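(* For a Banach space $E$ the following properties are equivalent: (a) $E$ has property $(V^* )$. (b) For any positive integer $k$ and any Banach space $F$, $\mathcal{P}_{uc*}(^kF,E)\subseteq\mathcal{P}_{wco}(^kF,E)$. (c) For some positive integer $k$, $\mathcal{P}_{uc*}(^k\ell_1,E)\subseteq\mathcal{P}_{wco}(^k\ell_1,E)$.
   Context: Banach spaces are real or complex ($E$, $F$, $\ell_1$ over the same field). $\mathcal{P}(^kF,E)$ is the space of continuous $k$-homogeneous polynomials from $F$ to $E$, and $\mathcal{P}(^kF)$ the Banach space of scalar-valued ones, with norm $\|Q\|=\sup_{\|x\|\le1}|Q(x)|$. A series $\sum x_i$ in a Banach space $X$ is weakly unconditionally Cauchy (w.u.C.) if $\sum_i|f(x_i)|<\infty$ for every $f\in X^*$; it is unconditionally converging (u.c.) if every subseries is norm convergent. A bounded linear operator between Banach spaces is unconditionally converging if it takes w.u.C. series into u.c. series. A set $A\subset E$ is a $(V^* )$ set if for every w.u.C. series $\sum_{n=1}^\infty f_n$ in $E^*$ one has $\lim_n\sup_{x\in A}|f_n(x)|=0$. $E$ has property $(V^* )$ if every $(V^* )$ set in $E$ is relatively weakly compact. For $P\in\mathcal{P}(^kF,E)$, its conjugate is the linear operator $P^*:E^*\to\mathcal{P}(^kF)$, $P^*f=f\circ P$. $\mathcal{P}_{uc*}(^kF,E)$ is the class of $P\in\mathcal{P}(^kF,E)$ such that $P^*$ is unconditionally converging. $\mathcal{P}_{wco}(^kF,E)$ is the class of $P\in\mathcal{P}(^kF,E)$ taking bounded subsets into relatively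 weakly compact subsets. *)

theory Defs
  imports "HOL-Analysis.Analysis" "HOL-Algebra.Module"
begin

text \<open>
  The scalar fields are \<open>\<real>\<close> and \<open>\<complex>\<close>, up to an isometric isomorphism of fields.
\<close>

class real_or_complex = real_normed_field +
  assumes real_or_complex:
    "(\<exists>\<phi> :: 'a \<Rightarrow> real. bij \<phi> \<and> \<phi> 1 = 1 \<and> (\<forall>x y. \<phi> (x + y) = \<phi> x + \<phi> y) \<and>
        (\<forall>x y. \<phi> (x * y) = \<phi> x * \<phi> y) \<and> (\<forall>x. norm (\<phi> x) = norm x)) \<or>
     (\<exists>\<phi> :: 'a \<Rightarrow> complex. bij \<phi> \<and> \<phi> 1 = 1 \<and> (\<forall>x y. \<phi> (x + y) = \<phi> x + \<phi> y) \<and>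
        (\<forall>x y. \<phi> (x * y) = \<phi> x * \<phi> y) \<and> (\<forall>x. norm (\<phi> x) = norm x))"

instance real :: real_or_complex
  by standard (rule disjI1, rule exI[of _ id], simp)

instance complex :: real_or_complex
  by standard (rule disjI2, rule exI[of _ id], simp)


section \<open>Normed and Banach spaces\<close>

text \<open>
  Spaces are carried by sets, so that one can quantify over them and so that duals and spaces of
  polynomials are again spaces.  The fields \<^term>\<open>mult\<close> and \<^term>\<open>one\<close>, which a module record
  inherits from the ring record, play no role.

  A quantifier over all spaces on subsets of a type \<open>'f\<close> ranges over all Banach spaces of cardinality
  at most that of \<open>'f\<close>, up to isometric isomorphism.  A nonzero Banach space has at least the
  cardinality of the continuum, and \<open>\<ell>\<^sub>1\<close> has exactly that cardinality; so \<open>'f\<close> is large enough to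
  host \<open>\<ell>\<^sub>1\<close> as soon as it hosts any nonzero Banach space.
\<close>

record ('k, 'v) nspace = "('k, 'v) module" +
  vnorm :: "'v \<Rightarrow> real"

definition scalars :: "('k::real_normed_field, 'k) nspace" where
  "scalars = \<lparr>carrier = UNIV, mult = (*), one = 1, zero = 0, add = (+), smult = (*), vnorm = norm\<rparr>"

locale normed_space = Module.module scalars V
  for V :: "('k::real_normed_field, 'v) nspace" (structure) +
  assumes vnorm_eq_0: "x \<in> carrier V \<Longrightarrow> vnorm V x = 0 \<longleftrightarrow> x = \<zero>"
    and vnorm_triangle:
      "\<lbrakk>x \<in> carrier V; y \<in> carrier V\<rbrakk> \<Longrightarrow> vnorm V (x \<oplus> y) \<le> vnorm V x + vnorm V y"
    and vnorm_smult: "x \<in> carrier V \<Longrightarrow> vnorm V (c \<odot> x) = norm c * vnorm V x"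

text \<open>The locale \<^locale>\<open>Metric_space\<close> asks for nonnegativity and symmetry off the carrier as well.\<close>

definition vdist :: "('k, 'v) nspace \<Rightarrow> 'v \<Rightarrow> 'v \<Rightarrow> real" where
  "vdist V x y = (if x \<in> carrier V \<and> y \<in> carrier V then vnorm V (x \<ominus>\<^bsub>V\<^esub> y) else 0)"

abbreviation norm_topology :: "('k, 'v) nspace \<Rightarrow> 'v topology" where
  "norm_topology V \<equiv> Metric_space.mtopology (carrier V) (vdist V)"

definition banach_space :: "('k::real_normed_field, 'v) nspace \<Rightarrow> bool" where
  "banach_space V \<longleftrightarrow> normed_space V \<and> Metric_space.mcomplete (carrier V) (vdist V)"

text \<open>
  Spaces of scalar functions on \<open>S\<close> with pointwise operations.  Functions are taken to be
  \<^const>\<open>undefined\<close> off \<open>S\<close>, so that equality is equality on \<open>S\<close>.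
\<close>

definition function_space ::
    "'x set \<Rightarrow> ('x \<Rightarrow> 'k) set \<Rightarrow> (('x \<Rightarrow> 'k) \<Rightarrow> real) \<Rightarrow> ('k::real_normed_field, 'x \<Rightarrow> 'k) nspace" where
  "function_space S C N =
     \<lparr>carrier = C, mult = undefined, one = undefined, zero = (\<lambda>x\<in>S. 0),
      add = (\<lambda>f g. \<lambda>x\<in>S. f x + g x), smult = (\<lambda>c f. \<lambda>x\<in>S. c * f x), vnorm = N\<rparr>"

definition ell1 :: "('k::real_normed_field, nat \<Rightarrow> 'k) nspace" where
  "ell1 = function_space UNIV {x. summable (\<lambda>n. norm (x n))} (\<lambda>x. \<Sum>n. norm (x n))"

definition sup_norm :: "('k, 'v) nspace \<Rightarrow> ('v \<Rightarrow> 'k::real_normed_field) \<Rightarrow> real" where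
  "sup_norm V f = (SUP x\<in>{x \<in> carrier V. vnorm V x \<le> 1}. norm (f x))"


section \<open>Linear operators and polynomials\<close>

definition linear_map :: "('k, 'v) nspace \<Rightarrow> ('k, 'w) nspace \<Rightarrow> ('v \<Rightarrow> 'w) \<Rightarrow> bool" where
  "linear_map V W T \<longleftrightarrow> T \<in> carrier V \<rightarrow> carrier W \<and>
     (\<forall>x\<in>carrier V. \<forall>y\<in>carrier V. T (x \<oplus>\<^bsub>V\<^esub> y) = T x \<oplus>\<^bsub>W\<^esub> T y) \<and>
     (\<forall>c. \<forall>x\<in>carrier V. T (c \<odot>\<^bsub>V\<^esub> x) = c \<odot>\<^bsub>W\<^esub> T x)"

definition bounded_linear_map :: "('k, 'v) nspace \<Rightarrow> ('k, 'w) nspace \<Rightarrow> ('v \<Rightarrow> 'w) \<Rightarrow> bool" where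
  "bounded_linear_map V W T \<longleftrightarrow>
     linear_map V W T \<and> (\<exists>C. \<forall>x\<in>carrier V. vnorm W (T x) \<le> C * vnorm V x)"

definition dual :: "('k::real_normed_field, 'v) nspace \<Rightarrow> ('k, 'v \<Rightarrow> 'k) nspace" where
  "dual V = function_space (carrier V)
     {f \<in> extensional (carrier V). bounded_linear_map V scalars f} (sup_norm V)"

definition multilinear_map ::
    "nat \<Rightarrow> ('k, 'v) nspace \<Rightarrow> ('k, 'w) nspace \<Rightarrow> ((nat \<Rightarrow> 'v) \<Rightarrow> 'w) \<Rightarrow> bool" where
  "multilinear_map k V W A \<longleftrightarrow>
     (\<forall>i<k. \<forall>x \<in> {..<k} \<rightarrow>\<^sub>E carrier V. linear_map V W (\<lambda>y. A (x(i := y))))"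

text \<open>
  A continuous \<open>k\<close>-homogeneous polynomial is the restriction to the diagonal of a continuous
  \<open>k\<close>-linear map.
\<close>

definition hom_polynomials :: "nat \<Rightarrow> ('k, 'v) nspace \<Rightarrow> ('k, 'w) nspace \<Rightarrow> ('v \<Rightarrow> 'w) set" where
  "hom_polynomials k V W = {P. \<exists>A. multilinear_map k V W A \<and>
     continuous_map (product_topology (\<lambda>_. norm_topology V) {..<k}) (norm_topology W) A \<and>
     P = (\<lambda>x\<in>carrier V. A (\<lambda>i\<in>{..<k}. x))}"

definition polynomial_space :: "nat \<Rightarrow> ('k::real_normed_field, 'v) nspace \<Rightarrow> ('k, 'v \<Rightarrow> 'k) nspace" where
  "polynomial_space k V = function_space (carrier V) (hom_polynomials k V scalars) (sup_norm V)"

definition conjugate ::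
    "('k::real_normed_field, 'v) nspace \<Rightarrow> ('v \<Rightarrow> 'w) \<Rightarrow> ('w \<Rightarrow> 'k) \<Rightarrow> ('v \<Rightarrow> 'k)" where
  "conjugate V P f = compose (carrier V) f P"


section \<open>Unconditional convergence and the weak topology\<close>

definition wuC_series :: "('k::real_normed_field, 'v) nspace \<Rightarrow> (nat \<Rightarrow> 'v) \<Rightarrow> bool" where
  "wuC_series V x \<longleftrightarrow> range x \<subseteq> carrier V \<and>
     (\<forall>f\<in>carrier (dual V). summable (\<lambda>i. norm (f (x i))))"

definition convergent_series :: "('k, 'v) nspace \<Rightarrow> (nat \<Rightarrow> 'v) \<Rightarrow> bool" where
  "convergent_series V x \<longleftrightarrow>
     (\<exists>l. limitin (norm_topology V) (\<lambda>n. finsum V x {..<n}) l sequentially)"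

definition uc_series :: "('k, 'v) nspace \<Rightarrow> (nat \<Rightarrow> 'v) \<Rightarrow> bool" where
  "uc_series V x \<longleftrightarrow> range x \<subseteq> carrier V \<and>
     (\<forall>r :: nat \<Rightarrow> nat. strict_mono r \<longrightarrow> convergent_series V (x \<circ> r))"

definition uc_operator ::
    "('k::real_normed_field, 'v) nspace \<Rightarrow> ('k, 'w) nspace \<Rightarrow> ('v \<Rightarrow> 'w) \<Rightarrow> bool" where
  "uc_operator V W T \<longleftrightarrow> bounded_linear_map V W T \<and>
     (\<forall>x. wuC_series V x \<longrightarrow> uc_series W (T \<circ> x))"

definition weak_topology :: "('k::real_normed_field, 'v) nspace \<Rightarrow> 'v topology" where
  "weak_topology V = topology_generated_by
     {{x \<in> carrier V. f x \<in> U} | f U. f \<in> carrier (dual V) \<and> open U}"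

definition relatively_weakly_compact :: "('k::real_normed_field, 'v) nspace \<Rightarrow> 'v set \<Rightarrow> bool" where
  "relatively_weakly_compact V A \<longleftrightarrow>
     A \<subseteq> carrier V \<and> compactin (weak_topology V) (weak_topology V closure_of A)"

text \<open>The supremum is taken in \<^typ>\<open>ennreal\<close>, as \<open>A\<close> is not assumed to be bounded.\<close>

definition V_star_set :: "('k::real_normed_field, 'v) nspace \<Rightarrow> 'v set \<Rightarrow> bool" where
  "V_star_set V A \<longleftrightarrow> A \<subseteq> carrier V \<and>
     (\<forall>f. wuC_series (dual V) f \<longrightarrow> (\<lambda>n. SUP x\<in>A. ennreal (norm (f n x))) \<longlonglongrightarrow> 0)"

definition property_V_star :: "('k::real_normed_field, 'v) nspace \<Rightarrow> bool" where
  "property_V_star V \<longleftrightarrow> (\<forall>A. V_star_set V A \<longrightarrow> relatively_weakly_compact V A)"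

definition P_uc_star ::
    "nat \<Rightarrow> ('k::real_normed_field, 'v) nspace \<Rightarrow> ('k, 'w) nspace \<Rightarrow> ('v \<Rightarrow> 'w) set" where
  "P_uc_star k F E =
     {P \<in> hom_polynomials k F E. uc_operator (dual E) (polynomial_space k F) (conjugate F P)}"

definition P_wco ::
    "nat \<Rightarrow> ('k::real_normed_field, 'v) nspace \<Rightarrow> ('k, 'w) nspace \<Rightarrow> ('v \<Rightarrow> 'w) set" where
  "P_wco k F E = {P \<in> hom_polynomials k F E.
     \<forall>B. Metric_space.mbounded (carrier F) (vdist F) B \<longrightarrow> relatively_weakly_compact E (P ` B)}"

end

theory Submission
  imports Defs
begin

text \<open>
  If \<open>P\<close> has an unconditionally converging conjugate, then \<open>P\<close> maps bounded sets to \<open>(V\<^sup>*)\<close> sets: for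
  a w.u.C. series of functionals \<open>f\<^sub>n\<close> the terms \<open>f\<^sub>n \<circ> P\<close> of an unconditionally converging series tend
  to \<open>0\<close> uniformly on the unit ball, and by homogeneity on every ball.  So property \<open>(V\<^sup>*)\<close> makes \<open>P\<close>
  weakly compact, for every degree and every domain (\<open>P_uc_star_subset_P_wco\<close>).

  Conversely let \<open>A\<close> be a \<open>(V\<^sup>*)\<close> set in \<open>E\<close>.  By Eberlein's theorem it is enough that every sequence
  \<open>s\<close> in \<open>A\<close> has a relatively weakly compact range, as \<open>A\<close> is bounded.  Let \<open>S\<close> be the operator from
  \<open>\<ell>\<^sub>1\<close> to \<open>E\<close> that sends the \<open>n\<close>-th unit vector to \<open>s n\<close>, let \<open>\<phi>\<close> be the functional that sums the
  coordinates, and put \<open>P x = \<phi> x ^ (k - 1) S x\<close>.  The conjugate of \<open>P\<close> sends \<open>f\<close> to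
  \<open>\<phi> ^ (k - 1) (f \<circ> S)\<close>.  On a \<open>(V\<^sup>*)\<close> set the partial sums of a w.u.C. series of functionals are
  uniformly Cauchy, since otherwise some blocks of the series would form a w.u.C. series that does not
  tend to \<open>0\<close> uniformly; hence the conjugate of \<open>P\<close> is unconditionally converging.  So \<open>P\<close> is weakly
  compact, and it maps the bounded set of the unit vectors onto the range of \<open>s\<close>
  (\<open>property_V_star_if_P_wco\<close>).  The domain enters only through its coordinates, so that the argument
  also covers a copy of \<open>\<ell>\<^sub>1\<close> on the type over which the Banach spaces \<open>F\<close> range.

  The functional analysis behind this is the Hahn-Banach theorem over both scalar fields
  (\<open>hahn_banach\<close>) and Eberlein's theorem (\<open>eberlein\<close>).  The latter combines Tychonoff's theorem with a
  gliding choice of points and functionals.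
\<close>

no_notation eq_closure_of (\<open>closure'_of\<index>\<close>)  (* so that closure_of has one reading *)


section \<open>The scalar field\<close>

lemma isometry_inverse_heine_borel:
  fixes \<phi> :: "'a::real_normed_field \<Rightarrow> 'b::{real_normed_vector, heine_borel}" and f :: "nat \<Rightarrow> 'a"
  assumes bij: "bij \<phi>" and add: "\<And>x y. \<phi> (x + y) = \<phi> x + \<phi> y"
    and iso: "\<And>x. norm (\<phi> x) = norm x" and bdd: "bounded (range f)"
  shows "\<exists>l r. strict_mono (r :: nat \<Rightarrow> nat) \<and> ((f \<circ> r) \<longlongrightarrow> l) sequentially"
proof -
  have diff: "\<phi> (x - y) = \<phi> x - \<phi> y" for x y
    using add[of "x - y" y] by simp
  have "bounded (range (\<phi> \<circ> f))"
    using bdd by (auto simp: bounded_iff iso)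
  then obtain l r where r: "strict_mono (r :: nat \<Rightarrow> nat)" and l: "((\<phi> \<circ> f) \<circ> r) \<longlonglongrightarrow> l"
    using bounded_imp_convergent_subsequence by blast
  have "norm ((f \<circ> r) n - inv_into UNIV \<phi> l) = norm (((\<phi> \<circ> f) \<circ> r) n - l)" for n
    using iso[of "(f \<circ> r) n - inv_into UNIV \<phi> l"] bij by (simp add: diff bij_is_surj surj_f_inv_f)
  then have "(f \<circ> r) \<longlonglongrightarrow> inv_into UNIV \<phi> l"
    using l by (simp add: LIMSEQ_iff)
  with r show ?thesis by blast
qed

text \<open>
  The Heine-Borel property provides the compact discs for Tychonoff's theorem; completeness of the
  scalars, which it implies, makes absolutely convergent scalar series converge.
\<close>

instance real_or_complex \<subseteq> heine_borel
proof
  fix f :: "nat \<Rightarrow> 'a" assume bdd: "bounded (range f)"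
  from real_or_complex show "\<exists>l r. strict_mono (r :: nat \<Rightarrow> nat) \<and> ((f \<circ> r) \<longlongrightarrow> l) sequentially"
    by (elim disjE exE conjE) (erule isometry_inverse_heine_borel; use bdd in auto)+
qed

instance real_or_complex \<subseteq> banach ..

text \<open>
  The two fields are treated at once: every scalar is recovered from the real parts of itself and
  of its product with \<open>\<iota>\<close>, where \<open>\<iota>\<close> is the imaginary unit over \<open>\<complex>\<close> and \<open>0\<close> over \<open>\<real>\<close>.
\<close>

lemma real_part:
  obtains re :: "'k::real_or_complex \<Rightarrow> real" and \<iota> :: 'k
  where "\<And>x y. re (x + y) = re x + re y" "\<And>r x. re (of_real r * x) = r * re x"
    "\<And>x. \<bar>re x\<bar> \<le> norm x" "\<And>a b. re (of_real a - \<iota> * of_real b) = a"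
    "\<And>x. x = of_real (re x) - \<iota> * of_real (re (\<iota> * x))"
    "\<iota> = 0 \<or> \<iota> * \<iota> = -1"
proof -
  from real_or_complex[where 'a = 'k] show ?thesis
  proof (elim disjE exE conjE)
    fix \<phi> :: "'k \<Rightarrow> real"
    assume \<phi>: "bij \<phi>" "\<phi> 1 = 1" "\<forall>x y. \<phi> (x + y) = \<phi> x + \<phi> y" "\<forall>x y. \<phi> (x * y) = \<phi> x * \<phi> y"
      "\<forall>x. norm (\<phi> x) = norm x"
    have diff: "\<phi> (x - y) = \<phi> x - \<phi> y" for x y
      using \<phi>(3)[rule_format, of "x - y" y] by simp
    \<comment> \<open>A real number is determined by its distances from \<open>0\<close> and \<open>1\<close>, which \<open>\<phi>\<close> preserves.\<close>
    have real: "\<phi> (of_real r) = r" for r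
    proof -
      have "\<bar>\<phi> (of_real r)\<bar> = \<bar>r\<bar>"
        using \<phi>(5)[rule_format, of "of_real r"] by simp
      moreover have "\<bar>\<phi> (of_real r) - 1\<bar> = \<bar>r - 1\<bar>"
        using \<phi>(5)[rule_format, of "of_real r - 1"] \<phi>(2) diff
        by (metis norm_of_real of_real_1 of_real_diff real_norm_def)
      ultimately show ?thesis by linarith
    qed
    show ?thesis
    proof (rule that[of \<phi> 0])
      fix x show "x = of_real (\<phi> x) - 0 * of_real (\<phi> (0 * x))"
        using real[of "\<phi> x"] \<phi>(1) by (simp add: bij_def inj_eq)
    qed (use \<phi> real in auto)
  next
    fix \<phi> :: "'k \<Rightarrow> complex"
    assume \<phi>: "bij \<phi>" "\<phi> 1 = 1" "\<forall>x y. \<phi> (x + y) = \<phi> x + \<phi> y" "\<forall>x y. \<phi> (x * y) = \<phi> x * \<phi> y"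
      "\<forall>x. norm (\<phi> x) = norm x"
    have diff: "\<phi> (x - y) = \<phi> x - \<phi> y" for x y
      using \<phi>(3)[rule_format, of "x - y" y] by simp
    have real: "\<phi> (of_real r) = of_real r" for r
    proof -
      have 1: "cmod (\<phi> (of_real r)) = \<bar>r\<bar>"
        using \<phi>(5)[rule_format, of "of_real r"] by simp
      have 2: "cmod (\<phi> (of_real r) - 1) = \<bar>r - 1\<bar>"
        using \<phi>(5)[rule_format, of "of_real r - 1"] \<phi>(2) diff
        by (metis norm_of_real of_real_1 of_real_diff)
      have "(Re (\<phi> (of_real r)))\<^sup>2 + (Im (\<phi> (of_real r)))\<^sup>2 = r\<^sup>2"
        using 1 by (metis cmod_power2 power2_abs)
      moreover have "(Re (\<phi> (of_real r)) - 1)\<^sup>2 + (Im (\<phi> (of_real r)))\<^sup>2 = (r - 1)\<^sup>2"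
        using 2 cmod_power2[of "\<phi> (of_real r) - 1"] by simp
      ultimately have "Re (\<phi> (of_real r)) = r" "(Im (\<phi> (of_real r)))\<^sup>2 = 0"
        by (auto simp: power2_eq_square algebra_simps)
      then show ?thesis by (simp add: complex_eq_iff)
    qed
    define \<iota> where "\<iota> = inv_into UNIV \<phi> \<i>"
    have \<iota>: "\<phi> \<iota> = \<i>" using \<phi>(1) by (simp add: \<iota>_def bij_is_surj surj_f_inv_f)
    have inj: "x = y" if "\<phi> x = \<phi> y" for x y using that \<phi>(1) by (simp add: bij_def inj_eq)
    have minus: "\<phi> (- x) = - \<phi> x" for x
      using diff[of 0 x] diff[of 0 0] by simp
    show ?thesis
    proof (rule that[of "\<lambda>x. Re (\<phi> x)" \<iota>])
      show "x = of_real (Re (\<phi> x)) - \<iota> * of_real (Re (\<phi> (\<iota> * x)))" for x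
        by (rule inj) (simp add: diff \<phi>(3,4) \<iota> real complex_eq_iff)
      show "\<iota> = 0 \<or> \<iota> * \<iota> = -1"
        by (rule disjI2, rule inj) (simp add: \<phi> \<iota> minus)
      show "Re (\<phi> (of_real a - \<iota> * of_real b)) = a" for a b
        by (simp add: diff \<phi>(4) \<iota> real)
      show "\<bar>Re (\<phi> x)\<bar> \<le> norm x" for x
        using abs_Re_le_cmod[of "\<phi> x"] \<phi>(5) by simp
    qed (use \<phi> real in auto)
  qed
qed


section \<open>Normed spaces on carriers\<close>

lemma scalars_simps [simp]:
  "carrier scalars = UNIV" "a \<oplus>\<^bsub>scalars\<^esub> b = a + b" "a \<otimes>\<^bsub>scalars\<^esub> b = a * b"
  "\<zero>\<^bsub>scalars\<^esub> = 0" "\<one>\<^bsub>scalars\<^esub> = 1" "a \<odot>\<^bsub>scalars\<^esub> b = a * b" "vnorm scalars = norm"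
  by (simp_all add: scalars_def)

lemma cring_scalars: "cring (scalars :: ('k::real_normed_field, 'k) nspace)"
proof (rule cringI)
  show "abelian_group (scalars :: ('k, 'k) nspace)"
    by (rule abelian_groupI) (auto simp: algebra_simps intro: exI[of _ "- _"] add.left_inverse)
  show "comm_monoid (scalars :: ('k, 'k) nspace)"
    by (rule comm_monoidI) auto
qed (auto simp: algebra_simps)

lemma normed_spaceI:
  fixes V :: "('k::real_normed_field, 'v) nspace" (structure)
  assumes add_closed: "\<And>x y. x \<in> carrier V \<Longrightarrow> y \<in> carrier V \<Longrightarrow> x \<oplus> y \<in> carrier V"
    and smult_closed: "\<And>c x. x \<in> carrier V \<Longrightarrow> c \<odot> x \<in> carrier V"
    and zero: "\<zero> \<in> carrier V"
    and assoc: "\<And>x y z. x \<in> carrier V \<Longrightarrow> y \<in> carrier V \<Longrightarrow> z \<in> carrier V \<Longrightarrow>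
      (x \<oplus> y) \<oplus> z = x \<oplus> (y \<oplus> z)"
    and comm: "\<And>x y. x \<in> carrier V \<Longrightarrow> y \<in> carrier V \<Longrightarrow> x \<oplus> y = y \<oplus> x"
    and zero_add: "\<And>x. x \<in> carrier V \<Longrightarrow> \<zero> \<oplus> x = x"
    and smult_0: "\<And>x. x \<in> carrier V \<Longrightarrow> 0 \<odot> x = \<zero>"
    and smult_1: "\<And>x. x \<in> carrier V \<Longrightarrow> 1 \<odot> x = x"
    and smult_add_left: "\<And>a b x. x \<in> carrier V \<Longrightarrow> (a + b) \<odot> x = a \<odot> x \<oplus> b \<odot> x"
    and smult_add_right: "\<And>a x y. x \<in> carrier V \<Longrightarrow> y \<in> carrier V \<Longrightarrow>
      a \<odot> (x \<oplus> y) = a \<odot> x \<oplus> a \<odot> y"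
    and smult_smult: "\<And>a b x. x \<in> carrier V \<Longrightarrow> a \<odot> (b \<odot> x) = (a * b) \<odot> x"
    and norm_eq_0: "\<And>x. x \<in> carrier V \<Longrightarrow> vnorm V x = 0 \<Longrightarrow> x = \<zero>"
    and norm_triangle: "\<And>x y. x \<in> carrier V \<Longrightarrow> y \<in> carrier V \<Longrightarrow>
      vnorm V (x \<oplus> y) \<le> vnorm V x + vnorm V y"
    and norm_smult: "\<And>c x. x \<in> carrier V \<Longrightarrow> vnorm V (c \<odot> x) = norm c * vnorm V x"
  shows "normed_space V"
proof -
  have "(-1) \<odot> x \<oplus> x = \<zero>" if "x \<in> carrier V" for x
    using smult_add_left[OF that, of "-1" 1] that by (simp add: smult_0 smult_1)
  then have "abelian_group V"
    by (intro abelian_groupI add_closed zero assoc comm zero_add bexI) (assumption | rule smult_closed)+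
  then have "Module.module scalars V"
    by (intro moduleI cring_scalars) (use assms in auto)
  moreover have "vnorm V \<zero> = 0"
    using norm_smult[OF zero, of 0] by (simp add: smult_0 zero)
  ultimately show ?thesis
    by (auto simp: normed_space_def normed_space_axioms_def intro: assms)
qed

lemma linear_map_scalars_iff:
  "linear_map V scalars f \<longleftrightarrow>
     (\<forall>x\<in>carrier V. \<forall>y\<in>carrier V. f (x \<oplus>\<^bsub>V\<^esub> y) = f x + f y) \<and>
     (\<forall>c. \<forall>x\<in>carrier V. f (c \<odot>\<^bsub>V\<^esub> x) = c * f x)"
  by (simp add: linear_map_def)

context normed_space
begin

lemma smult_closed' [simp, intro]: "x \<in> carrier V \<Longrightarrow> c \<odot> x \<in> carrier V"
  by simp

lemma smult_add_left: "x \<in> carrier V \<Longrightarrow> (a + b) \<odot> x = a \<odot> x \<oplus> b \<odot> x"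
  using smult_l_distr[of a b x] by simp

lemma smult_add_right:
  "x \<in> carrier V \<Longrightarrow> y \<in> carrier V \<Longrightarrow> a \<odot> (x \<oplus> y) = a \<odot> x \<oplus> a \<odot> y"
  using smult_r_distr[of a x y] by simp

lemma smult_smult: "x \<in> carrier V \<Longrightarrow> a \<odot> (b \<odot> x) = (a * b) \<odot> x"
  using smult_assoc1[of a b x] by simp

lemma smult_1 [simp]: "x \<in> carrier V \<Longrightarrow> 1 \<odot> x = x"
  using smult_one[of x] by simp

lemma smult_0 [simp]: "x \<in> carrier V \<Longrightarrow> 0 \<odot> x = \<zero>"
  using smult_l_null[of x] by simp

lemma smult_zero [simp]: "c \<odot> \<zero> = \<zero>"
  using smult_r_null[of c] by simp

lemma uminus_eq_smult: "x \<in> carrier V \<Longrightarrow> \<ominus> x = (-1) \<odot> x"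
proof -
  assume x: "x \<in> carrier V"
  have "(-1) \<odot> x \<oplus> x = \<zero>"
    using smult_add_left[OF x, of "-1" 1] x by simp
  then show ?thesis using x by (metis M.minus_equality smult_closed')
qed

lemma minus_eq_smult: "x \<in> carrier V \<Longrightarrow> y \<in> carrier V \<Longrightarrow> x \<ominus> y = x \<oplus> (-1) \<odot> y"
  by (simp add: a_minus_def uminus_eq_smult)

lemma vnorm_zero [simp]: "vnorm V \<zero> = 0"
  by (simp add: vnorm_eq_0)

lemma vnorm_nonneg [simp]: "x \<in> carrier V \<Longrightarrow> 0 \<le> vnorm V x"
proof -
  assume x: "x \<in> carrier V"
  have "x \<oplus> (-1) \<odot> x = \<zero>"
    using smult_add_left[OF x, of 1 "-1"] x by simp
  then show ?thesis
    using vnorm_triangle[OF x smult_closed'[OF x, of "-1"]] x by (simp add: vnorm_smult)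
qed

lemma vnorm_minus_commute:
  assumes "x \<in> carrier V" "y \<in> carrier V" shows "vnorm V (x \<ominus> y) = vnorm V (y \<ominus> x)"
proof -
  have "y \<ominus> x = (-1) \<odot> (x \<ominus> y)"
    using assms by (simp add: minus_eq_smult smult_add_right smult_smult M.a_comm)
  then show ?thesis using assms by (simp add: vnorm_smult)
qed

lemma minus_add_minus:
  assumes "x \<in> carrier V" "y \<in> carrier V" "z \<in> carrier V"
  shows "(x \<ominus> y) \<oplus> (y \<ominus> z) = x \<ominus> z"
  using assms
  by (metis M.add.inv_closed M.add.m_assoc M.add.m_closed M.l_neg M.l_zero a_minus_def)

lemma minus_add_cancel:
  assumes "x \<in> carrier V" "y \<in> carrier V" shows "(x \<ominus> y) \<oplus> y = x"
  using minus_add_minus[OF assms M.zero_closed] assms by (simp add: minus_eq_smult)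

lemma vnorm_diff_triangle:
  assumes "x \<in> carrier V" "y \<in> carrier V" "z \<in> carrier V"
  shows "vnorm V (x \<ominus> z) \<le> vnorm V (x \<ominus> y) + vnorm V (y \<ominus> z)"
  using vnorm_triangle[of "x \<ominus> y" "y \<ominus> z"] assms by (simp add: minus_add_minus)

lemma minus_eq_zero_iff:
  assumes "x \<in> carrier V" "y \<in> carrier V" shows "x \<ominus> y = \<zero> \<longleftrightarrow> x = y"
proof
  assume "x \<ominus> y = \<zero>"
  then show "x = y" using minus_add_cancel[OF assms] assms by simp
next
  assume "x = y"
  then show "x \<ominus> y = \<zero>"
    using assms smult_add_left[of x 1 "-1"] by (simp add: minus_eq_smult)
qed

lemma vdist_eq [simp]: "x \<in> carrier V \<Longrightarrow> y \<in> carrier V \<Longrightarrow> vdist V x y = vnorm V (x \<ominus> y)"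
  by (simp add: vdist_def)

lemma Metric_space_vdist: "Metric_space (carrier V) (vdist V)"
proof
  show "0 \<le> vdist V x y" for x y by (simp add: vdist_def)
  show "vdist V x y = vdist V y x" for x y by (simp add: vdist_def vnorm_minus_commute)
  show "(vdist V x y = 0) = (x = y)" if "x \<in> carrier V" "y \<in> carrier V" for x y
    using that by (simp add: vnorm_eq_0 minus_eq_zero_iff)
  show "vdist V x z \<le> vdist V x y + vdist V y z"
    if "x \<in> carrier V" "y \<in> carrier V" "z \<in> carrier V" for x y z
    using that by (simp add: vnorm_diff_triangle)
qed

end

lemma normed_space_scalars: "normed_space (scalars :: ('k::real_normed_field, 'k) nspace)"
  by (rule normed_spaceI) (auto simp: algebra_simps norm_triangle_ineq norm_mult)

lemma vdist_scalars [simp]: "vdist scalars = (dist :: 'k::real_normed_field \<Rightarrow> _)"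
proof (intro ext)
  fix x y :: 'k
  interpret normed_space "scalars :: ('k, 'k) nspace" by (rule normed_space_scalars)
  show "vdist scalars x y = dist x y"
    by (simp add: minus_eq_smult dist_norm)
qed

lemma norm_topology_scalars [simp]:
  "norm_topology (scalars :: ('k::real_normed_field, 'k) nspace) = euclidean"
  by simp


section \<open>The Hahn-Banach theorem\<close>

definition sublinear :: "('k::real_normed_field, 'v) nspace \<Rightarrow> ('v \<Rightarrow> real) \<Rightarrow> bool" where
  "sublinear V q \<longleftrightarrow>
     (\<forall>x\<in>carrier V. \<forall>y\<in>carrier V. q (x \<oplus>\<^bsub>V\<^esub> y) \<le> q x + q y) \<and>
     (\<forall>t\<ge>0. \<forall>x\<in>carrier V. q (of_real t \<odot>\<^bsub>V\<^esub> x) = t * q x)"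

context normed_space
begin

lemma sublinear_zero: "sublinear V q \<Longrightarrow> q \<zero> = 0"
  unfolding sublinear_def by (metis M.zero_closed mult_zero_left order_refl smult_zero)

lemma sublinear_lower:
  assumes "sublinear V q" "x \<in> carrier V"
  shows "- q ((-1) \<odot> x) \<le> q x"
proof -
  have "x \<oplus> (-1) \<odot> x = \<zero>"
    using smult_add_left[OF assms(2), of 1 "-1"] assms(2) by simp
  then have "0 \<le> q x + q ((-1) \<odot> x)"
    using assms sublinear_zero[OF assms(1)] unfolding sublinear_def by (metis smult_closed')
  then show ?thesis by simp
qed

text \<open>
  Lowering \<open>q\<close> along a convex cone \<open>C\<close> of pairs \<open>(y, s)\<close> with \<open>s \<le> q y\<close>: the infimum of
  \<open>q (x \<oplus> y) - s\<close> over \<open>C\<close> is again sublinear, because \<open>- q (- x)\<close> is a lower bound.  With the graph of a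
  linear functional as \<open>C\<close> this is the first step of the Hahn-Banach theorem; with the ray through
  \<open>(y, q y)\<close> it shows that a minimal sublinear functional is odd.
\<close>

lemma sublinear_inf_convolution:
  assumes q: "sublinear V q" and C: "C \<subseteq> carrier V \<times> UNIV" "C \<noteq> {}"
    and C_add: "\<And>y s z t. (y, s) \<in> C \<Longrightarrow> (z, t) \<in> C \<Longrightarrow> (y \<oplus> z, s + t) \<in> C"
    and C_scale: "\<And>r y s. 0 \<le> r \<Longrightarrow> (y, s) \<in> C \<Longrightarrow> (of_real r \<odot> y, r * s) \<in> C"
    and C_le: "\<And>y s. (y, s) \<in> C \<Longrightarrow> s \<le> q y"
  obtains q' where "sublinear V q'" "\<And>x. x \<in> carrier V \<Longrightarrow> q' x \<le> q x"
    "\<And>y s. (y, s) \<in> C \<Longrightarrow> q' ((-1) \<odot> y) \<le> - s"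
proof -
  define q' where "q' x = (INF (y, s)\<in>C. q (x \<oplus> y) - s)" for x
  have CV: "y \<in> carrier V" if "(y, s) \<in> C" for y s using C(1) that by auto
  have q_add: "q (x \<oplus> y) \<le> q x + q y" if "x \<in> carrier V" "y \<in> carrier V" for x y
    using q that by (simp add: sublinear_def)
  have q_scale: "q (of_real t \<odot> x) = t * q x" if "0 \<le> t" "x \<in> carrier V" for t x
    using q that by (simp add: sublinear_def)
  have lower: "- q ((-1) \<odot> x) \<le> q (x \<oplus> y) - s" if "x \<in> carrier V" "(y, s) \<in> C" for x y s
  proof -
    have y: "y \<in> carrier V" using CV that by blast
    have "y = (x \<oplus> y) \<oplus> (-1) \<odot> x"
      using that(1) y smult_add_left[OF that(1), of 1 "-1"]
      by (metis M.add.m_assoc M.add.m_comm M.r_zero add.right_inverse smult_0 smult_1 smult_closed')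
    then have "q y \<le> q (x \<oplus> y) + q ((-1) \<odot> x)"
      using q_add[of "x \<oplus> y" "(-1) \<odot> x"] that y by simp
    then show ?thesis using C_le[OF that(2)] by simp
  qed
  have bdd: "bdd_below ((\<lambda>(y, s). q (x \<oplus> y) - s) ` C)" if "x \<in> carrier V" for x
    by (rule bdd_belowI[of _ "- q ((-1) \<odot> x)"]) (use lower that in auto)
  have q'_le: "q' x \<le> q (x \<oplus> y) - s" if "x \<in> carrier V" "(y, s) \<in> C" for x y s
    unfolding q'_def by (rule cINF_lower2[OF bdd that(2)]) (use that in auto)
  have q'_ge: "a \<le> q' x" if "\<And>y s. (y, s) \<in> C \<Longrightarrow> a \<le> q (x \<oplus> y) - s" for a x
    unfolding q'_def by (rule cINF_greatest[OF C(2)]) (use that in auto)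
  obtain y0 s0 where "(y0, s0) \<in> C" using C(2) by auto
  then have C0: "(\<zero>, 0) \<in> C" using C_scale[of 0 y0 s0] CV by simp
  have q'_q: "q' x \<le> q x" if "x \<in> carrier V" for x
    using q'_le[OF that C0] that by simp
  have q'_0: "q' \<zero> = 0"
  proof (rule antisym)
    show "q' \<zero> \<le> 0" using q'_q[of \<zero>] sublinear_zero[OF q] by simp
    show "0 \<le> q' \<zero>" by (rule q'_ge) (use C_le CV in auto)
  qed
  have q'_add: "q' (x \<oplus> y) \<le> q' x + q' y" if x: "x \<in> carrier V" and y: "y \<in> carrier V" for x y
  proof -
    have "q' (x \<oplus> y) - (q (y \<oplus> b) - t) \<le> q (x \<oplus> a) - s" if a: "(a, s) \<in> C" and b: "(b, t) \<in> C" for a s b t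
    proof -
      have ab: "a \<in> carrier V" "b \<in> carrier V" using CV a b by auto
      have "q' (x \<oplus> y) \<le> q ((x \<oplus> y) \<oplus> (a \<oplus> b)) - (s + t)"
        using q'_le[OF _ C_add[OF a b]] x y by simp
      also have "(x \<oplus> y) \<oplus> (a \<oplus> b) = (x \<oplus> a) \<oplus> (y \<oplus> b)"
        using x y ab by (simp add: M.a_ac)
      finally show ?thesis using q_add[of "x \<oplus> a" "y \<oplus> b"] x y ab by simp
    qed
    then have "q' (x \<oplus> y) - (q (y \<oplus> b) - t) \<le> q' x" if "(b, t) \<in> C" for b t
      using that by (intro q'_ge) auto
    then have "q' (x \<oplus> y) - q' x \<le> q' y"
      by (intro q'_ge) (auto simp: algebra_simps)
    then show ?thesis by simp
  qed
  have scale_le: "q' (of_real t \<odot> x) \<le> t * q' x" if t: "0 < t" and x: "x \<in> carrier V" for t x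
  proof -
    have "q' (of_real t \<odot> x) / t \<le> q (x \<oplus> y) - s" if "(y, s) \<in> C" for y s
    proof -
      have y: "y \<in> carrier V" using CV that by blast
      have "q' (of_real t \<odot> x) \<le> q (of_real t \<odot> x \<oplus> of_real t \<odot> y) - t * s"
        using q'_le[OF _ C_scale[OF _ that]] t x by simp
      also have "\<dots> = t * (q (x \<oplus> y) - s)"
        using q_scale[of t "x \<oplus> y"] t x y by (simp add: smult_add_right algebra_simps)
      finally show ?thesis using t by (simp add: field_simps)
    qed
    then have "q' (of_real t \<odot> x) / t \<le> q' x" by (rule q'_ge)
    then show ?thesis using t by (simp add: field_simps)
  qed
  have q'_scale: "q' (of_real t \<odot> x) = t * q' x" if t: "0 \<le> t" and x: "x \<in> carrier V" for t x
  proof (cases "t = 0")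
    case True then show ?thesis using x q'_0 by simp
  next
    case False
    then have "0 < t" using t by simp
    have "of_real (1 / t) \<odot> (of_real t \<odot> x) = x"
      using False x by (simp add: smult_smult flip: of_real_mult)
    then have "q' x \<le> q' (of_real t \<odot> x) / t"
      using scale_le[of "1 / t" "of_real t \<odot> x"] x \<open>0 < t\<close> by simp
    then show ?thesis using scale_le[OF \<open>0 < t\<close> x] \<open>0 < t\<close> by (simp add: field_simps)
  qed
  show thesis
  proof (rule that[of q'])
    show "sublinear V q'" unfolding sublinear_def using q'_add q'_scale by blast
    show "q' ((-1) \<odot> y) \<le> - s" if "(y, s) \<in> C" for y s
    proof -
      have y: "y \<in> carrier V" using CV that by blast
      have "(-1) \<odot> y \<oplus> y = \<zero>" using smult_add_left[OF y, of "-1" 1] y by simp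
      then show ?thesis using q'_le[OF _ that, of "(-1) \<odot> y"] y sublinear_zero[OF q] by simp
    qed
  qed (rule q'_q)
qed

text \<open>
  Zorn's lemma applies because the pointwise infimum of a chain below \<open>p\<close> is finite: \<open>- p (- x)\<close> bounds
  the chain from below.
\<close>

lemma sublinear_minimal:
  assumes p: "sublinear V p"
  obtains f where "sublinear V f" "\<And>x. x \<in> carrier V \<Longrightarrow> f x \<le> p x"
    "\<And>q x. \<lbrakk>sublinear V q; \<And>y. y \<in> carrier V \<Longrightarrow> q y \<le> f y; x \<in> carrier V\<rbrakk> \<Longrightarrow> q x = f x"
proof -
  \<comment> \<open>Prescribing the values off the carrier keeps the infimum of a chain finite there as well.\<close>
  define A where "A = {q. sublinear V q \<and> (\<forall>x\<in>carrier V. q x \<le> p x) \<and> (\<forall>x. x \<notin> carrier V \<longrightarrow> q x = p x)}"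
  have "\<exists>m\<in>A. \<forall>a\<in>A. a \<le> m \<longrightarrow> a = m"
  proof (rule predicate_Zorn[of A "\<lambda>q r. r \<le> q"])
    show "partial_order_on A (relation_of (\<lambda>q r. r \<le> q) A)"
      by (rule partial_order_on_relation_ofI) auto
    fix C assume "C \<in> Chains (relation_of (\<lambda>q r. r \<le> q) A)"
    then have CA: "C \<subseteq> A" and chain: "\<And>q r. q \<in> C \<Longrightarrow> r \<in> C \<Longrightarrow> q \<le> r \<or> r \<le> q"
      by (auto simp: Chains_def relation_of_def)
    show "\<exists>u\<in>A. \<forall>a\<in>C. u \<le> a"
    proof (cases "C = {}")
      case True
      have "p \<in> A" using p by (simp add: A_def)
      with True show ?thesis by auto
    next
      case False
      define u where "u x = (if x \<in> carrier V then INF q\<in>C. q x else p x)" for x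
      have bdd: "bdd_below ((\<lambda>q. q x) ` C)" if x: "x \<in> carrier V" for x
      proof (rule bdd_belowI[of _ "- p ((-1) \<odot> x)"])
        fix a assume "a \<in> (\<lambda>q. q x) ` C"
        then obtain q where "q \<in> A" "a = q x" using CA by auto
        then show "- p ((-1) \<odot> x) \<le> a"
          using sublinear_lower[of q x] x by (simp add: A_def) (meson neg_le_iff_le order_trans smult_closed')
      qed
      have u_le: "u x \<le> q x" if "q \<in> C" "x \<in> carrier V" for q x
        using cINF_lower[OF bdd that(1)] that by (simp add: u_def)
      have u_ge: "a \<le> u x" if "x \<in> carrier V" "\<And>q. q \<in> C \<Longrightarrow> a \<le> q x" for a x
        using cINF_greatest[OF False, of a "\<lambda>q. q x"] that by (simp add: u_def)
      have sub: "sublinear V q" if "q \<in> C" for q using CA that by (auto simp: A_def)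
      have "u (x \<oplus> y) \<le> u x + u y" if x: "x \<in> carrier V" and y: "y \<in> carrier V" for x y
      proof -
        have *: "u (x \<oplus> y) - r y \<le> q x" if qr: "q \<in> C" "r \<in> C" for q r
        proof -
          obtain s where s: "s \<in> C" "s \<le> q" "s \<le> r" using chain[OF qr] qr by auto
          have "u (x \<oplus> y) \<le> s (x \<oplus> y)" using u_le[OF s(1)] x y by simp
          also have "\<dots> \<le> s x + s y" using sub[OF s(1)] x y by (simp add: sublinear_def)
          also have "\<dots> \<le> q x + r y" using s by (simp add: add_mono le_funD)
          finally show ?thesis by simp
        qed
        have "u (x \<oplus> y) - r y \<le> u x" if "r \<in> C" for r
          by (rule u_ge[OF x]) (use * that in auto)
        then have "u (x \<oplus> y) - u x \<le> u y"
          by (intro u_ge[OF y]) (auto simp: algebra_simps)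
        then show ?thesis by simp
      qed
      moreover have "u (of_real t \<odot> x) = t * u x" if t: "0 \<le> t" and x: "x \<in> carrier V" for t x
      proof -
        have "u (of_real t \<odot> x) = (INF q\<in>C. t * q x)"
          using t x sub by (auto simp: u_def sublinear_def intro!: INF_cong)
        also have "\<dots> = t * u x"
        proof (cases "t = 0")
          case True then show ?thesis using False by simp
        next
          case False': False
          show ?thesis
          proof (rule antisym)
            have bt: "bdd_below ((\<lambda>q. t * q x) ` C)"
              using bdd[OF x] t unfolding bdd_below_def by (auto intro!: mult_left_mono)
            have "(INF q\<in>C. t * q x) / t \<le> u x"
              by (rule u_ge[OF x]) (use cINF_lower[OF bt] t False' in \<open>simp add: field_simps\<close>)
            then show "(INF q\<in>C. t * q x) \<le> t * u x" using t False' by (simp add: field_simps)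
            show "t * u x \<le> (INF q\<in>C. t * q x)"
              by (rule cINF_greatest[OF False]) (use u_le[OF _ x] t in \<open>simp add: mult_left_mono\<close>)
          qed
        qed
        finally show ?thesis .
      qed
      ultimately have "sublinear V u" by (simp add: sublinear_def)
      moreover have "u x \<le> p x" if "x \<in> carrier V" for x
      proof -
        obtain q where "q \<in> C" using False by auto
        then show ?thesis using u_le[of q x] that CA by (force simp: A_def)
      qed
      ultimately have "u \<in> A" by (simp add: A_def u_def)
      moreover have "u \<le> a" if "a \<in> C" for a
        using u_le[OF that] CA that by (auto simp: A_def le_fun_def u_def)
      ultimately show ?thesis by blast
    qed
  qed
  then obtain m where m: "m \<in> A" and min: "\<And>a. a \<in> A \<Longrightarrow> a \<le> m \<Longrightarrow> a = m" by blast
  show thesis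
  proof (rule that[of m])
    fix q x assume q: "sublinear V q" "\<And>y. y \<in> carrier V \<Longrightarrow> q y \<le> m y" and x: "x \<in> carrier V"
    define q' where "q' y = (if y \<in> carrier V then q y else p y)" for y
    have 1: "sublinear V q'" using q(1) by (simp add: sublinear_def q'_def)
    have 2: "q' y \<le> p y" for y
    proof (cases "y \<in> carrier V")
      case True then show ?thesis using q(2)[OF True] m by (force simp: A_def q'_def)
    qed (simp add: q'_def)
    have "q' y = p y" if "y \<notin> carrier V" for y using that by (simp add: q'_def)
    with 1 2 have "q' \<in> A" by (simp add: A_def)
    moreover have "q' \<le> m" using q(2) m by (auto simp: le_fun_def q'_def A_def)
    ultimately have "q' = m" by (rule min)
    then show "q x = m x" using x by (metis q'_def)
  qed (use m in \<open>auto simp: A_def\<close>)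
qed

lemma sublinear_minimal_linear:
  assumes f: "sublinear V f"
    and min: "\<And>q x. \<lbrakk>sublinear V q; \<And>y. y \<in> carrier V \<Longrightarrow> q y \<le> f y; x \<in> carrier V\<rbrakk> \<Longrightarrow> q x = f x"
  shows "x \<in> carrier V \<Longrightarrow> y \<in> carrier V \<Longrightarrow> f (x \<oplus> y) = f x + f y"
    and "x \<in> carrier V \<Longrightarrow> f (of_real r \<odot> x) = r * f x"
proof -
  have neg: "f ((-1) \<odot> y) = - f y" if y: "y \<in> carrier V" for y
  proof (rule antisym)
    define C where "C = {(of_real t \<odot> y, t * f y) |t. 0 \<le> t}"
    obtain q where q: "sublinear V q" "\<And>x. x \<in> carrier V \<Longrightarrow> q x \<le> f x"
      and qC: "\<And>z s. (z, s) \<in> C \<Longrightarrow> q ((-1) \<odot> z) \<le> - s"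
    proof (rule sublinear_inf_convolution[OF f, of C])
      show "C \<subseteq> carrier V \<times> UNIV" using y by (auto simp: C_def)
      show "C \<noteq> {}" by (auto simp: C_def)
      show "(a \<oplus> b, s + t) \<in> C" if ab: "(a, s) \<in> C" "(b, t) \<in> C" for a s b t
      proof -
        obtain u v where "0 \<le> u" "0 \<le> v" "a = of_real u \<odot> y" "s = u * f y" "b = of_real v \<odot> y" "t = v * f y"
          using ab by (auto simp: C_def)
        then have "a \<oplus> b = of_real (u + v) \<odot> y" "s + t = (u + v) * f y" "0 \<le> u + v"
          using y by (simp_all add: smult_add_left algebra_simps)
        then show ?thesis unfolding C_def by blast
      qed
      show "(of_real r \<odot> a, r * s) \<in> C" if r: "0 \<le> r" and a: "(a, s) \<in> C" for r a s
      proof -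
        obtain u where "0 \<le> u" "a = of_real u \<odot> y" "s = u * f y"
          using a by (auto simp: C_def)
        then have "of_real r \<odot> a = of_real (r * u) \<odot> y" "r * s = (r * u) * f y" "0 \<le> r * u"
          using y r by (simp_all add: smult_smult)
        then show ?thesis unfolding C_def by blast
      qed
      show "s \<le> f a" if "(a, s) \<in> C" for a s
        using that y f by (auto simp: C_def sublinear_def)
    qed blast
    have "(y, f y) \<in> C" unfolding C_def using y by (auto intro!: exI[of _ 1])
    then have "q ((-1) \<odot> y) \<le> - f y" by (rule qC)
    moreover have "q ((-1) \<odot> y) = f ((-1) \<odot> y)" by (rule min[OF q]) (use y in auto)
    ultimately show "f ((-1) \<odot> y) \<le> - f y" by simp
    show "- f y \<le> f ((-1) \<odot> y)" using sublinear_lower[OF f y] by simp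
  qed
  have sub: "f (x \<oplus> y) \<le> f x + f y" if "x \<in> carrier V" "y \<in> carrier V" for x y
    using f that by (simp add: sublinear_def)
  show "f (x \<oplus> y) = f x + f y" if x: "x \<in> carrier V" and y: "y \<in> carrier V" for x y
  proof (rule antisym[OF sub[OF x y]])
    have "f ((-1) \<odot> (x \<oplus> y)) \<le> f ((-1) \<odot> x) + f ((-1) \<odot> y)"
      using sub[of "(-1) \<odot> x" "(-1) \<odot> y"] x y by (simp add: smult_add_right)
    then show "f x + f y \<le> f (x \<oplus> y)" using neg x y by simp
  qed
  show "f (of_real r \<odot> x) = r * f x" if x: "x \<in> carrier V" for x
  proof (cases "0 \<le> r")
    case True then show ?thesis using f x by (simp add: sublinear_def)
  next
    case False
    have "of_real r \<odot> x = (-1) \<odot> (of_real (- r) \<odot> x)" using x by (simp add: smult_smult)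
    then have "f (of_real r \<odot> x) = - f (of_real (- r) \<odot> x)" using neg x by simp
    moreover have "f (of_real (- r) \<odot> x) = - r * f x"
      using f x False unfolding sublinear_def by (metis less_eq_real_def neg_0_le_iff_le not_le)
    ultimately show ?thesis by simp
  qed
qed

text \<open>
  Lower \<open>p\<close> along the graph of \<open>g\<close> and take a minimal sublinear functional below the result.  It is
  linear and at most \<open>g\<close> on \<open>N\<close>; as \<open>N\<close> is closed under negation, it equals \<open>g\<close> there.
\<close>

lemma hahn_banach_real:
  assumes p: "sublinear V p" and N: "N \<subseteq> carrier V" "N \<noteq> {}"
    and N_add: "\<And>x y. x \<in> N \<Longrightarrow> y \<in> N \<Longrightarrow> x \<oplus> y \<in> N"
    and N_scale: "\<And>r x. x \<in> N \<Longrightarrow> of_real r \<odot> x \<in> N"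
    and g_add: "\<And>x y. x \<in> N \<Longrightarrow> y \<in> N \<Longrightarrow> g (x \<oplus> y) = g x + g y"
    and g_scale: "\<And>r x. x \<in> N \<Longrightarrow> g (of_real r \<odot> x) = r * g x"
    and g_le: "\<And>x. x \<in> N \<Longrightarrow> g x \<le> p x"
  obtains f where "\<And>x y. x \<in> carrier V \<Longrightarrow> y \<in> carrier V \<Longrightarrow> f (x \<oplus> y) = f x + f y"
    "\<And>r x. x \<in> carrier V \<Longrightarrow> f (of_real r \<odot> x) = r * f x"
    "\<And>x. x \<in> carrier V \<Longrightarrow> f x \<le> p x" "\<And>x. x \<in> N \<Longrightarrow> f x = g x"
proof -
  have NV: "x \<in> carrier V" if "x \<in> N" for x using N that by blast
  obtain q where q: "sublinear V q" "\<And>x. x \<in> carrier V \<Longrightarrow> q x \<le> p x"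
    and qN: "\<And>z s. (z, s) \<in> (\<lambda>y. (y, g y)) ` N \<Longrightarrow> q ((-1) \<odot> z) \<le> - s"
    by (rule sublinear_inf_convolution[OF p, of "(\<lambda>y. (y, g y)) ` N"])
      (use N N_add N_scale g_add g_scale g_le in auto)
  obtain f where f: "sublinear V f" "\<And>x. x \<in> carrier V \<Longrightarrow> f x \<le> q x"
    and min: "\<And>r x. \<lbrakk>sublinear V r; \<And>y. y \<in> carrier V \<Longrightarrow> r y \<le> f y; x \<in> carrier V\<rbrakk> \<Longrightarrow> r x = f x"
    using sublinear_minimal[OF q(1)] by blast
  have lin1: "f (x \<oplus> y) = f x + f y" if "x \<in> carrier V" "y \<in> carrier V" for x y
    by (rule sublinear_minimal_linear(1)[OF f(1) _ that]) (use min in blast)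
  have lin2: "f (of_real r \<odot> x) = r * f x" if "x \<in> carrier V" for r x
    by (rule sublinear_minimal_linear(2)[OF f(1) _ that]) (use min in blast)
  have le: "f ((-1) \<odot> y) \<le> - g y" if "y \<in> N" for y
    using f(2)[of "(-1) \<odot> y"] qN[of y "g y"] NV[OF that] that by force
  have neg: "f ((-1) \<odot> y) = - f y" if "y \<in> carrier V" for y
    using lin2[OF that, of "-1"] by simp
  show thesis
  proof (rule that[of f])
    show "f (x \<oplus> y) = f x + f y" if "x \<in> carrier V" "y \<in> carrier V" for x y
      by (rule lin1[OF that])
    show "f (of_real r \<odot> x) = r * f x" if "x \<in> carrier V" for r x
      by (rule lin2[OF that])
    show "f x \<le> p x" if "x \<in> carrier V" for x
      using f(2)[OF that] q(2)[OF that] by simp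
    show "f x = g x" if "x \<in> N" for x
    proof (rule antisym)
      have m: "(-1) \<odot> x \<in> N" using N_scale[OF that, of "-1"] by simp
      have "f x = f ((-1) \<odot> ((-1) \<odot> x))" using NV[OF that] by (simp add: smult_smult)
      also have "\<dots> \<le> - g ((-1) \<odot> x)" by (rule le[OF m])
      also have "\<dots> = g x" using g_scale[OF that, of "-1"] by simp
      finally show "f x \<le> g x" .
      show "g x \<le> f x" using le[OF that] neg[OF NV[OF that]] by simp
    qed
  qed
qed

end


text \<open>
  The reduction of the complex to the real case, for both fields at once: if \<open>h\<close> extends the real part
  of \<open>g\<close>, then \<open>h x - \<iota> h (\<iota> x)\<close> extends \<open>g\<close>.
\<close>

lemma hahn_banach:
  fixes V :: "('k::real_or_complex, 'v) nspace" (structure) and g :: "'v \<Rightarrow> 'k"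
  assumes V: "normed_space V"
    and p_add: "\<And>x y. x \<in> carrier V \<Longrightarrow> y \<in> carrier V \<Longrightarrow> p (x \<oplus> y) \<le> p x + p y"
    and p_smult: "\<And>c x. x \<in> carrier V \<Longrightarrow> p (c \<odot> x) = norm c * p x"
    and N: "N \<subseteq> carrier V" "N \<noteq> {}"
    and N_add: "\<And>x y. x \<in> N \<Longrightarrow> y \<in> N \<Longrightarrow> x \<oplus> y \<in> N"
    and N_smult: "\<And>c x. x \<in> N \<Longrightarrow> c \<odot> x \<in> N"
    and g_add: "\<And>x y. x \<in> N \<Longrightarrow> y \<in> N \<Longrightarrow> g (x \<oplus> y) = g x + g y"
    and g_smult: "\<And>c x. x \<in> N \<Longrightarrow> g (c \<odot> x) = c * g x"
    and g_le: "\<And>x. x \<in> N \<Longrightarrow> norm (g x) \<le> p x"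
  obtains f where "f \<in> extensional (carrier V)" "linear_map V scalars f"
    "\<And>x. x \<in> carrier V \<Longrightarrow> norm (f x) \<le> p x" "\<And>x. x \<in> N \<Longrightarrow> f x = g x"
proof -
  interpret normed_space V by (rule V)
  obtain re :: "'k \<Rightarrow> real" and \<iota> :: 'k
    where re: "\<And>x y. re (x + y) = re x + re y" "\<And>r x. re (of_real r * x) = r * re x"
      "\<And>x. \<bar>re x\<bar> \<le> norm x" "\<And>a b. re (of_real a - \<iota> * of_real b) = a" and dec: "\<And>x. x = of_real (re x) - \<iota> * of_real (re (\<iota> * x))"
      and \<iota>: "\<iota> = 0 \<or> \<iota> * \<iota> = -1"
    by (rule real_part[where 'k = 'k]) blast
  have p: "sublinear V p" by (simp add: sublinear_def p_add p_smult)
  obtain h where h_add: "\<And>x y. x \<in> carrier V \<Longrightarrow> y \<in> carrier V \<Longrightarrow> h (x \<oplus> y) = h x + h y"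
    and h_scale: "\<And>r x. x \<in> carrier V \<Longrightarrow> h (of_real r \<odot> x) = r * h x"
    and h_le: "\<And>x. x \<in> carrier V \<Longrightarrow> h x \<le> p x" and h_N: "\<And>x. x \<in> N \<Longrightarrow> h x = re (g x)"
  proof (rule hahn_banach_real[OF p N N_add, of "\<lambda>x. re (g x)"])
    show "re (g x) \<le> p x" if "x \<in> N" for x
      using re(3)[of "g x"] g_le[OF that] by linarith
    show "of_real r \<odot> x \<in> N" if "x \<in> N" for r x
      by (rule N_smult[OF that])
    show "re (g (x \<oplus> y)) = re (g x) + re (g y)" if "x \<in> N" "y \<in> N" for x y
      using that by (simp only: g_add re(1))
    show "re (g (of_real r \<odot> x)) = r * re (g x)" if "x \<in> N" for r x
      using that by (simp only: g_smult re(2))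
    fix h assume h: "\<And>x y. x \<in> carrier V \<Longrightarrow> y \<in> carrier V \<Longrightarrow> h (x \<oplus> y) = h x + h y"
      "\<And>r x. x \<in> carrier V \<Longrightarrow> h (of_real r \<odot> x) = r * h x"
      "\<And>x. x \<in> carrier V \<Longrightarrow> h x \<le> p x" "\<And>x. x \<in> N \<Longrightarrow> h x = re (g x)"
    show thesis by (rule that; fact h)
  qed
  define f where "f = (\<lambda>x\<in>carrier V. of_real (h x) - \<iota> * of_real (h (\<iota> \<odot> x)))"
  have h_zero: "h \<zero> = 0" using h_scale[of \<zero> 0] by simp
  have f_add: "f (x \<oplus> y) = f x + f y" if "x \<in> carrier V" "y \<in> carrier V" for x y
    using that by (simp add: f_def h_add smult_add_right algebra_simps)
  have f_real: "f (of_real r \<odot> x) = of_real r * f x" if x: "x \<in> carrier V" for r x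
  proof -
    have "\<iota> \<odot> (of_real r \<odot> x) = of_real r \<odot> (\<iota> \<odot> x)"
      using x by (simp add: smult_smult mult.commute)
    then show ?thesis using x by (simp add: f_def h_scale algebra_simps)
  qed
  have f_\<iota>: "f (\<iota> \<odot> x) = \<iota> * f x" if x: "x \<in> carrier V" for x
    using \<iota>
  proof
    assume "\<iota> = 0" then show ?thesis using x h_zero by (simp add: f_def)
  next
    assume 1: "\<iota> * \<iota> = -1"
    have "h (\<iota> \<odot> (\<iota> \<odot> x)) = - h x"
      using x h_scale[OF x, of "-1"] by (simp add: smult_smult 1)
    moreover have "\<iota> * (\<iota> * a) = - a" for a using 1 by (simp flip: mult.assoc)
    ultimately show ?thesis using x by (simp add: f_def right_diff_distrib)
  qed
  have f_smult: "f (c \<odot> x) = c * f x" if x: "x \<in> carrier V" for c x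
  proof -
    define a b where "a = re c" and "b = - re (\<iota> * c)"
    have c: "c = of_real a + of_real b * \<iota>" using dec[of c, symmetric] by (simp add: a_def b_def mult.commute)
    have "c \<odot> x = of_real a \<odot> x \<oplus> of_real b \<odot> (\<iota> \<odot> x)"
      using x by (simp add: c smult_add_left smult_smult)
    then have "f (c \<odot> x) = of_real a * f x + of_real b * (\<iota> * f x)"
      using x by (simp add: f_add f_real f_\<iota>)
    also have "\<dots> = (of_real a + of_real b * \<iota>) * f x"
      by (simp add: algebra_simps)
    finally show ?thesis by (simp only: c[symmetric])
  qed
  have f_le: "norm (f x) \<le> p x" if x: "x \<in> carrier V" for x
  proof (cases "f x = 0")
    case True
    have "0 \<le> p x"
      using h_le[OF x] h_le[of "(-1) \<odot> x"] h_scale[OF x, of "-1"] p_smult[OF x, of "-1"] x by simp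
    with True show ?thesis by simp
  next
    case False
    \<comment> \<open>Rotate \<open>x\<close> so that \<open>f\<close> takes a nonnegative real value there, which \<open>h\<close> then equals.\<close>
    define c where "c = of_real (norm (f x)) / f x"
    have c: "norm c = 1" "f (c \<odot> x) = of_real (norm (f x))"
      using False x by (simp_all add: c_def f_smult norm_divide)
    have "norm (f x) = re (f (c \<odot> x))"
      using re(4)[of "norm (f x)" 0] by (simp add: c)
    also have "\<dots> = h (c \<odot> x)"
      using x by (simp add: f_def re(4))
    also have "\<dots> \<le> p x"
      using h_le[of "c \<odot> x"] x by (simp add: p_smult c)
    finally show ?thesis .
  qed
  show thesis
  proof (rule that[of f])
    show "f \<in> extensional (carrier V)" by (simp add: f_def)
    show "linear_map V scalars f" by (simp add: linear_map_scalars_iff f_add f_smult)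
    show "norm (f x) \<le> p x" if "x \<in> carrier V" for x by (rule f_le[OF that])
    show "f x = g x" if "x \<in> N" for x
    proof -
      have "f x = of_real (re (g x)) - \<iota> * of_real (re (\<iota> * g x))"
        using that N N_smult[OF that, of \<iota>] by (simp add: f_def subset_iff h_N g_smult)
      then show ?thesis using dec[of "g x", symmetric] by simp
    qed
  qed
qed


section \<open>Function spaces and duals\<close>

lemma function_space_simps [simp]:
  "carrier (function_space S C N) = C" "vnorm (function_space S C N) = N"
  "\<zero>\<^bsub>function_space S C N\<^esub> = (\<lambda>x\<in>S. 0)"
  "f \<oplus>\<^bsub>function_space S C N\<^esub> g = (\<lambda>x\<in>S. f x + g x)"
  "c \<odot>\<^bsub>function_space S C N\<^esub> f = (\<lambda>x\<in>S. c * f x)"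
  by (simp_all add: function_space_def)

lemma normed_space_function_space:
  fixes C :: "('x \<Rightarrow> 'k::real_normed_field) set"
  assumes ext: "C \<subseteq> extensional S" and zero: "(\<lambda>x\<in>S. 0) \<in> C"
    and add: "\<And>f g. f \<in> C \<Longrightarrow> g \<in> C \<Longrightarrow> (\<lambda>x\<in>S. f x + g x) \<in> C"
    and smult: "\<And>c f. f \<in> C \<Longrightarrow> (\<lambda>x\<in>S. c * f x) \<in> C"
    and norm_0: "\<And>f. f \<in> C \<Longrightarrow> N f = 0 \<Longrightarrow> f = (\<lambda>x\<in>S. 0)"
    and norm_add: "\<And>f g. f \<in> C \<Longrightarrow> g \<in> C \<Longrightarrow> N (\<lambda>x\<in>S. f x + g x) \<le> N f + N g"
    and norm_smult: "\<And>c f. f \<in> C \<Longrightarrow> N (\<lambda>x\<in>S. c * f x) = norm c * N f"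
  shows "normed_space (function_space S C N)"
proof (rule normed_spaceI, unfold function_space_simps)
  fix f assume f: "f \<in> C"
  then have f': "restrict f S = f" using ext by (auto simp: extensional_restrict)
  show "(\<lambda>x\<in>S. (\<lambda>x\<in>S. 0) x + f x) = f" "(\<lambda>x\<in>S. 1 * f x) = f"
    using f' by (simp_all cong: restrict_cong)
qed (use assms in \<open>auto simp: algebra_simps cong: restrict_cong\<close>)

lemma function_space_minus:
  assumes "normed_space (function_space S C N)" "f \<in> C" "g \<in> C"
  shows "f \<ominus>\<^bsub>function_space S C N\<^esub> g = (\<lambda>x\<in>S. f x - g x)"
proof -
  interpret normed_space "function_space S C N" by (rule assms)
  show ?thesis using assms minus_eq_smult[of f g] by (simp cong: restrict_cong)
qed

lemma function_space_finsum:
  assumes V: "normed_space (function_space S C N)" and "finite A" "x \<in> S"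
    and f: "\<And>i. i \<in> A \<Longrightarrow> f i \<in> C"
  shows "finsum (function_space S C N) f A x = (\<Sum>i\<in>A. f i x)"
proof -
  interpret normed_space "function_space S C N" by (rule V)
  from \<open>finite A\<close> f show ?thesis
  proof (induction A rule: finite_induct)
    case empty then show ?case using \<open>x \<in> S\<close> by simp
  next
    case (insert a A)
    then have "finsum (function_space S C N) f (insert a A) =
        f a \<oplus>\<^bsub>function_space S C N\<^esub> finsum (function_space S C N) f A"
      by (intro M.finsum_insert) auto
    then show ?case using insert \<open>x \<in> S\<close> by simp
  qed
qed

context normed_space
begin

lemma sup_norm_upper:
  assumes "\<And>x. x \<in> carrier V \<Longrightarrow> vnorm V x \<le> 1 \<Longrightarrow> norm (f x) \<le> b"
    and "x \<in> carrier V" "vnorm V x \<le> 1"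
  shows "norm (f x) \<le> sup_norm V f"
  unfolding sup_norm_def
  by (rule cSUP_upper2[where x = x]) (use assms in \<open>auto intro!: bdd_aboveI[of _ b]\<close>)

lemma sup_norm_least:
  assumes "\<And>x. x \<in> carrier V \<Longrightarrow> vnorm V x \<le> 1 \<Longrightarrow> norm (f x) \<le> b"
  shows "sup_norm V f \<le> b"
  unfolding sup_norm_def
  by (rule cSUP_least) (use assms in \<open>auto intro!: exI[of _ \<zero>]\<close>)

text \<open>
  Both duals and spaces of homogeneous polynomials have this form: the supremum over the unit ball
  separates functions that are determined by their values there.
\<close>

lemma normed_space_sup_norm:
  assumes ext: "C \<subseteq> extensional (carrier V)" and zero: "(\<lambda>x\<in>carrier V. 0) \<in> C"
    and add: "\<And>f g. f \<in> C \<Longrightarrow> g \<in> C \<Longrightarrow> (\<lambda>x\<in>carrier V. f x + g x) \<in> C"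
    and smult: "\<And>c f. f \<in> C \<Longrightarrow> (\<lambda>x\<in>carrier V. c * f x) \<in> C"
    and bdd: "\<And>f. f \<in> C \<Longrightarrow> \<exists>b. \<forall>x\<in>carrier V. vnorm V x \<le> 1 \<longrightarrow> norm (f x) \<le> b"
    and ball: "\<And>f x. \<lbrakk>f \<in> C; \<And>x. x \<in> carrier V \<Longrightarrow> vnorm V x \<le> 1 \<Longrightarrow> f x = 0; x \<in> carrier V\<rbrakk> \<Longrightarrow> f x = 0"
  shows "normed_space (function_space (carrier V) C (sup_norm V))"
proof -
  have upper: "norm (f x) \<le> sup_norm V f" if "f \<in> C" "x \<in> carrier V" "vnorm V x \<le> 1" for f x
    using bdd[OF that(1)] sup_norm_upper that(2,3) by metis
  have nonneg: "0 \<le> sup_norm V f" if "f \<in> C" for f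
    using upper[OF that, of \<zero>] by (simp add: order_trans[OF norm_ge_zero])
  have le: "sup_norm V (\<lambda>x\<in>carrier V. c * f x) \<le> norm c * sup_norm V f" if "f \<in> C" for c f
    by (rule sup_norm_least) (use upper[OF that] in \<open>simp add: norm_mult mult_left_mono\<close>)
  show ?thesis
  proof (rule normed_space_function_space)
    fix f assume f: "f \<in> C"
    show "f = (\<lambda>x\<in>carrier V. 0)" if "sup_norm V f = 0"
    proof (rule extensionalityI[of _ "carrier V"])
      show "f x = (\<lambda>x\<in>carrier V. 0) x" if "x \<in> carrier V" for x
        using ball[OF f _ that] upper[OF f] \<open>sup_norm V f = 0\<close> that by force
    qed (use f ext in auto)
    show "sup_norm V (\<lambda>x\<in>carrier V. c * f x) = norm c * sup_norm V f" for c
    proof (rule antisym[OF le[OF f]])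
      show "norm c * sup_norm V f \<le> sup_norm V (\<lambda>x\<in>carrier V. c * f x)"
      proof (cases "c = 0")
        case True
        then show ?thesis using nonneg[OF smult[OF f, of c]] by simp
      next
        case False
        have "(\<lambda>x\<in>carrier V. inverse c * (\<lambda>x\<in>carrier V. c * f x) x) = f"
          using False f ext by (intro extensionalityI[of _ "carrier V"]) auto
        then have "sup_norm V f \<le> norm (inverse c) * sup_norm V (\<lambda>x\<in>carrier V. c * f x)"
          using le[OF smult[OF f, of c], of "inverse c"] by simp
        then show ?thesis using False by (simp add: norm_divide field_simps)
      qed
    qed
    fix g assume g: "g \<in> C"
    show "sup_norm V (\<lambda>x\<in>carrier V. f x + g x) \<le> sup_norm V f + sup_norm V g"
      by (rule sup_norm_least) (use upper[OF f] upper[OF g] in \<open>simp add: norm_triangle_mono\<close>)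
  qed (use assms in auto)
qed

end

lemma carrier_dual_iff:
  "f \<in> carrier (dual V) \<longleftrightarrow> f \<in> extensional (carrier V) \<and> linear_map V scalars f \<and>
     (\<exists>b. \<forall>x\<in>carrier V. norm (f x) \<le> b * vnorm V x)"
  by (simp add: dual_def bounded_linear_map_def)

lemma dual_simps [simp]:
  "vnorm (dual V) = sup_norm V" "\<zero>\<^bsub>dual V\<^esub> = (\<lambda>x\<in>carrier V. 0)"
  "f \<oplus>\<^bsub>dual V\<^esub> g = (\<lambda>x\<in>carrier V. f x + g x)" "c \<odot>\<^bsub>dual V\<^esub> f = (\<lambda>x\<in>carrier V. c * f x)"
  by (simp_all add: dual_def)

context normed_space
begin

lemma dual_add: "f \<in> carrier (dual V) \<Longrightarrow> x \<in> carrier V \<Longrightarrow> y \<in> carrier V \<Longrightarrow> f (x \<oplus> y) = f x + f y"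
  by (simp add: carrier_dual_iff linear_map_scalars_iff)

lemma dual_smult: "f \<in> carrier (dual V) \<Longrightarrow> x \<in> carrier V \<Longrightarrow> f (c \<odot> x) = c * f x"
  by (simp add: carrier_dual_iff linear_map_scalars_iff)

lemma dual_zero: "f \<in> carrier (dual V) \<Longrightarrow> f \<zero> = 0"
  using dual_smult[of f \<zero> 0] by simp

lemma dual_minus:
  "f \<in> carrier (dual V) \<Longrightarrow> x \<in> carrier V \<Longrightarrow> y \<in> carrier V \<Longrightarrow> f (x \<ominus> y) = f x - f y"
  by (simp add: minus_eq_smult dual_add dual_smult)

lemma dual_finsum:
  assumes f: "f \<in> carrier (dual V)" and "finite A" "\<And>i. i \<in> A \<Longrightarrow> x i \<in> carrier V"
  shows "f (finsum V x A) = (\<Sum>i\<in>A. f (x i))"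
  using assms(2,3)
proof (induction A rule: finite_induct)
  case empty then show ?case by (simp add: dual_zero[OF f])
next
  case (insert a A)
  have "finsum V x (insert a A) = x a \<oplus> finsum V x A"
    by (rule M.finsum_insert) (use insert in auto)
  moreover have "finsum V x A \<in> carrier V" by (rule M.finsum_closed) (use insert in auto)
  ultimately show ?case using insert by (simp add: dual_add[OF f])
qed

lemma dual_bounded_ball:
  assumes "f \<in> carrier (dual V)"
  shows "\<exists>b. \<forall>x\<in>carrier V. vnorm V x \<le> 1 \<longrightarrow> norm (f x) \<le> b"
proof -
  obtain b where b: "\<And>x. x \<in> carrier V \<Longrightarrow> norm (f x) \<le> b * vnorm V x"
    using assms by (auto simp: carrier_dual_iff)
  have "norm (f x) \<le> \<bar>b\<bar>" if "x \<in> carrier V" "vnorm V x \<le> 1" for x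
  proof -
    have "norm (f x) \<le> b * vnorm V x" by (rule b[OF that(1)])
    also have "\<dots> \<le> \<bar>b\<bar> * 1" using that by (intro mult_mono) auto
    finally show ?thesis by simp
  qed
  then show ?thesis by blast
qed

lemma homogeneous_ball_bound:
  assumes hom: "\<And>c x. x \<in> carrier V \<Longrightarrow> N (c \<odot> x) = norm c ^ k * N x"
    and ball: "\<And>x. x \<in> carrier V \<Longrightarrow> vnorm V x \<le> 1 \<Longrightarrow> N x \<le> b"
    and k: "1 \<le> k" and x: "x \<in> carrier V"
  shows "N x \<le> b * vnorm V x ^ k"
proof (cases "x = \<zero>")
  case True
  then show ?thesis using hom[of \<zero> 0] k by (simp add: power_0_left)
next
  case False
  then have pos: "0 < vnorm V x" using x vnorm_eq_0[of x] vnorm_nonneg[OF x] by linarith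
  let ?c = "of_real (inverse (vnorm V x))"
  have "N (?c \<odot> x) \<le> b" using x pos by (intro ball) (auto simp: vnorm_smult norm_inverse)
  then have "inverse (vnorm V x ^ k) * N x \<le> b"
    using hom[OF x, of ?c] pos by (simp add: norm_inverse power_inverse)
  then show ?thesis using pos by (simp add: field_simps)
qed

lemma normed_space_dual: "normed_space (dual V)"
  unfolding dual_def
proof (rule normed_space_sup_norm)
  let ?C = "{f \<in> extensional (carrier V). bounded_linear_map V scalars f}"
  have C: "f \<in> ?C \<longleftrightarrow> f \<in> carrier (dual V)" for f by (simp add: dual_def)
  show "(\<lambda>x\<in>carrier V. f x + g x) \<in> ?C" if "f \<in> ?C" "g \<in> ?C" for f g
  proof -
    obtain a b where "\<And>x. x \<in> carrier V \<Longrightarrow> norm (f x) \<le> a * vnorm V x"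
       "\<And>x. x \<in> carrier V \<Longrightarrow> norm (g x) \<le> b * vnorm V x"
      using \<open>f \<in> ?C\<close> \<open>g \<in> ?C\<close> unfolding C carrier_dual_iff by blast
    then have "\<forall>x\<in>carrier V. norm (f x + g x) \<le> (a + b) * vnorm V x"
      by (auto simp: distrib_right intro!: norm_triangle_mono)
    then show ?thesis using that unfolding C
      by (auto simp: carrier_dual_iff linear_map_scalars_iff algebra_simps intro!: exI[of _ "a + b"])
  qed
  show "(\<lambda>x\<in>carrier V. c * f x) \<in> ?C" if "f \<in> ?C" for c f
  proof -
    obtain a where "\<And>x. x \<in> carrier V \<Longrightarrow> norm (f x) \<le> a * vnorm V x"
      using \<open>f \<in> ?C\<close> unfolding C carrier_dual_iff by blast
    then have "\<forall>x\<in>carrier V. norm (c * f x) \<le> (norm c * a) * vnorm V x"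
      by (auto simp: norm_mult mult.assoc intro!: mult_left_mono)
    then show ?thesis using that unfolding C
      by (auto simp: carrier_dual_iff linear_map_scalars_iff algebra_simps intro!: exI[of _ "norm c * a"])
  qed
  show "\<exists>b. \<forall>x\<in>carrier V. vnorm V x \<le> 1 \<longrightarrow> norm (f x) \<le> b" if "f \<in> ?C" for f
    using dual_bounded_ball that unfolding C by blast
  show "f x = 0" if f: "f \<in> ?C" and "\<And>x. x \<in> carrier V \<Longrightarrow> vnorm V x \<le> 1 \<Longrightarrow> f x = 0"
    and x: "x \<in> carrier V" for f x
    using homogeneous_ball_bound[of "\<lambda>x. norm (f x)" 1 0] f that unfolding C
    by (force simp: dual_smult norm_mult)
  show "(\<lambda>x\<in>carrier V. 0) \<in> ?C"
    unfolding C by (auto simp: carrier_dual_iff linear_map_scalars_iff intro!: exI[of _ 0])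
qed auto

lemma dual_bound:
  assumes f: "f \<in> carrier (dual V)" and x: "x \<in> carrier V"
  shows "norm (f x) \<le> sup_norm V f * vnorm V x"
proof -
  have "norm (f x) \<le> sup_norm V f" if "x \<in> carrier V" "vnorm V x \<le> 1" for x
    using dual_bounded_ball[OF f] sup_norm_upper that by metis
  then show ?thesis
    using homogeneous_ball_bound[of "\<lambda>x. norm (f x)" 1] f x by (simp add: dual_smult norm_mult)
qed

lemma sup_norm_dual_nonneg [simp]: "f \<in> carrier (dual V) \<Longrightarrow> 0 \<le> sup_norm V f"
  using normed_space.vnorm_nonneg[OF normed_space_dual, of f] by simp

lemma dualI:
  assumes "f \<in> extensional (carrier V)" "linear_map V scalars f" "0 \<le> b"
    and b: "\<And>x. x \<in> carrier V \<Longrightarrow> norm (f x) \<le> b * vnorm V x"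
  shows "f \<in> carrier (dual V)" "sup_norm V f \<le> b"
proof -
  show "f \<in> carrier (dual V)" unfolding carrier_dual_iff using assms by blast
  show "sup_norm V f \<le> b"
  proof (rule sup_norm_least)
    fix x assume x: "x \<in> carrier V" "vnorm V x \<le> 1"
    have "norm (f x) \<le> b * vnorm V x" by (rule b[OF x(1)])
    also have "\<dots> \<le> b * 1" using x \<open>0 \<le> b\<close> by (intro mult_left_mono)
    finally show "norm (f x) \<le> b" by simp
  qed
qed

lemma evaluation_dual_dual:
  assumes x: "x \<in> carrier V"
  shows "(\<lambda>f\<in>carrier (dual V). f x) \<in> carrier (dual (dual V))"
proof -
  interpret D: normed_space "dual V" by (rule normed_space_dual)
  have "linear_map (dual V) scalars (\<lambda>f\<in>carrier (dual V). f x)"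
    using D.M.a_closed D.smult_closed' x unfolding linear_map_scalars_iff by auto
  moreover have "norm (f x) \<le> vnorm V x * sup_norm V f" if "f \<in> carrier (dual V)" for f
    using dual_bound[OF that x] by (simp add: mult.commute)
  ultimately show ?thesis
    by (auto simp: carrier_dual_iff[of _ "dual V"] intro!: exI[of _ "vnorm V x"])
qed

end


section \<open>Functionals obtained by extension\<close>

text \<open>
  Extension from the line through \<open>x\<close>.  For the norm as \<open>p\<close> this yields norming functionals, for the
  distance from a subspace it yields functionals that annihilate the subspace.
\<close>

lemma norming_functional_seminorm:
  fixes V :: "('k::real_or_complex, 'v) nspace" (structure)
  assumes V: "normed_space V"
    and p_add: "\<And>x y. x \<in> carrier V \<Longrightarrow> y \<in> carrier V \<Longrightarrow> p (x \<oplus> y) \<le> p x + p y"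
    and p_smult: "\<And>c x. x \<in> carrier V \<Longrightarrow> p (c \<odot> x) = norm c * p x"
    and p_le: "\<And>x. x \<in> carrier V \<Longrightarrow> p x \<le> vnorm V x" and x: "x \<in> carrier V"
  obtains f where "f \<in> carrier (dual V)" "sup_norm V f \<le> 1" "f x = of_real (p x)"
    "\<And>y. y \<in> carrier V \<Longrightarrow> norm (f y) \<le> p y"
proof -
  interpret normed_space V by (rule V)
  have p_0: "p \<zero> = 0" using p_smult[of \<zero> 0] by simp
  have p_nonneg: "0 \<le> p y" if "y \<in> carrier V" for y
  proof -
    have "y \<oplus> (-1) \<odot> y = \<zero>" using smult_add_left[OF that, of 1 "-1"] that by simp
    then show ?thesis using p_add[of y "(-1) \<odot> y"] p_smult[of y "-1"] that p_0 by simp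
  qed
  \<comment> \<open>If \<open>c\<close> is not determined by \<open>c \<odot> x\<close>, then \<open>p x = 0\<close>, so \<open>g\<close> does not depend on the choice.\<close>
  define g where "g y = (SOME c. y = c \<odot> x) * of_real (p x)" for y
  have g: "g (c \<odot> x) = c * of_real (p x)" for c
  proof -
    define d where "d = (SOME d. c \<odot> x = d \<odot> x)"
    have "c \<odot> x = d \<odot> x" unfolding d_def by (rule someI[of _ c]) simp
    then have "(c - d) \<odot> x = \<zero>"
      using smult_add_left[OF x, of c "- d"] smult_add_left[OF x, of d "- d"] x by simp
    then have "norm (c - d) * p x = 0" using p_smult[OF x, of "c - d"] p_0 by simp
    then show ?thesis by (auto simp: g_def d_def)
  qed
  obtain f where f: "f \<in> extensional (carrier V)" "linear_map V scalars f"
    "\<And>y. y \<in> carrier V \<Longrightarrow> norm (f y) \<le> p y"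
    and fg: "\<And>y. y \<in> range (\<lambda>c. c \<odot> x) \<Longrightarrow> f y = g y"
  proof (rule hahn_banach[OF V p_add p_smult, of "range (\<lambda>c. c \<odot> x)" g])
    show "y \<oplus> z \<in> range (\<lambda>c. c \<odot> x)" "g (y \<oplus> z) = g y + g z"
      if yz: "y \<in> range (\<lambda>c. c \<odot> x)" "z \<in> range (\<lambda>c. c \<odot> x)" for y z
    proof -
      obtain c d where cd: "y = c \<odot> x" "z = d \<odot> x" using yz by blast
      then have e: "y \<oplus> z = (c + d) \<odot> x" using x by (simp add: smult_add_left)
      then show "y \<oplus> z \<in> range (\<lambda>c. c \<odot> x)" by blast
      show "g (y \<oplus> z) = g y + g z" unfolding e g by (simp add: cd g algebra_simps)
    qed
    show "d \<odot> y \<in> range (\<lambda>c. c \<odot> x)" "g (d \<odot> y) = d * g y"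
      if "y \<in> range (\<lambda>c. c \<odot> x)" for d y
      using that x by (auto simp: smult_smult g)
    show "norm (g y) \<le> p y" if "y \<in> range (\<lambda>c. c \<odot> x)" for y
      using that x p_nonneg[OF x] by (auto simp: g norm_mult p_smult)
    fix f assume f: "f \<in> extensional (carrier V)" "linear_map V scalars f"
      "\<And>x. x \<in> carrier V \<Longrightarrow> norm (f x) \<le> p x" "\<And>y. y \<in> range (\<lambda>c. c \<odot> x) \<Longrightarrow> f y = g y"
    show thesis by (rule that; fact f)
  qed (use x in auto)
  have "norm (f y) \<le> 1 * vnorm V y" if "y \<in> carrier V" for y
    using f(3)[OF that] p_le[OF that] by simp
  note d = dualI[OF f(1,2) _ this]
  have "f x = of_real (p x)"
    using fg[OF rangeI[of "\<lambda>c. c \<odot> x" 1]] g[of 1] x by simp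
  with d f(3) show thesis by (intro that[of f]) auto
qed

lemma norming_functional:
  fixes V :: "('k::real_or_complex, 'v) nspace"
  assumes V: "normed_space V" and x: "x \<in> carrier V"
  obtains f where "f \<in> carrier (dual V)" "sup_norm V f \<le> 1" "f x = of_real (vnorm V x)"
proof -
  interpret normed_space V by (rule V)
  show thesis
    by (rule norming_functional_seminorm[OF V vnorm_triangle vnorm_smult order_refl x]) (auto intro: that)
qed

lemma vnorm_le_functionals:
  fixes V :: "('k::real_or_complex, 'v) nspace"
  assumes V: "normed_space V" and x: "x \<in> carrier V"
    and b: "\<And>f. f \<in> carrier (dual V) \<Longrightarrow> sup_norm V f \<le> 1 \<Longrightarrow> norm (f x) \<le> b"
  shows "vnorm V x \<le> b"
proof -
  obtain f where "f \<in> carrier (dual V)" "sup_norm V f \<le> 1" "f x = of_real (vnorm V x)"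
    by (rule norming_functional[OF V x])
  then show ?thesis
    using b[of f] normed_space.vnorm_nonneg[OF V x] by simp
qed

lemma functionals_separate_points:
  fixes V :: "('k::real_or_complex, 'v) nspace"
  assumes V: "normed_space V" and x: "x \<in> carrier V" and y: "y \<in> carrier V"
    and eq: "\<And>f. f \<in> carrier (dual V) \<Longrightarrow> f x = f y"
  shows "x = y"
proof -
  interpret normed_space V by (rule V)
  have "vnorm V (x \<ominus>\<^bsub>V\<^esub> y) \<le> 0"
    by (rule vnorm_le_functionals[OF V]) (use x y eq in \<open>auto simp: dual_minus\<close>)
  moreover have "x \<ominus>\<^bsub>V\<^esub> y \<in> carrier V" using x y by simp
  ultimately have "x \<ominus>\<^bsub>V\<^esub> y = \<zero>\<^bsub>V\<^esub>"
    using vnorm_nonneg vnorm_eq_0 by (metis antisym)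
  then show ?thesis using minus_eq_zero_iff x y by simp
qed

text \<open>
  A point that no functional separates from the subspace \<open>M\<close> has distance \<open>0\<close> from \<open>M\<close>, since otherwise a
  functional dominated by this distance would separate them.  This is Mazur's theorem for subspaces.
\<close>

lemma mazur_subspace:
  fixes V :: "('k::real_or_complex, 'v) nspace" (structure)
  assumes V: "normed_space V" and M: "M \<subseteq> carrier V" "M \<noteq> {}"
    and M_add: "\<And>x y. x \<in> M \<Longrightarrow> y \<in> M \<Longrightarrow> x \<oplus> y \<in> M"
    and M_smult: "\<And>c x. x \<in> M \<Longrightarrow> c \<odot> x \<in> M"
    and x: "x \<in> carrier V"
    and ann: "\<And>f. f \<in> carrier (dual V) \<Longrightarrow> (\<And>y. y \<in> M \<Longrightarrow> f y = 0) \<Longrightarrow> f x = 0"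
    and \<epsilon>: "0 < \<epsilon>"
  obtains y where "y \<in> M" "vnorm V (x \<ominus> y) < \<epsilon>"
proof -
  interpret normed_space V by (rule V)
  have MV: "y \<in> carrier V" if "y \<in> M" for y using M that by blast
  obtain m0 where m0: "m0 \<in> M" using M by blast
  have M0: "\<zero> \<in> M" using M_smult[OF m0, of 0] MV[OF m0] by simp
  \<comment> \<open>the distance from \<open>M\<close>\<close>
  define p where "p y = (INF m\<in>M. vnorm V (y \<oplus> m))" for y
  have p_le: "p y \<le> vnorm V (y \<oplus> m)" if "y \<in> carrier V" "m \<in> M" for y m
    unfolding p_def by (rule cINF_lower) (use that MV in \<open>auto intro!: bdd_belowI[of _ 0]\<close>)
  have p_ge: "a \<le> p y" if "\<And>m. m \<in> M \<Longrightarrow> a \<le> vnorm V (y \<oplus> m)" for a y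
    unfolding p_def by (rule cINF_greatest) (use that M in auto)
  have p_0: "p \<zero> = 0"
    using p_le[OF M.zero_closed M0] p_ge[of 0 \<zero>] MV by fastforce
  have p_add: "p (y \<oplus> z) \<le> p y + p z" if y: "y \<in> carrier V" and z: "z \<in> carrier V" for y z
  proof -
    have "p (y \<oplus> z) - vnorm V (z \<oplus> b) \<le> vnorm V (y \<oplus> a)" if "a \<in> M" "b \<in> M" for a b
    proof -
      have ab: "a \<in> carrier V" "b \<in> carrier V" using that MV by auto
      have "p (y \<oplus> z) \<le> vnorm V ((y \<oplus> z) \<oplus> (a \<oplus> b))"
        using p_le[OF _ M_add[OF that]] y z by simp
      also have "(y \<oplus> z) \<oplus> (a \<oplus> b) = (y \<oplus> a) \<oplus> (z \<oplus> b)"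
        using y z ab by (simp add: M.a_ac)
      finally show ?thesis
        using vnorm_triangle[of "y \<oplus> a" "z \<oplus> b"] y z ab by simp
    qed
    then have "p (y \<oplus> z) - vnorm V (z \<oplus> b) \<le> p y" if "b \<in> M" for b
      using that by (intro p_ge) auto
    then have "p (y \<oplus> z) - p y \<le> p z"
      by (intro p_ge) (simp add: algebra_simps)
    then show ?thesis by simp
  qed
  have smult_le: "p (c \<odot> y) \<le> norm c * p y" if c: "c \<noteq> 0" and y: "y \<in> carrier V" for c y
  proof -
    have "p (c \<odot> y) / norm c \<le> vnorm V (y \<oplus> m)" if m: "m \<in> M" for m
    proof -
      have "p (c \<odot> y) \<le> vnorm V (c \<odot> (y \<oplus> m))"
        using p_le[OF _ M_smult[OF m, of c], of "c \<odot> y"] y MV[OF m] by (simp add: smult_add_right)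
      then show ?thesis using c y MV[OF m] by (simp add: vnorm_smult field_simps)
    qed
    then have "p (c \<odot> y) / norm c \<le> p y" by (rule p_ge)
    then show ?thesis using c by (simp add: field_simps)
  qed
  have p_smult: "p (c \<odot> y) = norm c * p y" if y: "y \<in> carrier V" for c y
  proof (cases "c = 0")
    case True then show ?thesis using y p_0 by simp
  next
    case False
    have "p y \<le> norm (inverse c) * p (c \<odot> y)"
      using smult_le[of "inverse c" "c \<odot> y"] False y by (simp add: smult_smult)
    then show ?thesis using smult_le[OF False y] False by (simp add: norm_divide field_simps)
  qed
  have p_norm: "p y \<le> vnorm V y" if "y \<in> carrier V" for y
    using p_le[OF that M0] that by simp
  obtain f where f: "f \<in> carrier (dual V)" "f x = of_real (p x)"
    and fp: "\<And>y. y \<in> carrier V \<Longrightarrow> norm (f y) \<le> p y"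
    by (rule norming_functional_seminorm[OF V p_add p_smult p_norm x]) blast+
  have "f y = 0" if "y \<in> M" for y
  proof -
    have "y \<oplus> (-1) \<odot> y = \<zero>" using smult_add_left[OF MV[OF that], of 1 "-1"] MV[OF that] by simp
    then have "p y \<le> 0" using p_le[OF MV[OF that] M_smult[OF that, of "-1"]] by simp
    then show ?thesis using fp[OF MV[OF that]] by (metis norm_le_zero_iff order_trans)
  qed
  then have "p x = 0" using ann[OF f(1)] f(2) by simp
  then have "\<not> \<epsilon> \<le> p x" using \<epsilon> by simp
  then obtain m where m: "m \<in> M" "vnorm V (x \<oplus> m) < \<epsilon>" using p_ge[of \<epsilon> x] by force
  show thesis
  proof (rule that[of "(-1) \<odot> m"])
    show "vnorm V (x \<ominus> (-1) \<odot> m) < \<epsilon>"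
      using m x MV by (simp add: minus_eq_smult smult_smult)
  qed (rule M_smult[OF m(1)])
qed

text \<open>
  The annihilator of a finite set has as its own annihilator the span of the evaluations at that set.
  In the induction step let \<open>g\<close> vanish on the old points with \<open>g z = 1\<close> at the new one; then the
  functional \<open>\<xi> - \<xi> g z\<close> vanishes on the annihilator of the old points.  If there is no such \<open>g\<close>, then
  \<open>z\<close> adds no condition.
\<close>

lemma functional_on_dual_is_evaluation:
  fixes V :: "('k::real_normed_field, 'v) nspace" (structure)
  assumes V: "normed_space V"
    and add: "\<And>f g. f \<in> carrier (dual V) \<Longrightarrow> g \<in> carrier (dual V) \<Longrightarrow> \<xi> (f \<oplus>\<^bsub>dual V\<^esub> g) = \<xi> f + \<xi> g"
    and smult: "\<And>c f. f \<in> carrier (dual V) \<Longrightarrow> \<xi> (c \<odot>\<^bsub>dual V\<^esub> f) = c * \<xi> f"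
    and "finite X" "X \<subseteq> carrier V"
    and ann: "\<And>f. f \<in> carrier (dual V) \<Longrightarrow> (\<And>x. x \<in> X \<Longrightarrow> f x = 0) \<Longrightarrow> \<xi> f = 0"
  obtains x where "x \<in> carrier V" "\<And>f. f \<in> carrier (dual V) \<Longrightarrow> \<xi> f = f x"
proof -
  interpret normed_space V by (rule V)
  interpret D: normed_space "dual V" by (rule normed_space_dual)
  have "\<exists>x\<in>carrier V. \<forall>f\<in>carrier (dual V). \<xi> f = f x"
    using assms(4,5) add smult ann
  proof (induction X arbitrary: \<xi> rule: finite_induct)
    case empty
    then show ?case by (intro bexI[of _ \<zero>]) (auto simp: dual_zero)
  next
    case (insert z X)
    show ?case
    proof (cases "\<exists>g\<in>carrier (dual V). (\<forall>x\<in>X. g x = 0) \<and> g z \<noteq> 0")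
      case False
      show ?thesis
      proof (rule insert.IH)
        fix f assume "f \<in> carrier (dual V)" "\<And>x. x \<in> X \<Longrightarrow> f x = 0"
        with False have "f x = 0" if "x \<in> insert z X" for x using that by blast
        with \<open>f \<in> carrier (dual V)\<close> show "\<xi> f = 0" by (rule insert.prems(4))
      qed (use insert.prems(1) in blast, fact insert.prems(2), fact insert.prems(3))
    next
      case True
      then obtain h where h: "h \<in> carrier (dual V)" "\<And>x. x \<in> X \<Longrightarrow> h x = 0" "h z \<noteq> 0" by blast
      define g where "g = inverse (h z) \<odot>\<^bsub>dual V\<^esub> h"
      have g: "g \<in> carrier (dual V)" unfolding g_def using h(1) by (rule D.smult_closed')
      have gX: "g x = 0" if "x \<in> X" for x using that insert.prems h by (auto simp: g_def)
      have gz: "g z = 1" using insert.prems h by (auto simp: g_def)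
      have "\<exists>x\<in>carrier V. \<forall>f\<in>carrier (dual V). \<xi> f - \<xi> g * f z = f x"
      proof (rule insert.IH)
        show "X \<subseteq> carrier V" using insert.prems by simp
        fix f assume f: "f \<in> carrier (dual V)"
        show "\<xi> (c \<odot>\<^bsub>dual V\<^esub> f) - \<xi> g * (c \<odot>\<^bsub>dual V\<^esub> f) z = c * (\<xi> f - \<xi> g * f z)" for c
          by (subst insert.prems(3)[OF f]) (use insert.prems(1) in \<open>simp add: algebra_simps\<close>)
        show "\<xi> (f \<oplus>\<^bsub>dual V\<^esub> f') - \<xi> g * (f \<oplus>\<^bsub>dual V\<^esub> f') z = \<xi> f - \<xi> g * f z + (\<xi> f' - \<xi> g * f' z)"
          if "f' \<in> carrier (dual V)" for f'
          by (subst insert.prems(2)[OF f that]) (use insert.prems(1) in \<open>simp add: algebra_simps\<close>)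
        show "\<xi> f - \<xi> g * f z = 0" if fX: "\<And>x. x \<in> X \<Longrightarrow> f x = 0"
        proof -
          define u where "u = (- f z) \<odot>\<^bsub>dual V\<^esub> g"
          have u: "u \<in> carrier (dual V)" unfolding u_def using g by (rule D.smult_closed')
          have "(f \<oplus>\<^bsub>dual V\<^esub> u) x = 0" if "x \<in> insert z X" for x
            using that insert.prems(1) fX gX gz by (auto simp: u_def)
          then have "\<xi> (f \<oplus>\<^bsub>dual V\<^esub> u) = 0"
            using insert.prems(4) D.M.a_closed[OF f u] by blast
          then have "\<xi> f + \<xi> u = 0" by (simp only: insert.prems(2)[OF f u])
          moreover have "\<xi> u = - f z * \<xi> g" unfolding u_def by (rule insert.prems(3)[OF g])
          ultimately show ?thesis by (simp add: mult.commute)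
        qed
      qed
      then obtain x where x: "x \<in> carrier V" "\<And>f. f \<in> carrier (dual V) \<Longrightarrow> \<xi> f - \<xi> g * f z = f x"
        by blast
      have "\<xi> f = f (x \<oplus> \<xi> g \<odot> z)" if "f \<in> carrier (dual V)" for f
        using x that insert.prems(1) by (simp add: dual_add dual_smult eq_diff_eq' algebra_simps)
      then show ?thesis using x insert.prems(1) by (intro bexI[of _ "x \<oplus> \<xi> g \<odot> z"]) auto
    qed
  qed
  then show thesis using that by blast
qed


section \<open>The weak topology\<close>

lemma closure_of_meets_openin: "x \<in> X closure_of A \<Longrightarrow> openin X T \<Longrightarrow> x \<in> T \<Longrightarrow> \<exists>a\<in>A. a \<in> T"
  by (auto simp: in_closure_of)

context normed_space
begin

lemma topspace_weak_topology [simp]: "topspace (weak_topology V) = carrier V"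
proof -
  have "(\<lambda>x\<in>carrier V. 0) \<in> carrier (dual V)"
    by (auto simp: carrier_dual_iff linear_map_scalars_iff intro!: exI[of _ 0])
  then have "carrier V \<in> {{x \<in> carrier V. f x \<in> U} |f U. f \<in> carrier (dual V) \<and> open U}"
    by (intro CollectI exI[of _ "\<lambda>x\<in>carrier V. 0"] exI[of _ UNIV]) auto
  then have "carrier V \<subseteq> topspace (weak_topology V)"
    unfolding weak_topology_def topology_generated_by_topspace by (rule Union_upper)
  moreover have "topspace (weak_topology V) \<subseteq> carrier V"
    unfolding weak_topology_def topology_generated_by_topspace by (rule Union_least) auto
  ultimately show ?thesis by (rule antisym[rotated])
qed

lemma openin_weak_topology:
  "f \<in> carrier (dual V) \<Longrightarrow> open U \<Longrightarrow> openin (weak_topology V) {x \<in> carrier V. f x \<in> U}"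
  unfolding weak_topology_def
  by (rule topology_generated_by_Basis) (intro CollectI exI conjI; (rule refl | assumption))

lemma continuous_map_weak_topology:
  assumes "f \<in> carrier (dual V)" shows "continuous_map (weak_topology V) euclidean f"
  using openin_weak_topology[OF assms] by (simp add: continuous_map_def Pi_iff)

lemma weak_closure_approx:
  assumes x: "x \<in> weak_topology V closure_of A" and f: "f \<in> carrier (dual V)" and "0 < \<epsilon>"
  obtains a where "a \<in> A" "norm (f a - f x) < \<epsilon>"
proof -
  have xV: "x \<in> carrier V" using x by (auto simp: in_closure_of)
  obtain a where "a \<in> A" "f a \<in> ball (f x) \<epsilon>"
    using closure_of_meets_openin[OF x openin_weak_topology[OF f open_ball[of "f x" \<epsilon>]]] xV \<open>0 < \<epsilon>\<close>
    by auto
  then show thesis using that by (simp add: dist_norm norm_minus_commute)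
qed

end

text \<open>
  Evaluation embeds the space with its weak topology into the product of copies of the scalar field,
  one for each functional.  The image of a bounded set lies in a product of discs, which is compact by
  Tychonoff's theorem; a closure that stays within the image of the space can be pulled back.
\<close>

lemma relatively_weakly_compact_if_closure_evaluations:
  fixes V :: "('k::real_or_complex, 'v) nspace"
  defines "X \<equiv> product_topology (\<lambda>_. euclidean :: 'k topology) (carrier (dual V))"
    and "ev \<equiv> \<lambda>x. \<lambda>f\<in>carrier (dual V). f x"
  assumes V: "normed_space V" and A: "A \<subseteq> carrier V"
    and bdd: "\<And>x. x \<in> A \<Longrightarrow> vnorm V x \<le> b"
    and closure: "X closure_of (ev ` A) \<subseteq> ev ` carrier V"
  shows "relatively_weakly_compact V A"
proof -
  interpret normed_space V by (rule V)
  let ?D = "carrier (dual V)" and ?W = "weak_topology V"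
  define K where "K = X closure_of (ev ` A)"
  define B where "B = Pi\<^sub>E ?D (\<lambda>f. cball (0 :: 'k) (sup_norm V f * b))"
  have "ev ` A \<subseteq> B"
  proof (clarsimp simp: ev_def B_def)
    fix a f assume "a \<in> A" "f \<in> ?D"
    then have "norm (f a) \<le> sup_norm V f * vnorm V a" using A by (intro dual_bound) auto
    also have "\<dots> \<le> sup_norm V f * b" using \<open>a \<in> A\<close> \<open>f \<in> ?D\<close> bdd by (intro mult_left_mono) auto
    finally show "norm (f a) \<le> sup_norm V f * b" .
  qed
  moreover have "closedin X B" unfolding X_def B_def by (simp add: closedin_product_topology)
  ultimately have "K \<subseteq> B" unfolding K_def by (intro closure_of_minimal)
  moreover have "compactin X B" unfolding X_def B_def by (simp add: compactin_PiE)
  ultimately have K: "compactin X K" using closed_compactin unfolding K_def by (metis closedin_closure_of)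
  define g where "g = inv_into (carrier V) ev"
  have g: "g \<xi> \<in> carrier V" "ev (g \<xi>) = \<xi>" if "\<xi> \<in> K" for \<xi>
    using that closure inv_into_into[of \<xi> ev "carrier V"] f_inv_into_f[of \<xi> ev "carrier V"]
    unfolding g_def K_def by blast+
  have g_ev: "g (ev x) = x" if "x \<in> carrier V" for x
  proof -
    have "inj_on ev (carrier V)"
    proof (rule inj_onI)
      fix x y assume xy: "x \<in> carrier V" "y \<in> carrier V" "ev x = ev y"
      show "x = y"
        by (rule functionals_separate_points[OF V xy(1,2)]) (use xy(3) in \<open>metis ev_def restrict_apply'\<close>)
    qed
    then show ?thesis using that by (simp add: g_def)
  qed
  have KX: "topspace (subtopology X K) = K"
    using compactin_subset_topspace[OF K] by (simp add: inf.absorb2)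
  have "continuous_map (subtopology X K) ?W g"
    unfolding weak_topology_def
  proof (rule continuous_on_generated_topo, unfold KX)
    fix U assume "U \<in> {{x \<in> carrier V. f x \<in> U} |f U. f \<in> ?D \<and> open U}"
    then obtain f T where f: "f \<in> ?D" "open T" and U: "U = {x \<in> carrier V. f x \<in> T}" by blast
    have "f (g \<xi>) = \<xi> f" if "\<xi> \<in> K" for \<xi>
      using g(2)[OF that] f(1) by (metis ev_def restrict_apply')
    then have "g -` U \<inter> K = {\<xi> \<in> topspace (subtopology X K). \<xi> f \<in> T}"
      unfolding KX using g(1) by (auto simp: U)
    moreover have "continuous_map (subtopology X K) euclidean (\<lambda>\<xi>. \<xi> f)"
      unfolding X_def using f(1) by (intro continuous_map_from_subtopology continuous_map_product_projection)
    ultimately show "openin (subtopology X K) (g -` U \<inter> K)"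
      using f(2) openin_continuous_map_preimage by fastforce
  next
    have eq: "\<Union> {{x \<in> carrier V. f x \<in> U} |f U. f \<in> ?D \<and> open U} = carrier V"
      using topspace_weak_topology unfolding weak_topology_def topology_generated_by_topspace .
    show "g ` K \<subseteq> \<Union> {{x \<in> carrier V. f x \<in> U} |f U. f \<in> ?D \<and> open U}"
      unfolding eq by (rule image_subsetI) (rule g(1))
  qed
  moreover have "compactin (subtopology X K) K" using K by (simp add: compactin_subtopology)
  ultimately have gK: "compactin ?W (g ` K)" using image_compactin by blast
  have "continuous_map ?W X ev"
    unfolding X_def continuous_map_componentwise
    using continuous_map_weak_topology by (auto simp: ev_def)
  then have "ev ` (?W closure_of A) \<subseteq> K"
    unfolding K_def by (rule continuous_map_image_closure_subset)
  moreover have "?W closure_of A \<subseteq> carrier V" using closure_of_subset_topspace[of ?W A] by simp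
  ultimately have "?W closure_of A \<subseteq> g ` K"
    using g_ev by (auto intro!: rev_image_eqI[of "ev _"])
  then have "compactin ?W (?W closure_of A)"
    using gK closed_compactin by (metis closedin_closure_of)
  then show ?thesis using A by (simp add: relatively_weakly_compact_def)
qed

lemma pointwise_closure_approx:
  fixes A :: "('x \<Rightarrow> 'k::metric_space) set"
  assumes \<xi>: "\<xi> \<in> product_topology (\<lambda>_. euclidean) D closure_of A"
    and F: "finite F" "F \<subseteq> D" and "0 < \<epsilon>"
  obtains a where "a \<in> A" "\<And>f. f \<in> F \<Longrightarrow> dist (\<xi> f) (a f) < \<epsilon>"
proof -
  let ?U = "\<lambda>f. if f \<in> F then ball (\<xi> f) \<epsilon> else UNIV"
  have op: "openin (product_topology (\<lambda>_. euclidean) D) (Pi\<^sub>E D ?U)"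
    by (rule product_topology_basis) (auto intro: finite_subset[OF _ F(1)])
  have "\<xi> \<in> Pi\<^sub>E D ?U" using \<xi> \<open>0 < \<epsilon>\<close> by (auto simp: in_closure_of)
  then obtain a where "a \<in> A" "a \<in> Pi\<^sub>E D ?U" using closure_of_meets_openin[OF \<xi> op] by auto
  then show thesis using that[of a] F(2) by (force simp: PiE_iff)
qed

lemma weak_cluster_point:
  fixes a :: "nat \<Rightarrow> 'v" and V :: "('k::real_normed_field, 'v) nspace"
  assumes V: "normed_space V" and "relatively_weakly_compact V (range a)"
  obtains x where "\<And>n. x \<in> weak_topology V closure_of (a ` {n..})"
proof -
  interpret normed_space V by (rule V)
  let ?W = "weak_topology V"
  define K where "K = ?W closure_of range a"
  have a: "range a \<subseteq> carrier V" and K: "compactin ?W K"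
    using assms(2) by (auto simp: relatively_weakly_compact_def K_def)
  have sub: "?W closure_of (a ` {n..}) \<subseteq> K" for n
    unfolding K_def by (intro closure_of_mono) auto
  have "(\<Inter>n. ?W closure_of (a ` {n..})) \<noteq> {}"
  proof (rule compact_space_imp_nest)
    show "compact_space (subtopology ?W K)" using K by (simp add: compact_space_subtopology)
    show "closedin (subtopology ?W K) (?W closure_of (a ` {n..}))" for n
      using sub by (intro closedin_subset_topspace) auto
    show "?W closure_of (a ` {n..}) \<noteq> {}" for n
    proof -
      have "a n \<in> ?W closure_of (a ` {n..})"
        using closure_of_subset[of "a ` {n..}" ?W] a by auto
      then show ?thesis by blast
    qed
    show "decseq (\<lambda>n. ?W closure_of (a ` {n..}))"
      by (intro antimonoI closure_of_mono) auto
  qed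
  then show thesis using that by blast
qed


section \<open>Weak compactness is determined by sequences\<close>

lemma (in normed_space) banach_limit:
  assumes "banach_space V" and s: "\<And>n. s n \<in> carrier V"
    and cauchy: "\<And>\<epsilon>. 0 < \<epsilon> \<Longrightarrow> \<exists>N. \<forall>m\<ge>N. \<forall>n\<ge>N. vnorm V (s m \<ominus> s n) < \<epsilon>"
  obtains l where "l \<in> carrier V" "(\<lambda>n. vnorm V (s n \<ominus> l)) \<longlonglongrightarrow> 0"
proof -
  interpret Metric_space "carrier V" "vdist V" by (rule Metric_space_vdist)
  have "mcomplete" using assms(1) by (simp add: banach_space_def)
  moreover have "MCauchy s"
    unfolding MCauchy_def using s cauchy by (auto simp: image_subset_iff)
  ultimately obtain l where "limitin mtopology s l sequentially" by (auto simp: mcomplete_def)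
  then have "l \<in> carrier V" "(\<lambda>n. vdist V (s n) l) \<longlonglongrightarrow> 0"
    by (auto simp: limitin_metric_dist_null)
  then show thesis using that s by simp
qed

text \<open>
  A complete space is closed in its bidual.
\<close>

lemma approximable_by_evaluations:
  fixes V :: "('k::real_or_complex, 'v) nspace"
  assumes E: "banach_space V"
    and approx: "\<And>\<epsilon>. 0 < \<epsilon> \<Longrightarrow> \<exists>x\<in>carrier V. \<forall>f\<in>carrier (dual V). norm (\<xi> f - f x) \<le> \<epsilon> * sup_norm V f"
  obtains x where "x \<in> carrier V" "\<And>f. f \<in> carrier (dual V) \<Longrightarrow> \<xi> f = f x"
proof -
  have V: "normed_space V" using E by (simp add: banach_space_def)
  interpret normed_space V by (rule V)
  have "\<forall>n. \<exists>x\<in>carrier V. \<forall>f\<in>carrier (dual V). norm (\<xi> f - f x) \<le> inverse (real (Suc n)) * sup_norm V f"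
    using approx by simp
  then obtain s where s: "\<And>n. s n \<in> carrier V"
    and s_approx: "\<And>n f. f \<in> carrier (dual V) \<Longrightarrow> norm (\<xi> f - f (s n)) \<le> inverse (real (Suc n)) * sup_norm V f"
    by metis
  obtain x where x: "x \<in> carrier V" and lim: "(\<lambda>n. vnorm V (s n \<ominus>\<^bsub>V\<^esub> x)) \<longlonglongrightarrow> 0"
  proof (rule banach_limit[OF E s])
    fix \<epsilon> :: real assume "0 < \<epsilon>"
    then obtain N where N: "inverse (real (Suc N)) < \<epsilon> / 3"
      using reals_Archimedean[of "\<epsilon> / 3"] by auto
    have "vnorm V (s m \<ominus>\<^bsub>V\<^esub> s n) < \<epsilon>" if "N \<le> m" "N \<le> n" for m n
    proof -
      have small: "inverse (real (Suc i)) \<le> \<epsilon> / 3" if "N \<le> i" for i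
      proof -
        have "inverse (real (Suc i)) \<le> inverse (real (Suc N))" using that by (intro le_imp_inverse_le) auto
        then show ?thesis using N by linarith
      qed
      have "vnorm V (s m \<ominus>\<^bsub>V\<^esub> s n) \<le> \<epsilon> / 3 + \<epsilon> / 3"
      proof (rule vnorm_le_functionals[OF V])
        fix f assume f: "f \<in> carrier (dual V)" "sup_norm V f \<le> 1"
        have *: "norm (\<xi> f - f (s i)) \<le> \<epsilon> / 3" if "N \<le> i" for i
        proof -
          have "norm (\<xi> f - f (s i)) \<le> inverse (real (Suc i)) * sup_norm V f" by (rule s_approx[OF f(1)])
          also have "\<dots> \<le> (\<epsilon> / 3) * 1"
            using small[OF that] f \<open>0 < \<epsilon>\<close> by (intro mult_mono) auto
          finally show ?thesis by simp
        qed
        have "f (s m \<ominus>\<^bsub>V\<^esub> s n) = (\<xi> f - f (s n)) - (\<xi> f - f (s m))" using f s by (simp add: dual_minus)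
        then show "norm (f (s m \<ominus>\<^bsub>V\<^esub> s n)) \<le> \<epsilon> / 3 + \<epsilon> / 3"
          using norm_triangle_ineq4[of "\<xi> f - f (s n)" "\<xi> f - f (s m)"] *[OF that(1)] *[OF that(2)] by simp
      qed (use s in simp)
      then show ?thesis using \<open>0 < \<epsilon>\<close> by simp
    qed
    then show "\<exists>N. \<forall>m\<ge>N. \<forall>n\<ge>N. vnorm V (s m \<ominus>\<^bsub>V\<^esub> s n) < \<epsilon>" by blast
  qed blast
  have "\<xi> f = f x" if f: "f \<in> carrier (dual V)" for f
  proof -
    have "norm (\<xi> f - f x) \<le> inverse (real (Suc n)) * sup_norm V f + sup_norm V f * vnorm V (s n \<ominus>\<^bsub>V\<^esub> x)" for n
    proof -
      have "\<xi> f - f x = (\<xi> f - f (s n)) + f (s n \<ominus>\<^bsub>V\<^esub> x)" using f s x by (simp add: dual_minus)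
      then have "norm (\<xi> f - f x) \<le> norm (\<xi> f - f (s n)) + norm (f (s n \<ominus>\<^bsub>V\<^esub> x))"
        by (metis norm_triangle_ineq)
      moreover have "s n \<ominus>\<^bsub>V\<^esub> x \<in> carrier V" using s x by simp
      ultimately show ?thesis using s_approx[OF f, of n] dual_bound[OF f] by fastforce
    qed
    moreover have "(\<lambda>n. inverse (real (Suc n)) * sup_norm V f + sup_norm V f * vnorm V (s n \<ominus>\<^bsub>V\<^esub> x)) \<longlonglongrightarrow> 0"
      using tendsto_add[OF tendsto_mult_right[OF LIMSEQ_inverse_real_of_nat, of "sup_norm V f"]
          tendsto_mult_left[OF lim, of "sup_norm V f"]] by simp
    ultimately have "norm (\<xi> f - f x) \<le> 0" by (intro LIMSEQ_le_const) auto
    then show ?thesis by simp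
  qed
  with x show thesis using that by blast
qed

text \<open>
  Suppose that on the annihilator of some finite set \<open>N\<close> the functional \<open>\<xi>\<close> is bounded by \<open>\<epsilon>\<close>.  Extend
  its restriction to that annihilator to \<open>\<eta>\<close> with the same bound.  Then \<open>\<xi> - \<eta>\<close> vanishes on the
  annihilator of \<open>N\<close>, so it is an evaluation, and \<open>\<xi>\<close> is within \<open>\<epsilon>\<close> of it.  If this happened for every
  \<open>\<epsilon>\<close>, then \<open>\<xi>\<close> itself would be an evaluation.
\<close>

lemma evaluation_or_large_on_annihilators:
  fixes V :: "('k::real_or_complex, 'v) nspace"
  assumes E: "banach_space V"
    and add: "\<And>f g. f \<in> carrier (dual V) \<Longrightarrow> g \<in> carrier (dual V) \<Longrightarrow> \<xi> (f \<oplus>\<^bsub>dual V\<^esub> g) = \<xi> f + \<xi> g"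
    and smult: "\<And>c f. f \<in> carrier (dual V) \<Longrightarrow> \<xi> (c \<odot>\<^bsub>dual V\<^esub> f) = c * \<xi> f"
    and not_ev: "\<And>x. x \<in> carrier V \<Longrightarrow> \<exists>f\<in>carrier (dual V). \<xi> f \<noteq> f x"
  shows "\<exists>C. \<forall>N. finite N \<and> N \<subseteq> carrier V \<longrightarrow>
    (\<exists>f\<in>carrier (dual V). (\<forall>x\<in>N. f x = 0) \<and> \<xi> f = 1 \<and> sup_norm V f \<le> C)"
proof -
  have V: "normed_space V" using E by (simp add: banach_space_def)
  interpret normed_space V by (rule V)
  interpret D: normed_space "dual V" by (rule normed_space_dual)
  let ?D = "carrier (dual V)"
  have "\<exists>\<epsilon>>0. \<forall>N. finite N \<and> N \<subseteq> carrier V \<longrightarrow>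
      (\<exists>f\<in>?D. (\<forall>x\<in>N. f x = 0) \<and> \<epsilon> * sup_norm V f < norm (\<xi> f))"
  proof (rule ccontr)
    assume neg: "\<not> ?thesis"
    have "\<exists>x\<in>carrier V. \<forall>f\<in>?D. norm (\<xi> f - f x) \<le> \<epsilon> * sup_norm V f" if \<epsilon>: "0 < \<epsilon>" for \<epsilon>
    proof -
      obtain N where N: "finite N" "N \<subseteq> carrier V"
        and small: "\<And>f. f \<in> ?D \<Longrightarrow> (\<And>x. x \<in> N \<Longrightarrow> f x = 0) \<Longrightarrow> norm (\<xi> f) \<le> \<epsilon> * sup_norm V f"
        using neg \<epsilon> by (metis not_le)
      let ?N = "{f \<in> ?D. \<forall>x\<in>N. f x = 0}"
      obtain \<eta> where \<eta>: "linear_map (dual V) scalars \<eta>"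
        and \<eta>_le: "\<And>f. f \<in> ?D \<Longrightarrow> norm (\<eta> f) \<le> \<epsilon> * sup_norm V f" and \<eta>_N: "\<And>f. f \<in> ?N \<Longrightarrow> \<eta> f = \<xi> f"
      proof (rule hahn_banach[OF normed_space_dual, of "\<lambda>f. \<epsilon> * sup_norm V f" ?N \<xi>])
        show "\<epsilon> * sup_norm V (f \<oplus>\<^bsub>dual V\<^esub> g) \<le> \<epsilon> * sup_norm V f + \<epsilon> * sup_norm V g"
          if "f \<in> ?D" "g \<in> ?D" for f g
          using D.vnorm_triangle[OF that] \<epsilon> by (simp flip: distrib_left)
        show "\<epsilon> * sup_norm V (c \<odot>\<^bsub>dual V\<^esub> f) = norm c * (\<epsilon> * sup_norm V f)" if "f \<in> ?D" for c f
          using D.vnorm_smult[OF that, of c] by simp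
        show "f \<oplus>\<^bsub>dual V\<^esub> g \<in> ?N" if "f \<in> ?N" "g \<in> ?N" for f g
          using that D.M.a_closed[of f g] N(2) by auto
        show "c \<odot>\<^bsub>dual V\<^esub> f \<in> ?N" if "f \<in> ?N" for c f
          using that D.smult_closed'[of f c] N(2) by auto
        show "?N \<noteq> {}" using D.M.zero_closed N(2) by (auto simp: subset_iff intro!: exI[of _ "\<zero>\<^bsub>dual V\<^esub>"])
        show "norm (\<xi> f) \<le> \<epsilon> * sup_norm V f" if "f \<in> ?N" for f using small that by blast
        show "\<xi> (f \<oplus>\<^bsub>dual V\<^esub> g) = \<xi> f + \<xi> g" if "f \<in> ?N" "g \<in> ?N" for f g
          by (rule add) (use that in auto)
        show "\<xi> (c \<odot>\<^bsub>dual V\<^esub> f) = c * \<xi> f" if "f \<in> ?N" for c f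
          by (rule smult) (use that in auto)
      qed blast+
      obtain x where x: "x \<in> carrier V" "\<And>f. f \<in> ?D \<Longrightarrow> \<xi> f - \<eta> f = f x"
      proof (rule functional_on_dual_is_evaluation[OF V, of "\<lambda>f. \<xi> f - \<eta> f" N])
        show "\<xi> (f \<oplus>\<^bsub>dual V\<^esub> g) - \<eta> (f \<oplus>\<^bsub>dual V\<^esub> g) = \<xi> f - \<eta> f + (\<xi> g - \<eta> g)"
          if "f \<in> ?D" "g \<in> ?D" for f g
          by (subst add[OF that]) (use \<eta> that in \<open>simp add: linear_map_scalars_iff\<close>)
        show "\<xi> (c \<odot>\<^bsub>dual V\<^esub> f) - \<eta> (c \<odot>\<^bsub>dual V\<^esub> f) = c * (\<xi> f - \<eta> f)" if "f \<in> ?D" for c f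
          by (subst smult[OF that]) (use \<eta> that in \<open>simp add: linear_map_scalars_iff algebra_simps\<close>)
        show "\<xi> f - \<eta> f = 0" if "f \<in> ?D" "\<And>x. x \<in> N \<Longrightarrow> f x = 0" for f
          using \<eta>_N[of f] that by simp
      qed (use N in blast)+
      have "\<xi> f - f x = \<eta> f" if "f \<in> ?D" for f using x(2)[OF that] by (simp add: algebra_simps)
      with \<eta>_le show ?thesis by (intro bexI[OF _ x(1)] ballI) simp
    qed
    note approx = this
    show False
    proof (rule approximable_by_evaluations[OF E approx])
      fix x assume "x \<in> carrier V" "\<And>f. f \<in> ?D \<Longrightarrow> \<xi> f = f x"
      then show False using not_ev[of x] by blast
    qed
  qed
  then obtain \<epsilon> where \<epsilon>: "0 < \<epsilon>" and large: "\<forall>N. finite N \<and> N \<subseteq> carrier V \<longrightarrow>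
      (\<exists>f\<in>?D. (\<forall>x\<in>N. f x = 0) \<and> \<epsilon> * sup_norm V f < norm (\<xi> f))" by (elim exE conjE)
  show ?thesis
  proof (intro exI[of _ "inverse \<epsilon>"] allI impI)
    fix N assume N: "finite N \<and> N \<subseteq> carrier V"
    have "\<exists>f\<in>?D. (\<forall>x\<in>N. f x = 0) \<and> \<epsilon> * sup_norm V f < norm (\<xi> f)"
      using large N by simp
    then obtain f where f: "f \<in> ?D" "\<And>x. x \<in> N \<Longrightarrow> f x = 0" "\<epsilon> * sup_norm V f < norm (\<xi> f)"
      by (elim bexE conjE) simp
    have "0 \<le> \<epsilon> * sup_norm V f" using \<epsilon> f(1) by simp
    then have pos: "0 < norm (\<xi> f)" using f(3) by linarith
    let ?g = "inverse (\<xi> f) \<odot>\<^bsub>dual V\<^esub> f"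
    have "sup_norm V ?g = inverse (norm (\<xi> f)) * sup_norm V f"
      using D.vnorm_smult[OF f(1), of "inverse (\<xi> f)"] pos by (simp add: norm_inverse)
    also have "\<dots> \<le> inverse \<epsilon>" using f(3) \<epsilon> pos by (simp add: field_simps)
    finally have "sup_norm V ?g \<le> inverse \<epsilon>" .
    moreover have "\<xi> ?g = 1" by (subst smult[OF f(1)]) (use pos in simp)
    moreover have "?g x = 0" if "x \<in> N" for x using f(2)[OF that] that N by auto
    ultimately show "\<exists>f\<in>?D. (\<forall>x\<in>N. f x = 0) \<and> \<xi> f = 1 \<and> sup_norm V f \<le> inverse \<epsilon>"
      using D.smult_closed'[OF f(1)] by blast
  qed
qed

text \<open>
  Let \<open>\<xi>\<close> be a pointwise limit of evaluations at points of \<open>A\<close> and suppose that \<open>\<xi>\<close> is not an evaluation.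
  Choose alternately functionals \<open>f\<^sub>i\<close> of bounded norm that vanish at the points chosen before and satisfy
  \<open>\<xi> f\<^sub>i = 1\<close>, and points \<open>a\<^sub>i\<close> of \<open>A\<close> at which \<open>f\<^sub>0, \<dots>, f\<^sub>i\<close> approximate \<open>1\<close>.  A weak cluster point \<open>x\<close> of the
  points then satisfies \<open>f\<^sub>i x = 1\<close> for all \<open>i\<close>.  But \<open>x\<close> lies in the closed span of the points, and \<open>f\<^sub>i\<close>
  tends to \<open>0\<close> on that span.
\<close>

theorem eberlein:
  fixes V :: "('k::real_or_complex, 'v) nspace"
  assumes E: "banach_space V" and A: "A \<subseteq> carrier V"
    and bdd: "\<And>x. x \<in> A \<Longrightarrow> vnorm V x \<le> b"
    and seq: "\<And>s :: nat \<Rightarrow> 'v. range s \<subseteq> A \<Longrightarrow> relatively_weakly_compact V (range s)"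
  shows "relatively_weakly_compact V A"
proof -
  have V: "normed_space V" using E by (simp add: banach_space_def)
  interpret normed_space V by (rule V)
  interpret D: normed_space "dual V" by (rule normed_space_dual)
  let ?D = "carrier (dual V)" and ?ev = "\<lambda>x. \<lambda>f\<in>carrier (dual V). f x"
  let ?X = "product_topology (\<lambda>_. euclidean :: 'k topology) ?D"
  show ?thesis
  proof (rule relatively_weakly_compact_if_closure_evaluations[OF V A bdd], assumption, rule subsetI, rule ccontr)
    fix \<xi> assume \<xi>: "\<xi> \<in> ?X closure_of (?ev ` A)" and not_ev: "\<xi> \<notin> ?ev ` carrier V"
    have approx: "\<exists>a\<in>A. \<forall>f\<in>F. norm (\<xi> f - f a) < \<epsilon>" if F: "finite F" "F \<subseteq> ?D" and "0 < \<epsilon>" for F \<epsilon>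
    proof -
      obtain z where z: "z \<in> ?ev ` A" "\<And>f. f \<in> F \<Longrightarrow> dist (\<xi> f) (z f) < \<epsilon>"
        by (rule pointwise_closure_approx[OF \<xi> F \<open>0 < \<epsilon>\<close>]) blast
      then obtain a where "a \<in> A" "z = ?ev a" by blast
      then show ?thesis using z(2) F(2) by (intro bexI[of _ a]) (force simp: dist_norm subset_iff)+
    qed
    have ext: "\<xi> \<in> extensional ?D" using \<xi> by (auto simp: in_closure_of PiE_def)
    have add: "\<xi> (f \<oplus>\<^bsub>dual V\<^esub> g) = \<xi> f + \<xi> g" if f: "f \<in> ?D" and g: "g \<in> ?D" for f g
    proof (rule ccontr)
      let ?h = "f \<oplus>\<^bsub>dual V\<^esub> g"
      assume "\<not> ?thesis"
      then have \<epsilon>: "0 < norm (\<xi> ?h - (\<xi> f + \<xi> g)) / 3" by simp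
      obtain a where a: "a \<in> A" "\<forall>u\<in>{f, g, ?h}. norm (\<xi> u - u a) < norm (\<xi> ?h - (\<xi> f + \<xi> g)) / 3"
        using approx[OF _ _ \<epsilon>, of "{f, g, ?h}"] f g D.M.a_closed by blast
      have "?h a = f a + g a" using a A by auto
      then have e: "\<xi> ?h - (\<xi> f + \<xi> g) = (\<xi> ?h - ?h a) - ((\<xi> f - f a) + (\<xi> g - g a))" by simp
      have "norm (\<xi> ?h - (\<xi> f + \<xi> g)) \<le> norm (\<xi> ?h - ?h a) + (norm (\<xi> f - f a) + norm (\<xi> g - g a))"
        by (subst e) (rule order_trans[OF norm_triangle_ineq4 add_left_mono[OF norm_triangle_ineq]])
      then show False using a(2) by simp
    qed
    have smult: "\<xi> (c \<odot>\<^bsub>dual V\<^esub> f) = c * \<xi> f" if f: "f \<in> ?D" for c f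
    proof (rule ccontr)
      let ?h = "c \<odot>\<^bsub>dual V\<^esub> f"
      assume "\<not> ?thesis"
      then have d: "0 < norm (\<xi> ?h - c * \<xi> f)" by simp
      define \<epsilon> where "\<epsilon> = norm (\<xi> ?h - c * \<xi> f) / (norm c + 1)"
      have \<epsilon>: "0 < \<epsilon>" unfolding \<epsilon>_def using d by (intro divide_pos_pos) (auto intro: add_nonneg_pos)
      obtain a where a: "a \<in> A" "\<forall>u\<in>{f, ?h}. norm (\<xi> u - u a) < \<epsilon>"
        using approx[OF _ _ \<epsilon>, of "{f, ?h}"] f D.smult_closed' by blast
      have "?h a = c * f a" using a A by auto
      then have e: "\<xi> ?h - c * \<xi> f = (\<xi> ?h - ?h a) - c * (\<xi> f - f a)" by (simp add: algebra_simps)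
      have "norm (\<xi> ?h - c * \<xi> f) \<le> norm (\<xi> ?h - ?h a) + norm c * norm (\<xi> f - f a)"
        by (subst e) (rule order_trans[OF norm_triangle_ineq4], simp add: norm_mult)
      also have "\<dots> < \<epsilon> + norm c * \<epsilon>"
        using a(2) by (intro add_less_le_mono mult_left_mono) auto
      also have "\<dots> = norm (\<xi> ?h - c * \<xi> f)"
        using norm_ge_zero[of c] by (simp add: \<epsilon>_def field_simps add_nonneg_eq_0_iff)
      finally show False by simp
    qed
    have ne: "\<exists>f\<in>?D. \<xi> f \<noteq> f x" if "x \<in> carrier V" for x
    proof (rule ccontr)
      assume "\<not> ?thesis"
      then have "\<xi> = ?ev x" using ext by (intro extensionalityI[of _ ?D]) auto
      with not_ev that show False by blast
    qed
    obtain C where C: "\<forall>N. finite N \<and> N \<subseteq> carrier V \<longrightarrow>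
        (\<exists>f\<in>?D. (\<forall>x\<in>N. f x = 0) \<and> \<xi> f = 1 \<and> sup_norm V f \<le> C)"
      using evaluation_or_large_on_annihilators[OF E add smult ne] ..
    \<comment> \<open>A state consists of the points and the functionals chosen so far and the last of each.\<close>
    define P where "P n S = (case S of (N, F, f, a) \<Rightarrow> finite N \<and> N \<subseteq> carrier V \<and> finite F \<and> F \<subseteq> ?D \<and>
      f \<in> F \<and> a \<in> N \<and> a \<in> A \<and> \<xi> f = 1 \<and> sup_norm V f \<le> C \<and>
      (\<forall>g\<in>F. norm (\<xi> g - g a) < inverse (real (Suc n))))" for n S
    define Q where "Q S S' = (case S of (N, F, f, a) \<Rightarrow> case S' of (N', F', f', a') \<Rightarrow>
      N \<subseteq> N' \<and> F \<subseteq> F' \<and> (\<forall>x\<in>N. f' x = 0))" for S S' :: "'v set \<times> ('v \<Rightarrow> 'k) set \<times> ('v \<Rightarrow> 'k) \<times> 'v"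
    have step: "\<exists>f a. P n (insert a N, insert f F, f, a) \<and> (\<forall>x\<in>N. f x = 0)"
      if N: "finite N" "N \<subseteq> carrier V" "finite F" "F \<subseteq> ?D" for n N F
    proof -
      have "\<exists>f\<in>?D. (\<forall>x\<in>N. f x = 0) \<and> \<xi> f = 1 \<and> sup_norm V f \<le> C" using C N by simp
      then obtain f where f: "f \<in> ?D" "\<forall>x\<in>N. f x = 0" "\<xi> f = 1" "sup_norm V f \<le> C" by blast
      obtain a where "a \<in> A" "\<forall>g\<in>insert f F. norm (\<xi> g - g a) < inverse (real (Suc n))"
        using approx[of "insert f F" "inverse (real (Suc n))"] N f by auto
      then show ?thesis using f N A by (intro exI[of _ f] exI[of _ a]) (auto simp: P_def)
    qed
    have "\<exists>S. \<forall>n. P n (S n) \<and> Q (S n) (S (Suc n))"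
    proof (rule dependent_nat_choice)
      show "\<exists>S. P 0 S" using step[of "{}" "{}" 0] by blast
      show "\<exists>S'. P (Suc n) S' \<and> Q S S'" if "P n S" for S n
      proof -
        obtain N F f a where S: "S = (N, F, f, a)" by (cases S) auto
        have "finite N" "N \<subseteq> carrier V" "finite F" "F \<subseteq> ?D" using that by (auto simp: S P_def)
        from step[OF this, of "Suc n"] obtain f' a' where
          "P (Suc n) (insert a' N, insert f' F, f', a')" "\<forall>x\<in>N. f' x = 0" by blast
        then show ?thesis by (intro exI[of _ "(insert a' N, insert f' F, f', a')"]) (auto simp: Q_def S)
      qed
    qed
    then obtain S where PS: "\<And>n. P n (S n)" and QS: "\<And>n. Q (S n) (S (Suc n))" by blast
    define N where "N n = fst (S n)" for n
    define F where "F n = fst (snd (S n))" for n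
    define f where "f n = fst (snd (snd (S n)))" for n
    define a where "a n = snd (snd (snd (S n)))" for n
    have S: "S n = (N n, F n, f n, a n)" for n by (simp add: N_def F_def f_def a_def)
    have f: "f n \<in> ?D" "sup_norm V (f n) \<le> C" "\<xi> (f n) = 1" "f n \<in> F n" and a: "a n \<in> N n" "a n \<in> A"
      and FN: "\<And>g. g \<in> F n \<Longrightarrow> norm (\<xi> g - g (a n)) < inverse (real (Suc n))" for n
      using PS[of n] by (auto simp: P_def S)
    have NF_Suc: "N n \<subseteq> N (Suc n)" "F n \<subseteq> F (Suc n)" and f_Suc: "\<And>x. x \<in> N n \<Longrightarrow> f (Suc n) x = 0" for n
      using QS[of n] by (auto simp: Q_def S)
    have N_mono: "N m \<subseteq> N n" and F_mono: "F m \<subseteq> F n" if "m \<le> n" for m n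
      using that NF_Suc lift_Suc_mono_le[of N] lift_Suc_mono_le[of F] by blast+
    have fa_0: "f i (a j) = 0" if "j < i" for i j
    proof (cases i)
      case (Suc n)
      then have "a j \<in> N n" using a(1) N_mono[of j n] that by auto
      then show ?thesis using f_Suc Suc by simp
    qed (use that in simp)
    have fa_1: "norm (1 - f j (a i)) < inverse (real (Suc i))" if "j \<le> i" for i j
      using FN[of "f j" i] f(4)[of j] F_mono[OF that] f(3)[of j] by auto
    have aV: "a n \<in> carrier V" for n using a A by blast
    have "relatively_weakly_compact V (range a)" by (rule seq) (use a in blast)
    then obtain x where x: "\<And>n. x \<in> weak_topology V closure_of (a ` {n..})"
      by (rule weak_cluster_point[OF V]) blast
    have xV: "x \<in> carrier V" using x[of 0] by (auto simp: in_closure_of)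
    have fx: "f j x = 1" for j
    proof (rule ccontr)
      assume "f j x \<noteq> 1"
      then have \<epsilon>: "0 < norm (1 - f j x) / 2" by simp
      then obtain m where m: "inverse (real (Suc m)) < norm (1 - f j x) / 2" using reals_Archimedean by blast
      obtain y where "y \<in> a ` {max m j..}" "norm (f j y - f j x) < norm (1 - f j x) / 2"
        by (rule weak_closure_approx[OF x f(1) \<epsilon>])
      then obtain i where i: "m \<le> i" "j \<le> i" "norm (f j (a i) - f j x) < norm (1 - f j x) / 2" by auto
      have "inverse (real (Suc i)) \<le> inverse (real (Suc m))" using i by (intro le_imp_inverse_le) auto
      then have "norm (1 - f j (a i)) < norm (1 - f j x) / 2" using fa_1[OF i(2)] m by linarith
      then show False
        using i(3) norm_triangle_ineq[of "1 - f j (a i)" "f j (a i) - f j x"] by simp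
    qed
    \<comment> \<open>a subspace that contains all points \<open>a j\<close>, easier to handle than their span\<close>
    define M where "M = {y \<in> carrier V. \<exists>n. \<forall>i\<ge>n. f i y = 0}"
    have aM: "a j \<in> M" for j using aV fa_0 by (auto simp: M_def intro!: exI[of _ "Suc j"])
    \<comment> \<open>so small that a functional of norm at most \<open>C\<close> is less than \<open>1\<close> on vectors of norm at most \<open>\<delta>\<close>\<close>
    define \<delta> where "\<delta> = inverse (\<bar>C\<bar> + 1)"
    have \<delta>: "0 < \<delta>" by (simp add: \<delta>_def)
    obtain y where y: "y \<in> M" "vnorm V (x \<ominus>\<^bsub>V\<^esub> y) < \<delta>"
    proof (rule mazur_subspace[OF V _ _ _ _ xV _ \<delta>, of M])
      show "M \<subseteq> carrier V" by (auto simp: M_def)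
      show "M \<noteq> {}" using aM by blast
      show "u \<oplus>\<^bsub>V\<^esub> v \<in> M" if uv: "u \<in> M" "v \<in> M" for u v
      proof -
        obtain m n where "\<forall>i\<ge>m. f i u = 0" "\<forall>i\<ge>n. f i v = 0" using uv by (auto simp: M_def)
        then have "\<forall>i\<ge>max m n. f i (u \<oplus>\<^bsub>V\<^esub> v) = 0" using uv by (auto simp: M_def dual_add[OF f(1)])
        then show ?thesis using uv unfolding M_def by blast
      qed
      show "c \<odot>\<^bsub>V\<^esub> u \<in> M" if "u \<in> M" for c u
        using that by (auto simp: M_def dual_smult[OF f(1)])
      show "h x = 0" if h: "h \<in> ?D" and hM: "\<And>y. y \<in> M \<Longrightarrow> h y = 0" for h
      proof (rule ccontr)
        assume "h x \<noteq> 0"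
        then obtain y where "y \<in> a ` {0..}" "norm (h y - h x) < norm (h x)"
          using weak_closure_approx[OF x h, of "norm (h x)" 0] by auto
        then show False using hM aM by auto
      qed
    qed blast
    then obtain n where n: "f n y = 0" by (auto simp: M_def)
    have yV: "y \<in> carrier V" using y by (auto simp: M_def)
    have "1 = norm (f n (x \<ominus>\<^bsub>V\<^esub> y))" using fx n f(1) xV yV by (simp add: dual_minus)
    also have "\<dots> \<le> sup_norm V (f n) * vnorm V (x \<ominus>\<^bsub>V\<^esub> y)" by (rule dual_bound[OF f(1)]) (use xV yV in simp)
    also have "\<dots> \<le> \<bar>C\<bar> * \<delta>" using f(1,2)[of n] y(2) xV yV by (intro mult_mono) auto
    also have "\<dots> < 1" by (simp add: \<delta>_def field_simps)
    finally show False by simp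
  qed
qed


section \<open>Series and \<open>(V\<^sup>*)\<close> sets\<close>

context normed_space
begin

lemma limitin_norm_topology_iff:
  "limitin (norm_topology V) s l sequentially \<longleftrightarrow>
     l \<in> carrier V \<and> (\<forall>\<^sub>F n in sequentially. s n \<in> carrier V) \<and> (\<lambda>n. vdist V (s n) l) \<longlonglongrightarrow> 0"
  by (rule Metric_space.limitin_metric_dist_null[OF Metric_space_vdist])

lemma convergent_series_terms:
  assumes x: "\<And>n. x n \<in> carrier V" and "convergent_series V x"
  shows "(\<lambda>n. vnorm V (x n)) \<longlonglongrightarrow> 0"
proof -
  let ?S = "\<lambda>n. finsum V x {..<n}"
  have S: "?S n \<in> carrier V" for n by (rule M.finsum_closed) (use x in auto)
  obtain l where l: "l \<in> carrier V" and lim: "(\<lambda>n. vnorm V (?S n \<ominus> l)) \<longlonglongrightarrow> 0"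
    using assms(2) S by (auto simp: convergent_series_def limitin_norm_topology_iff)
  have le: "vnorm V (x n) \<le> vnorm V (?S (Suc n) \<ominus> l) + vnorm V (?S n \<ominus> l)" for n
  proof -
    have "?S (Suc n) = x n \<oplus> ?S n"
      unfolding lessThan_Suc by (rule M.finsum_insert) (use x in auto)
    then have "?S (Suc n) \<ominus> ?S n = x n"
      using x[of n] S[of n] smult_add_left[OF S[of n], of 1 "-1"]
      by (simp add: minus_eq_smult M.a_assoc)
    then have "vnorm V (x n) \<le> vnorm V (?S (Suc n) \<ominus> l) + vnorm V (l \<ominus> ?S n)"
      using vnorm_diff_triangle[OF S l S, of "Suc n" n] by simp
    then show ?thesis using vnorm_minus_commute[OF l S] by simp
  qed
  have "(\<lambda>n. vnorm V (?S (Suc n) \<ominus> l) + vnorm V (?S n \<ominus> l)) \<longlonglongrightarrow> 0 + 0"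
    by (intro tendsto_add lim LIMSEQ_Suc[OF lim])
  then show ?thesis
    by (intro Lim_null_comparison[of "\<lambda>n. vnorm V (x n)"]) (use le x in auto)
qed

lemma wuC_dual_carrier: "wuC_series (dual V) f \<Longrightarrow> f n \<in> carrier (dual V)"
  by (auto simp: wuC_series_def)

lemma wuC_dual_summable:
  assumes f: "wuC_series (dual V) f" and x: "x \<in> carrier V"
  shows "summable (\<lambda>n. norm (f n x))"
proof -
  have "summable (\<lambda>n. norm ((\<lambda>f\<in>carrier (dual V). f x) (f n)))"
    using f evaluation_dual_dual[OF x] unfolding wuC_series_def by blast
  then show ?thesis using wuC_dual_carrier[OF f] by simp
qed

end

lemma wuC_series_subseq:
  assumes "wuC_series V f" "strict_mono r" shows "wuC_series V (f \<circ> r)"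
proof -
  have "summable (\<lambda>i. norm (g ((f \<circ> r) i)))" if "g \<in> carrier (dual V)" for g
    using summable_reindex[of "\<lambda>i. norm (g (f i))" r] assms that
    by (auto simp: wuC_series_def strict_mono_imp_inj_on o_def)
  then show ?thesis using assms by (auto simp: wuC_series_def)
qed

lemma wuC_series_blocks:
  assumes V: "normed_space V" and f: "wuC_series V f"
    and ord: "\<And>j. m j \<le> n j" "\<And>j. n j \<le> m (Suc j)"
  shows "wuC_series V (\<lambda>j. finsum V f {m j..<n j})"
proof -
  interpret normed_space V by (rule V)
  have fV: "f i \<in> carrier V" for i using f by (auto simp: wuC_series_def)
  have "summable (\<lambda>j. norm (g (finsum V f {m j..<n j})))" if g: "g \<in> carrier (dual V)" for g
  proof -
    let ?a = "\<lambda>i. norm (g (f i))"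
    have sum: "summable ?a" using f g by (simp add: wuC_series_def)
    have le: "norm (g (finsum V f {m j..<n j})) \<le> (\<Sum>i=m j..<n j. ?a i)" for j
      using fV by (simp add: dual_finsum[OF g] norm_sum)
    have "(\<Sum>j<J. \<Sum>i=m j..<n j. ?a i) \<le> (\<Sum>i<m J. ?a i)" for J
    proof (induction J)
      case (Suc J)
      have "(\<Sum>j<Suc J. \<Sum>i=m j..<n j. ?a i) \<le> (\<Sum>i<m J. ?a i) + (\<Sum>i=m J..<n J. ?a i)"
        using Suc by simp
      also have "\<dots> = (\<Sum>i<n J. ?a i)"
        using ord(1)[of J] by (simp add: sum.atLeastLessThan_concat lessThan_atLeast0)
      also have "\<dots> \<le> (\<Sum>i<m (Suc J). ?a i)"
        using ord(2)[of J] by (intro sum_mono2) auto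
      finally show ?case .
    qed (simp add: sum_nonneg)
    then have bound: "(\<Sum>j<J. \<Sum>i=m j..<n j. ?a i) \<le> suminf ?a" for J
      using sum_le_suminf[OF sum, of "{..<m J}"] by (meson finite_lessThan norm_ge_zero order_trans)
    have "summable (\<lambda>j. \<Sum>i=m j..<n j. ?a i)"
      by (rule summableI_nonneg_bounded[OF _ bound]) (simp add: sum_nonneg)
    then show ?thesis by (rule summable_comparison_test'[of _ 0]) (use le in simp)
  qed
  moreover have "finsum V f {m j..<n j} \<in> carrier V" for j
    by (rule M.finsum_closed) (use fV in auto)
  ultimately show ?thesis by (auto simp: wuC_series_def)
qed

lemma V_star_set_uniform_limit:
  assumes "V_star_set V A" "wuC_series (dual V) f" "0 < \<epsilon>"
  obtains N where "\<And>n x. N \<le> n \<Longrightarrow> x \<in> A \<Longrightarrow> norm (f n x) < \<epsilon>"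
proof -
  have "(\<lambda>n. SUP x\<in>A. ennreal (norm (f n x))) \<longlonglongrightarrow> 0"
    using assms by (auto simp: V_star_set_def)
  then have "\<forall>\<^sub>F n in sequentially. (SUP x\<in>A. ennreal (norm (f n x))) < ennreal \<epsilon>"
    using \<open>0 < \<epsilon>\<close> by (intro order_tendstoD) auto
  then obtain N where N: "\<And>n. N \<le> n \<Longrightarrow> (SUP x\<in>A. ennreal (norm (f n x))) < ennreal \<epsilon>"
    by (auto simp: eventually_sequentially)
  have "norm (f n x) < \<epsilon>" if "N \<le> n" "x \<in> A" for n x
  proof -
    have "ennreal (norm (f n x)) \<le> (SUP x\<in>A. ennreal (norm (f n x)))" using that by (intro SUP_upper)
    also have "\<dots> < ennreal \<epsilon>" by (rule N[OF that(1)])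
    finally show ?thesis using \<open>0 < \<epsilon>\<close> by (simp add: ennreal_less_iff)
  qed
  then show thesis by (rule that)
qed

text \<open>
  If this fails for some \<open>\<epsilon>\<close>, there are successive blocks of the series that exceed \<open>\<epsilon>\<close> somewhere on \<open>A\<close>.
  Their sums form a w.u.C. series that contradicts the definition of a \<open>(V\<^sup>*)\<close> set.
\<close>

lemma V_star_set_uniformly_Cauchy:
  fixes V :: "('k::real_normed_field, 'v) nspace"
  assumes V: "normed_space V" and A: "V_star_set V A" and f: "wuC_series (dual V) f" and \<epsilon>: "0 < \<epsilon>"
  shows "\<exists>N. \<forall>m n. N \<le> m \<longrightarrow> (\<forall>x\<in>A. norm (\<Sum>i=m..<n. f i x) \<le> \<epsilon>)"
proof (rule ccontr)
  interpret normed_space V by (rule V)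
  interpret D: normed_space "dual V" by (rule normed_space_dual)
  assume "\<not> ?thesis"
  then have "\<forall>N. \<exists>m\<ge>N. \<exists>n. \<exists>x\<in>A. \<epsilon> < norm (\<Sum>i=m..<n. f i x)" by (simp add: not_le)
  then obtain m n x where mnx: "\<And>N. N \<le> m N" "\<And>N. x N \<in> A" "\<And>N. \<epsilon> < norm (\<Sum>i=m N..<n N. f i (x N))"
    by metis
  have mn: "m N \<le> n N" for N
  proof (rule ccontr)
    assume "\<not> ?thesis"
    then have "{m N..<n N} = {}" by simp
    then show False using mnx(3)[of N] \<epsilon> by (simp only: sum.empty norm_zero)
  qed
  \<comment> \<open>The block found beyond \<open>p j\<close> ends at \<open>p (Suc j)\<close>.\<close>
  define p where "p j = (n ^^ j) 0" for j
  define h where "h j = finsum (dual V) f {m (p j)..<n (p j)}" for j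
  have "wuC_series (dual V) h"
    unfolding h_def
    by (rule wuC_series_blocks[OF normed_space_dual f]) (use mn mnx(1)[of "n _"] in \<open>auto simp: p_def\<close>)
  then obtain N where N: "\<And>j y. N \<le> j \<Longrightarrow> y \<in> A \<Longrightarrow> norm (h j y) < \<epsilon>"
    by (rule V_star_set_uniform_limit[OF A _ \<epsilon>]) blast
  have "x (p N) \<in> carrier V" using A mnx(2) by (auto simp: V_star_set_def)
  then have "h N (x (p N)) = (\<Sum>i=m (p N)..<n (p N). f i (x (p N)))"
    unfolding h_def dual_def
    by (intro function_space_finsum normed_space_dual[unfolded dual_def])
      (use wuC_dual_carrier[OF f] in \<open>auto simp: dual_def\<close>)
  then show False using N[of N "x (p N)"] mnx(2,3)[of "p N"] by simp
qed

text \<open>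
  At points \<open>x\<^sub>n\<close> of norm greater than \<open>4 ^ n\<close> take norming functionals \<open>f\<^sub>n\<close>.  The series with terms
  \<open>f\<^sub>n / 2 ^ n\<close> converges absolutely, yet its \<open>n\<close>-th term exceeds \<open>2 ^ n\<close> at \<open>x\<^sub>n\<close>.
\<close>

lemma V_star_set_bounded:
  fixes V :: "('k::real_or_complex, 'v) nspace"
  assumes V: "normed_space V" and A: "V_star_set V A"
  obtains b where "\<And>x. x \<in> A \<Longrightarrow> vnorm V x \<le> b"
proof (rule ccontr)
  interpret normed_space V by (rule V)
  interpret D: normed_space "dual V" by (rule normed_space_dual)
  assume "\<not> thesis"
  then have "\<forall>b. \<exists>x\<in>A. b < vnorm V x" using that by (meson not_le)
  then have "\<forall>n. \<exists>x\<in>A. 4 ^ n < vnorm V x" by blast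
  then obtain x where x: "\<And>n. x n \<in> A" "\<And>n. 4 ^ n < vnorm V (x n)" by metis
  have AV: "A \<subseteq> carrier V" using A by (simp add: V_star_set_def)
  have "\<exists>f\<in>carrier (dual V). sup_norm V f \<le> 1 \<and> f (x n) = of_real (vnorm V (x n))" for n
    using norming_functional[OF V, of "x n"] x(1)[of n] AV by blast
  then obtain f where f: "\<And>n. f n \<in> carrier (dual V)" "\<And>n. sup_norm V (f n) \<le> 1"
    "\<And>n. f n (x n) = of_real (vnorm V (x n))" by metis
  define g where "g n = of_real ((1/2) ^ n) \<odot>\<^bsub>dual V\<^esub> f n" for n
  have "summable (\<lambda>n. norm (\<Psi> (g n)))" if \<Psi>: "\<Psi> \<in> carrier (dual (dual V))" for \<Psi>
  proof (rule summable_comparison_test')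
    show "summable (\<lambda>n. (1/2) ^ n * sup_norm (dual V) \<Psi>)"
      by (intro summable_mult2 summable_geometric) simp
    fix n
    have "norm (\<Psi> (f n)) \<le> sup_norm (dual V) \<Psi> * sup_norm V (f n)"
      using D.dual_bound[OF \<Psi> f(1)[of n]] by simp
    also have "\<dots> \<le> sup_norm (dual V) \<Psi> * 1"
      by (rule mult_left_mono[OF f(2) D.sup_norm_dual_nonneg[OF \<Psi>]])
    finally show "norm (norm (\<Psi> (g n))) \<le> (1/2) ^ n * sup_norm (dual V) \<Psi>"
      unfolding g_def D.dual_smult[OF \<Psi> f(1)] by (simp add: norm_mult norm_power)
  qed
  moreover have "g n \<in> carrier (dual V)" for n unfolding g_def by (rule D.smult_closed'[OF f(1)])
  ultimately have "wuC_series (dual V) g" by (auto simp: wuC_series_def)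
  then obtain N where N: "\<And>n y. N \<le> n \<Longrightarrow> y \<in> A \<Longrightarrow> norm (g n y) < 1"
    by (rule V_star_set_uniform_limit[OF A _ zero_less_one]) blast
  have "norm (g N (x N)) = (1/2) ^ N * vnorm V (x N)"
    using x(1)[of N] AV by (auto simp: g_def f(3) norm_mult norm_power subset_iff)
  moreover have "(1/2) ^ N * 4 ^ N \<le> (1/2) ^ N * vnorm V (x N)"
    using x(2)[of N] by (intro mult_left_mono) auto
  moreover have "(1/2) ^ N * 4 ^ N = (2 ^ N :: real)" by (simp flip: power_mult_distrib)
  moreover have "(1 :: real) \<le> 2 ^ N" by simp
  ultimately show False using N[of N "x N"] x(1)[of N] by linarith
qed


section \<open>Homogeneous polynomials\<close>

lemma hom_polynomials_continuous:
  assumes V: "normed_space V" and P: "P \<in> hom_polynomials k V W"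
  shows "continuous_map (norm_topology V) (norm_topology W) P"
proof -
  interpret normed_space V by (rule V)
  interpret Metric_space "carrier V" "vdist V" by (rule Metric_space_vdist)
  obtain A where A: "continuous_map (product_topology (\<lambda>_. mtopology) {..<k}) (norm_topology W) A"
    and P: "P = (\<lambda>x\<in>carrier V. A (\<lambda>i\<in>{..<k}. x))"
    using P by (auto simp: hom_polynomials_def)
  have "continuous_map mtopology (product_topology (\<lambda>_. mtopology) {..<k}) (\<lambda>x. \<lambda>i\<in>{..<k}. x)"
    unfolding continuous_map_componentwise by (auto simp: continuous_map_id[unfolded id_def])
  then have "continuous_map mtopology (norm_topology W) (A \<circ> (\<lambda>x. \<lambda>i\<in>{..<k}. x))"
    using A by (rule continuous_map_compose)
  then show ?thesis by (rule continuous_map_eq) (simp add: P)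
qed

lemma hom_polynomials_homogeneous:
  assumes V: "normed_space V" and W: "normed_space W" and P: "P \<in> hom_polynomials k V W"
    and x: "x \<in> carrier V" and k: "1 \<le> k"
  shows "P x \<in> carrier W" "P (c \<odot>\<^bsub>V\<^esub> x) = c ^ k \<odot>\<^bsub>W\<^esub> P x"
proof -
  interpret V: normed_space V by (rule V)
  interpret W: normed_space W by (rule W)
  obtain A where A: "multilinear_map k V W A" and P: "P = (\<lambda>x\<in>carrier V. A (\<lambda>i\<in>{..<k}. x))"
    using P by (auto simp: hom_polynomials_def)
  have lin: "linear_map V W (\<lambda>y. A (u(i := y)))" if "i < k" "u \<in> {..<k} \<rightarrow>\<^sub>E carrier V" for i u
    using A that by (simp add: multilinear_map_def)
  have closed: "A u \<in> carrier W" if u: "u \<in> {..<k} \<rightarrow>\<^sub>E carrier V" for u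
  proof -
    have "linear_map V W (\<lambda>y. A (u(0 := y)))" by (rule lin[OF _ u]) (use k in simp)
    then have "(\<lambda>y. A (u(0 := y))) \<in> carrier V \<rightarrow> carrier W" by (simp only: linear_map_def)
    moreover have "u 0 \<in> carrier V" by (rule PiE_mem[OF u]) (use k in simp)
    ultimately have "A (u(0 := u 0)) \<in> carrier W" by (rule funcset_mem)
    then show ?thesis by simp
  qed
  show "P x \<in> carrier W" using x closed[of "\<lambda>i\<in>{..<k}. x"] by (simp add: P restrict_PiE_iff)
  have Au: "A (\<lambda>i\<in>{..<k}. x) \<in> carrier W" using x by (intro closed) (simp add: restrict_PiE_iff)
  let ?u = "\<lambda>j. \<lambda>i\<in>{..<k}. if i < j then c \<odot>\<^bsub>V\<^esub> x else x"
  have "A (?u j) = c ^ j \<odot>\<^bsub>W\<^esub> A (\<lambda>i\<in>{..<k}. x)" if "j \<le> k" for j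
    using that
  proof (induction j)
    case 0
    have "?u 0 = (\<lambda>i\<in>{..<k}. x)" by auto
    then show ?case by (simp only: power_0 W.smult_1[OF Au])
  next
    case (Suc j)
    have u: "?u j \<in> {..<k} \<rightarrow>\<^sub>E carrier V" using x by auto
    have "A (?u (Suc j)) = A ((?u j)(j := c \<odot>\<^bsub>V\<^esub> x))"
      by (rule arg_cong[of _ _ A]) (use Suc.prems in \<open>auto simp: fun_eq_iff\<close>)
    also have "\<dots> = c \<odot>\<^bsub>W\<^esub> A ((?u j)(j := x))"
      using lin[OF _ u, of j] Suc.prems x by (simp add: linear_map_def)
    also have "(?u j)(j := x) = ?u j" using Suc.prems by (auto simp: fun_eq_iff)
    also have "A (?u j) = c ^ j \<odot>\<^bsub>W\<^esub> A (\<lambda>i\<in>{..<k}. x)" 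
      by (rule Suc.IH) (use Suc.prems in simp)
    finally show ?case by (simp only: W.smult_smult[OF Au] power_Suc)
  qed
  from this[OF order_refl] have "A (?u k) = c ^ k \<odot>\<^bsub>W\<^esub> A (\<lambda>i\<in>{..<k}. x)" .
  moreover have "?u k = (\<lambda>i\<in>{..<k}. c \<odot>\<^bsub>V\<^esub> x)" by auto
  moreover have "P (c \<odot>\<^bsub>V\<^esub> x) = A (\<lambda>i\<in>{..<k}. c \<odot>\<^bsub>V\<^esub> x)" "P x = A (\<lambda>i\<in>{..<k}. x)"
    unfolding P using x by (simp_all only: restrict_apply' V.smult_closed')
  ultimately show "P (c \<odot>\<^bsub>V\<^esub> x) = c ^ k \<odot>\<^bsub>W\<^esub> P x" by (simp only:)
qed

context normed_space
begin

lemma scalar_polynomial_homogeneous: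
  assumes "P \<in> hom_polynomials k V scalars" "x \<in> carrier V" "1 \<le> k"
  shows "P (c \<odot> x) = c ^ k * P x"
  using hom_polynomials_homogeneous(2)[OF normed_space_axioms normed_space_scalars assms] by simp

lemma scalar_polynomial_bounded:
  assumes P: "P \<in> hom_polynomials k V scalars" and k: "1 \<le> k"
  shows "\<exists>b. \<forall>x\<in>carrier V. vnorm V x \<le> 1 \<longrightarrow> norm (P x) \<le> b"
proof -
  interpret Metric_space "carrier V" "vdist V" by (rule Metric_space_vdist)
  note hom = scalar_polynomial_homogeneous[OF P _ k]
  have P0: "P \<zero> = 0" using hom[of \<zero> 0] k by (simp add: power_0_left)
  have "openin mtopology {x \<in> carrier V. P x \<in> ball 0 1}"
    using openin_continuous_map_preimage[OF hom_polynomials_continuous[OF normed_space_axioms P], of "ball 0 1"]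
    by simp
  moreover have "\<zero> \<in> {x \<in> carrier V. P x \<in> ball 0 1}" using P0 by simp
  ultimately obtain r where r: "0 < r" "mball \<zero> r \<subseteq> {x \<in> carrier V. P x \<in> ball 0 1}"
    unfolding openin_mtopology by blast
  have "norm (P x) \<le> (2 / r) ^ k" if x: "x \<in> carrier V" "vnorm V x \<le> 1" for x
  proof -
    let ?c = "of_real (r / 2)"
    have "vdist V \<zero> (?c \<odot> x) = vnorm V (?c \<odot> x)"
      using x vnorm_minus_commute[of \<zero> "?c \<odot> x"] by (simp add: minus_eq_smult)
    also have "\<dots> = r / 2 * vnorm V x" unfolding vnorm_smult[OF x(1)] using r(1) by simp
    also have "\<dots> \<le> r / 2 * 1" using x r(1) by (intro mult_left_mono) auto
    also have "\<dots> < r" using r(1) by simp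
    finally have "?c \<odot> x \<in> mball \<zero> r" using x by simp
    from subsetD[OF r(2) this] have "P (?c \<odot> x) \<in> ball 0 1" by blast
    then have "norm (P (?c \<odot> x)) < 1" by simp
    then have "(r / 2) ^ k * norm (P x) < 1"
      unfolding hom[OF x(1)] using r(1) by (simp add: norm_mult norm_power norm_divide)
    then show ?thesis using r(1) by (simp add: field_simps)
  qed
  then show ?thesis by blast
qed

lemma scalar_polynomial_bound:
  assumes P: "P \<in> hom_polynomials k V scalars" and k: "1 \<le> k" and x: "x \<in> carrier V"
  shows "norm (P x) \<le> sup_norm V P * vnorm V x ^ k"
proof (rule homogeneous_ball_bound[OF _ _ k x])
  show "norm (P (c \<odot> x)) = norm c ^ k * norm (P x)" if "x \<in> carrier V" for c x
    using scalar_polynomial_homogeneous[OF P that k] by (simp add: norm_mult norm_power)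
  show "norm (P x) \<le> sup_norm V P" if "x \<in> carrier V" "vnorm V x \<le> 1" for x
    using scalar_polynomial_bounded[OF P k] sup_norm_upper that by metis
qed

lemma hom_polynomials_scalars_add:
  assumes "P \<in> hom_polynomials k V scalars" "Q \<in> hom_polynomials k V scalars"
  shows "(\<lambda>x\<in>carrier V. P x + Q x) \<in> hom_polynomials k V scalars"
proof -
  let ?X = "product_topology (\<lambda>_. norm_topology V) {..<k}"
  obtain A B where A: "multilinear_map k V scalars A" "continuous_map ?X (norm_topology scalars) A"
      "P = (\<lambda>x\<in>carrier V. A (\<lambda>i\<in>{..<k}. x))"
    and B: "multilinear_map k V scalars B" "continuous_map ?X (norm_topology scalars) B"
      "Q = (\<lambda>x\<in>carrier V. B (\<lambda>i\<in>{..<k}. x))"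
    using assms by (auto simp: hom_polynomials_def)
  have "multilinear_map k V scalars (\<lambda>x. A x + B x)"
    using A(1) B(1) unfolding multilinear_map_def linear_map_scalars_iff
    by (auto simp: algebra_simps)
  moreover have "continuous_map ?X (norm_topology scalars) (\<lambda>x. A x + B x)"
    using A(2) B(2) by (simp add: continuous_map_add)
  moreover have "(\<lambda>x\<in>carrier V. P x + Q x) = (\<lambda>x\<in>carrier V. A (\<lambda>i\<in>{..<k}. x) + B (\<lambda>i\<in>{..<k}. x))"
    by (auto simp: A(3) B(3))
  ultimately show ?thesis unfolding hom_polynomials_def by blast
qed

lemma hom_polynomials_scalars_smult:
  assumes "P \<in> hom_polynomials k V scalars"
  shows "(\<lambda>x\<in>carrier V. c * P x) \<in> hom_polynomials k V scalars"
proof -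
  let ?X = "product_topology (\<lambda>_. norm_topology V) {..<k}"
  obtain A where A: "multilinear_map k V scalars A" "continuous_map ?X (norm_topology scalars) A"
      "P = (\<lambda>x\<in>carrier V. A (\<lambda>i\<in>{..<k}. x))"
    using assms by (auto simp: hom_polynomials_def)
  have "multilinear_map k V scalars (\<lambda>x. c * A x)"
    using A(1) unfolding multilinear_map_def linear_map_scalars_iff
    by (auto simp: algebra_simps)
  moreover have "continuous_map euclidean euclidean (\<lambda>x. c * x)"
    by (simp add: continuous_on_mult_left)
  then have "continuous_map ?X (norm_topology scalars) (\<lambda>x. c * A x)"
    using continuous_map_compose[of ?X euclidean A euclidean "\<lambda>x. c * x"] A(2) by (simp add: o_def)
  moreover have "(\<lambda>x\<in>carrier V. c * P x) = (\<lambda>x\<in>carrier V. c * A (\<lambda>i\<in>{..<k}. x))"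
    by (auto simp: A(3))
  ultimately show ?thesis unfolding hom_polynomials_def by blast
qed

lemma hom_polynomials_scalars_zero: "(\<lambda>x\<in>carrier V. 0) \<in> hom_polynomials k V scalars"
  unfolding hom_polynomials_def
  by (intro CollectI exI[of _ "\<lambda>_. 0"] conjI) (simp_all add: multilinear_map_def linear_map_scalars_iff)

lemma normed_space_polynomial_space:
  assumes k: "1 \<le> k" shows "normed_space (polynomial_space k V)"
  unfolding polynomial_space_def
proof (rule normed_space_sup_norm)
  show "hom_polynomials k V scalars \<subseteq> extensional (carrier V)" by (auto simp: hom_polynomials_def)
  show "P x = 0" if P: "P \<in> hom_polynomials k V scalars"
    and 0: "\<And>x. x \<in> carrier V \<Longrightarrow> vnorm V x \<le> 1 \<Longrightarrow> P x = 0" and x: "x \<in> carrier V" for P x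
  proof -
    have "sup_norm V P \<le> 0" by (rule sup_norm_least) (simp add: 0)
    then have "sup_norm V P * vnorm V x ^ k \<le> 0" using x by (simp add: mult_nonpos_nonneg)
    then show ?thesis using scalar_polynomial_bound[OF P k x] by (metis norm_le_zero_iff order_trans)
  qed
qed (use hom_polynomials_scalars_add hom_polynomials_scalars_smult hom_polynomials_scalars_zero
    scalar_polynomial_bounded[OF _ k] in auto)

end

lemma polynomial_space_simps [simp]:
  "carrier (polynomial_space k V) = hom_polynomials k V scalars"
  "vnorm (polynomial_space k V) = sup_norm V"
  by (simp_all add: polynomial_space_def)


section \<open>Polynomials with unconditionally converging conjugate\<close>

text \<open>
  The terms \<open>f\<^sub>n \<circ> P\<close> of a convergent series tend to \<open>0\<close> in the norm of the space of polynomials, that is,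
  uniformly on the unit ball, and a \<open>k\<close>-homogeneous polynomial grows by at most \<open>R ^ k\<close> on the ball of
  radius \<open>R\<close>.
\<close>

lemma P_uc_star_image_V_star_set:
  fixes E :: "('k::real_normed_field, 'e) nspace"
  assumes E: "normed_space E" and F: "normed_space F" and k: "1 \<le> k" and P: "P \<in> P_uc_star k F E"
    and B: "B \<subseteq> carrier F" "\<And>x. x \<in> B \<Longrightarrow> vnorm F x \<le> R"
  shows "V_star_set E (P ` B)"
  unfolding V_star_set_def
proof (intro conjI allI impI)
  interpret E: normed_space E by (rule E)
  interpret F: normed_space F by (rule F)
  interpret PS: normed_space "polynomial_space k F" by (rule F.normed_space_polynomial_space[OF k])
  have Ph: "P \<in> hom_polynomials k F E"
    and uc: "uc_operator (dual E) (polynomial_space k F) (conjugate F P)"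
    using P by (auto simp: P_uc_star_def)
  show "P ` B \<subseteq> carrier E" using hom_polynomials_homogeneous(1)[OF F E Ph _ k] B(1) by auto
  fix f assume f: "wuC_series (dual E) f"
  let ?Q = "conjugate F P \<circ> f"
  have "uc_series (polynomial_space k F) ?Q" using uc f by (auto simp: uc_operator_def)
  then have Q: "?Q n \<in> hom_polynomials k F scalars" and "convergent_series (polynomial_space k F) (?Q \<circ> id)" for n
    unfolding uc_series_def using strict_mono_id by (auto simp: image_subset_iff)
  then have lim: "(\<lambda>n. sup_norm F (?Q n)) \<longlonglongrightarrow> 0"
    using PS.convergent_series_terms[of ?Q] by simp
  have le: "(SUP x\<in>P ` B. ennreal (norm (f n x))) \<le> ennreal (sup_norm F (?Q n) * \<bar>R\<bar> ^ k)" for n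
  proof (rule SUP_least, clarify)
    fix x assume x: "x \<in> B"
    then have xF: "x \<in> carrier F" using B(1) by blast
    have "norm (f n (P x)) = norm (?Q n x)" using xF by (simp add: conjugate_def compose_def)
    also have "\<dots> \<le> sup_norm F (?Q n) * vnorm F x ^ k"
      by (rule F.scalar_polynomial_bound[OF Q k xF])
    also have "\<dots> \<le> sup_norm F (?Q n) * \<bar>R\<bar> ^ k"
      using B(2)[OF x] PS.vnorm_nonneg[of "?Q n"] Q[of n] xF
      by (intro mult_left_mono power_mono) auto
    finally show "ennreal (norm (f n (P x))) \<le> ennreal (sup_norm F (?Q n) * \<bar>R\<bar> ^ k)"
      by (rule ennreal_leI)
  qed
  have "(\<lambda>n. ennreal (sup_norm F (?Q n) * \<bar>R\<bar> ^ k)) \<longlonglongrightarrow> ennreal (0 * \<bar>R\<bar> ^ k)"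
    by (intro tendsto_ennrealI tendsto_mult_right lim)
  then have "(\<lambda>n. ennreal (sup_norm F (?Q n) * \<bar>R\<bar> ^ k)) \<longlonglongrightarrow> 0" by simp
  then show "(\<lambda>n. SUP x\<in>P ` B. ennreal (norm (f n x))) \<longlonglongrightarrow> 0"
    by (rule tendsto_sandwich[OF always_eventually always_eventually tendsto_const, rotated 2])
      (intro allI zero_le, intro allI le)
qed

lemma P_uc_star_subset_P_wco:
  fixes E :: "('k::real_normed_field, 'e) nspace"
  assumes E: "normed_space E" and F: "normed_space F" and k: "1 \<le> k" and VE: "property_V_star E"
  shows "P_uc_star k F E \<subseteq> P_wco k F E"
proof
  fix P assume P: "P \<in> P_uc_star k F E"
  interpret F: normed_space F by (rule F)
  interpret Metric_space "carrier F" "vdist F" by (rule F.Metric_space_vdist)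
  have "relatively_weakly_compact E (P ` B)" if B: "mbounded B" for B
  proof -
    obtain c R where cR: "B \<subseteq> mcball c R" using B by (auto simp: mbounded_def)
    have BF: "B \<subseteq> carrier F" using B mbounded_subset_mspace by blast
    have "vnorm F x \<le> vnorm F c + R" if "x \<in> B" for x
    proof -
      have x: "x \<in> carrier F" "c \<in> carrier F" "vnorm F (c \<ominus>\<^bsub>F\<^esub> x) \<le> R" using subsetD[OF cR that] by auto
      then have "vnorm F x \<le> vnorm F (x \<ominus>\<^bsub>F\<^esub> c) + vnorm F c"
        using F.vnorm_triangle[of "x \<ominus>\<^bsub>F\<^esub> c" c] by (simp add: F.minus_add_cancel)
      then show ?thesis using x F.vnorm_minus_commute[of x c] by simp
    qed
    then have "V_star_set E (P ` B)"
      by (rule P_uc_star_image_V_star_set[OF E F k P BF])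
    then show ?thesis using VE by (simp add: property_V_star_def)
  qed
  then show "P \<in> P_wco k F E" using P by (simp add: P_uc_star_def P_wco_def)
qed


section \<open>Continuity into normed spaces\<close>

lemma continuous_map_norm_topology_iff:
  assumes W: "normed_space W"
  shows "continuous_map X (norm_topology W) v \<longleftrightarrow>
    (\<forall>x\<in>topspace X. v x \<in> carrier W \<and> ((\<lambda>y. vdist W (v y) (v x)) \<longlongrightarrow> 0) (atin X x))"
    (is "?L \<longleftrightarrow> ?R")
proof -
  interpret Metric_space "carrier W" "vdist W" by (rule normed_space.Metric_space_vdist[OF W])
  have "?L \<longleftrightarrow> (\<forall>x\<in>topspace X. v x \<in> carrier W \<and> (\<forall>\<^sub>F y in atin X x. v y \<in> carrier W) \<and>
      ((\<lambda>y. vdist W (v y) (v x)) \<longlongrightarrow> 0) (atin X x))"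
    by (simp add: continuous_map_atin limitin_metric_dist_null)
  also have "\<dots> \<longleftrightarrow> ?R"
  proof
    assume R: ?R
    have "\<forall>\<^sub>F y in atin X x. v y \<in> carrier W" if "x \<in> topspace X" for x
      using that R by (auto simp: eventually_atin intro!: exI[of _ "topspace X"])
    with R show "\<forall>x\<in>topspace X. v x \<in> carrier W \<and> (\<forall>\<^sub>F y in atin X x. v y \<in> carrier W) \<and>
      ((\<lambda>y. vdist W (v y) (v x)) \<longlongrightarrow> 0) (atin X x)" by blast
  qed blast
  finally show ?thesis .
qed

lemma eventually_atin_topspace: "\<forall>\<^sub>F y in atin X x. y \<in> topspace X"
  by (auto simp: eventually_atin intro!: exI[of _ "topspace X"])

lemma bounded_linear_map_continuous:
  assumes V: "normed_space V" and W: "normed_space W" and L: "linear_map V W L"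
    and b: "\<And>x. x \<in> carrier V \<Longrightarrow> vnorm W (L x) \<le> b * vnorm V x"
  shows "continuous_map (norm_topology V) (norm_topology W) L"
  unfolding continuous_map_norm_topology_iff[OF W]
proof (intro ballI conjI)
  interpret V: normed_space V by (rule V)
  interpret W: normed_space W by (rule W)
  have top: "topspace (norm_topology V) = carrier V"
    by (rule Metric_space.topspace_mtopology[OF V.Metric_space_vdist])
  fix x assume "x \<in> topspace (norm_topology V)"
  then have x: "x \<in> carrier V" unfolding top .
  have LW: "L y \<in> carrier W" if "y \<in> carrier V" for y using L that by (auto simp: linear_map_def)
  then show "L x \<in> carrier W" using x .
  have "continuous_map (norm_topology V) (norm_topology V) (\<lambda>x. x)" by (rule continuous_map_id[unfolded id_def])
  then have lim: "((\<lambda>y. vdist V y x) \<longlongrightarrow> 0) (atin (norm_topology V) x)"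
    unfolding continuous_map_norm_topology_iff[OF V] top using x by blast
  have le: "norm (vdist W (L y) (L x)) \<le> b * vdist V y x" if y: "y \<in> carrier V" for y
  proof -
    have "L y \<ominus>\<^bsub>W\<^esub> L x = L (y \<ominus>\<^bsub>V\<^esub> x)"
      using L x y LW by (simp add: linear_map_def V.minus_eq_smult W.minus_eq_smult)
    then show ?thesis using b[of "y \<ominus>\<^bsub>V\<^esub> x"] x y LW by simp
  qed
  show "((\<lambda>y. vdist W (L y) (L x)) \<longlongrightarrow> 0) (atin (norm_topology V) x)"
  proof (rule Lim_null_comparison)
    show "((\<lambda>y. b * vdist V y x) \<longlongrightarrow> 0) (atin (norm_topology V) x)"
      using tendsto_mult_left[OF lim, of b] by simp
    show "\<forall>\<^sub>F y in atin (norm_topology V) x. norm (vdist W (L y) (L x)) \<le> b * vdist V y x"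
      using eventually_atin_topspace by (rule eventually_mono) (use le top in simp)
  qed
qed

lemma continuous_map_smult:
  assumes W: "normed_space W" and u: "continuous_map X euclidean u"
    and v: "continuous_map X (norm_topology W) v"
  shows "continuous_map X (norm_topology W) (\<lambda>x. u x \<odot>\<^bsub>W\<^esub> v x)"
  unfolding continuous_map_norm_topology_iff[OF W]
proof (intro ballI conjI)
  interpret W: normed_space W by (rule W)
  fix x assume x: "x \<in> topspace X"
  have vW: "v y \<in> carrier W" if "y \<in> topspace X" for y
    using v that unfolding continuous_map_norm_topology_iff[OF W] by blast
  then show "u x \<odot>\<^bsub>W\<^esub> v x \<in> carrier W" using x by simp
  have limv: "((\<lambda>y. vdist W (v y) (v x)) \<longlongrightarrow> 0) (atin X x)"
    using v x unfolding continuous_map_norm_topology_iff[OF W] by blast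
  have limu: "(u \<longlongrightarrow> u x) (atin X x)"
    using u x by (simp add: continuous_map_atin)
  have le: "norm (vdist W (u y \<odot>\<^bsub>W\<^esub> v y) (u x \<odot>\<^bsub>W\<^esub> v x)) \<le>
      norm (u y) * vdist W (v y) (v x) + norm (u y - u x) * vnorm W (v x)" if "y \<in> topspace X" for y
  proof -
    note vy = vW[OF that] and vx = vW[OF x]
    have "vnorm W (u y \<odot>\<^bsub>W\<^esub> v y \<ominus>\<^bsub>W\<^esub> u x \<odot>\<^bsub>W\<^esub> v x) \<le>
        vnorm W (u y \<odot>\<^bsub>W\<^esub> v y \<ominus>\<^bsub>W\<^esub> u y \<odot>\<^bsub>W\<^esub> v x) + vnorm W (u y \<odot>\<^bsub>W\<^esub> v x \<ominus>\<^bsub>W\<^esub> u x \<odot>\<^bsub>W\<^esub> v x)"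
      using vx vy by (intro W.vnorm_diff_triangle) auto
    moreover have "u y \<odot>\<^bsub>W\<^esub> v y \<ominus>\<^bsub>W\<^esub> u y \<odot>\<^bsub>W\<^esub> v x = u y \<odot>\<^bsub>W\<^esub> (v y \<ominus>\<^bsub>W\<^esub> v x)"
      using vx vy by (simp add: W.minus_eq_smult W.smult_add_right W.smult_smult)
    moreover have "u y \<odot>\<^bsub>W\<^esub> v x \<ominus>\<^bsub>W\<^esub> u x \<odot>\<^bsub>W\<^esub> v x = (u y - u x) \<odot>\<^bsub>W\<^esub> v x"
      using vx W.smult_add_left[OF vx, of "u y" "- u x"] by (simp add: W.minus_eq_smult W.smult_smult)
    ultimately show ?thesis using vx vy by (simp add: W.vnorm_smult)
  qed
  show "((\<lambda>y. vdist W (u y \<odot>\<^bsub>W\<^esub> v y) (u x \<odot>\<^bsub>W\<^esub> v x)) \<longlongrightarrow> 0) (atin X x)"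
  proof (rule Lim_null_comparison)
    have "((\<lambda>y. norm (u y) * vdist W (v y) (v x) + norm (u y - u x) * vnorm W (v x)) \<longlongrightarrow>
        norm (u x) * 0 + norm (u x - u x) * vnorm W (v x)) (atin X x)"
      by (intro tendsto_intros limu limv)
    then show "((\<lambda>y. norm (u y) * vdist W (v y) (v x) + norm (u y - u x) * vnorm W (v x)) \<longlongrightarrow> 0) (atin X x)"
      by simp
    show "\<forall>\<^sub>F y in atin X x. norm (vdist W (u y \<odot>\<^bsub>W\<^esub> v y) (u x \<odot>\<^bsub>W\<^esub> v x)) \<le>
      norm (u y) * vdist W (v y) (v x) + norm (u y - u x) * vnorm W (v x)"
      using eventually_atin_topspace by (rule eventually_mono) (rule le)
  qed
qed

text \<open>
  The multilinear map applies \<open>L\<close> to the variable with index \<open>0\<close> and \<open>\<phi>\<close> to each of the other \<open>k - 1\<close>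
  variables.  For \<open>k = 1\<close> it is \<open>L\<close> itself.
\<close>

lemma power_times_linear_is_polynomial:
  assumes V: "normed_space V" and W: "normed_space W" and k: "1 \<le> k"
    and \<phi>: "\<phi> \<in> carrier (dual V)" and L: "linear_map V W L"
    and b: "\<And>x. x \<in> carrier V \<Longrightarrow> vnorm W (L x) \<le> b * vnorm V x"
  shows "(\<lambda>x\<in>carrier V. \<phi> x ^ (k - 1) \<odot>\<^bsub>W\<^esub> L x) \<in> hom_polynomials k V W"
proof -
  interpret V: normed_space V by (rule V)
  interpret W: normed_space W by (rule W)
  let ?X = "product_topology (\<lambda>_. norm_topology V) {..<k}"
  define A where "A x = (\<Prod>i=1..<k. \<phi> (x i)) \<odot>\<^bsub>W\<^esub> L (x 0)" for x
  have LW: "L y \<in> carrier W" if "y \<in> carrier V" for y using L that by (auto simp: linear_map_def)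
  have L_add: "L (x \<oplus>\<^bsub>V\<^esub> y) = L x \<oplus>\<^bsub>W\<^esub> L y" if "x \<in> carrier V" "y \<in> carrier V" for x y
    using L that by (simp add: linear_map_def)
  have L_smult: "L (c \<odot>\<^bsub>V\<^esub> x) = c \<odot>\<^bsub>W\<^esub> L x" if "x \<in> carrier V" for c x
    using L that by (simp add: linear_map_def)
  have "multilinear_map k V W A"
    unfolding multilinear_map_def
  proof (intro allI impI ballI)
    fix i u assume i: "i < k" and u: "u \<in> {..<k} \<rightarrow>\<^sub>E carrier V"
    show "linear_map V W (\<lambda>y. A (u(i := y)))"
    proof (cases "i = 0")
      case True
      have "(\<Prod>j=1..<k. \<phi> ((u(i := y)) j)) = (\<Prod>j=1..<k. \<phi> (u j))" for y
        using True by (intro prod.cong) auto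
      then have "A (u(i := y)) = (\<Prod>j=1..<k. \<phi> (u j)) \<odot>\<^bsub>W\<^esub> L y" for y
        using True by (simp add: A_def)
      then show ?thesis
        unfolding linear_map_def
        by (auto simp: L_add L_smult LW W.smult_add_right W.smult_smult mult.commute)
    next
      case False
      define p where "p = (\<Prod>j\<in>{1..<k} - {i}. \<phi> (u j))"
      have u0: "u 0 \<in> carrier V" by (rule PiE_mem[OF u]) (use k in simp)
      have "(\<Prod>j=1..<k. \<phi> ((u(i := y)) j)) = \<phi> y * p" for y
      proof -
        have "(\<Prod>j=1..<k. \<phi> ((u(i := y)) j)) =
            \<phi> ((u(i := y)) i) * (\<Prod>j\<in>{1..<k} - {i}. \<phi> ((u(i := y)) j))"
          using False i by (intro prod.remove) auto
        also have "(\<Prod>j\<in>{1..<k} - {i}. \<phi> ((u(i := y)) j)) = p"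
          unfolding p_def by (intro prod.cong) auto
        finally show ?thesis by simp
      qed
      then have "A (u(i := y)) = (\<phi> y * p) \<odot>\<^bsub>W\<^esub> L (u 0)" for y
        using False by (simp add: A_def)
      then show ?thesis
        unfolding linear_map_def using LW[OF u0]
        by (auto simp: V.dual_add[OF \<phi>] V.dual_smult[OF \<phi>] W.smult_smult mult.assoc distrib_right W.smult_add_left)
    qed
  qed
  moreover have "continuous_map ?X (norm_topology W) A"
  proof -
    have "continuous_map (norm_topology V) (norm_topology scalars) \<phi>"
      by (rule bounded_linear_map_continuous[OF V normed_space_scalars, of _ "sup_norm V \<phi>"])
        (use \<phi> V.dual_bound[OF \<phi>] in \<open>auto simp: carrier_dual_iff\<close>)
    then have cont_\<phi>: "continuous_map (norm_topology V) euclidean \<phi>" by simp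
    have coord: "continuous_map ?X (norm_topology V) (\<lambda>x. x i)" if "i < k" for i
      using that by (intro continuous_map_product_projection) simp
    have "continuous_map ?X euclidean (\<lambda>x. \<phi> (x i))" if "i < k" for i
      using continuous_map_compose[OF coord[OF that] cont_\<phi>] by (simp add: o_def)
    then have "continuous_map ?X euclidean (\<lambda>x. \<Prod>i=1..<k. \<phi> (x i))"
      unfolding continuous_map_atin limitin_canonical_iff by (auto intro!: tendsto_prod)
    moreover have "continuous_map ?X (norm_topology W) (\<lambda>x. L (x 0))"
      using continuous_map_compose[OF coord bounded_linear_map_continuous[OF V W L b], of 0] k
      by (simp add: o_def)
    ultimately show ?thesis unfolding A_def by (rule continuous_map_smult[OF W])
  qed
  moreover have "(\<lambda>x\<in>carrier V. \<phi> x ^ (k - 1) \<odot>\<^bsub>W\<^esub> L x) = (\<lambda>x\<in>carrier V. A (\<lambda>i\<in>{..<k}. x))"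
  proof (rule restrict_ext)
    fix x
    have "(\<Prod>i=1..<k. \<phi> ((\<lambda>i\<in>{..<k}. x) i)) = (\<Prod>i=1..<k. \<phi> x)" by (intro prod.cong) auto
    also have "\<dots> = \<phi> x ^ (k - 1)" by simp
    finally show "\<phi> x ^ (k - 1) \<odot>\<^bsub>W\<^esub> L x = A (\<lambda>i\<in>{..<k}. x)" using k by (simp add: A_def)
  qed
  ultimately show ?thesis unfolding hom_polynomials_def by blast
qed


section \<open>Operators on \<open>\<ell>\<^sub>1\<close>\<close>

text \<open>
  The part of an isometric isomorphism with \<open>\<ell>\<^sub>1\<close> that the construction of operators uses: it holds for
  \<open>\<ell>\<^sub>1\<close> itself and for its copies on other types.
\<close>

definition ell1_coordinates :: "('k::real_normed_field, 'v) nspace \<Rightarrow> ('v \<Rightarrow> nat \<Rightarrow> 'k) \<Rightarrow> bool" where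
  "ell1_coordinates F J \<longleftrightarrow>
     (\<forall>x\<in>carrier F. \<forall>y\<in>carrier F. \<forall>n. J (x \<oplus>\<^bsub>F\<^esub> y) n = J x n + J y n) \<and>
     (\<forall>c. \<forall>x\<in>carrier F. \<forall>n. J (c \<odot>\<^bsub>F\<^esub> x) n = c * J x n) \<and>
     (\<forall>x\<in>carrier F. (\<lambda>n. norm (J x n)) sums vnorm F x) \<and>
     (\<forall>m. \<exists>e\<in>carrier F. J e = (\<lambda>n. if n = m then 1 else 0))"

lemma norm_sum_diff_le:
  fixes c :: "nat \<Rightarrow> 'a::real_normed_vector"
  assumes le: "\<And>i. norm (c i) \<le> a i"
  shows "norm (sum c {..<m} - sum c {..<n}) \<le> \<bar>sum a {..<m} - sum a {..<n}\<bar>"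
proof -
  have *: "norm (sum c {..<m} - sum c {..<n}) \<le> \<bar>sum a {..<m} - sum a {..<n}\<bar>" if "n \<le> m" for m n
  proof -
    have "sum c {..<m} - sum c {..<n} = sum c {n..<m}" "sum a {..<m} - sum a {..<n} = sum a {n..<m}"
      using that by (simp_all add: lessThan_atLeast0 sum_diff_nat_ivl)
    moreover have "norm (sum c {n..<m}) \<le> sum a {n..<m}" by (rule sum_norm_le) (rule le)
    ultimately show ?thesis by simp
  qed
  show ?thesis
    using *[of n m] *[of m n] by (metis abs_minus_commute norm_minus_commute nat_le_linear)
qed

lemma ell1_sum_bound:
  fixes J :: "'v \<Rightarrow> nat \<Rightarrow> 'k::{real_normed_field, banach}"
  assumes J: "ell1_coordinates F J" and x: "x \<in> carrier F" and c: "\<And>n. norm (c n) \<le> b"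
  shows "summable (\<lambda>n. J x n * c n)" "norm (\<Sum>n. J x n * c n) \<le> b * vnorm F x"
proof -
  have sums: "(\<lambda>n. norm (J x n)) sums vnorm F x" using J x by (simp add: ell1_coordinates_def)
  then have bs: "(\<lambda>n. b * norm (J x n)) sums (b * vnorm F x)" by (rule sums_mult)
  have le: "norm (J x n * c n) \<le> b * norm (J x n)" for n
    using mult_right_mono[OF c norm_ge_zero, of n "J x n"] by (simp add: norm_mult mult.commute)
  show s: "summable (\<lambda>n. J x n * c n)"
    by (rule summable_comparison_test'[OF sums_summable[OF bs]]) (rule le)
  have ns: "summable (\<lambda>n. norm (J x n * c n))"
    by (rule summable_comparison_test'[OF sums_summable[OF bs]]) (use le in simp)
  have "norm (\<Sum>n. J x n * c n) \<le> (\<Sum>n. norm (J x n * c n))" by (rule summable_norm[OF ns])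
  also have "\<dots> \<le> (\<Sum>n. b * norm (J x n))" by (rule suminf_le[OF le ns sums_summable[OF bs]])
  also have "\<dots> = b * vnorm F x" using bs by (rule sums_unique[symmetric])
  finally show "norm (\<Sum>n. J x n * c n) \<le> b * vnorm F x" .
qed

text \<open>
  The value at \<open>x\<close> of the operator that sends the unit vectors to the points \<open>s n\<close>, a norm limit of
  partial sums.  Describing it by its functionals makes linearity a consequence of the fact that
  functionals separate points.
\<close>

lemma ell1_operator_exists:
  fixes E :: "('k::real_or_complex, 'e) nspace" and F :: "('k, 'v) nspace" and s :: "nat \<Rightarrow> 'e"
  assumes E: "banach_space E" and J: "ell1_coordinates F J"
    and s: "\<And>n. s n \<in> carrier E" "\<And>n. vnorm E (s n) \<le> b" and x: "x \<in> carrier F"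
  shows "\<exists>y\<in>carrier E. \<forall>f\<in>carrier (dual E). f y = (\<Sum>n. J x n * f (s n))"
proof -
  have VE: "normed_space E" using E by (simp add: banach_space_def)
  interpret E: normed_space E by (rule VE)
  have b: "0 \<le> b" using s[of 0] E.vnorm_nonneg[of "s 0"] by linarith
  define y where "y N = finsum E (\<lambda>n. J x n \<odot>\<^bsub>E\<^esub> s n) {..<N}" for N :: nat
  have yE: "y N \<in> carrier E" for N unfolding y_def by (rule E.M.finsum_closed) (use s in auto)
  have fy: "f (y N) = (\<Sum>n<N. J x n * f (s n))" if "f \<in> carrier (dual E)" for f N
    unfolding y_def using s by (simp add: E.dual_finsum[OF that] E.dual_smult[OF that])
  have fs: "norm (f (s n)) \<le> sup_norm E f * b" if "f \<in> carrier (dual E)" for f n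
    using E.dual_bound[OF that s(1)] mult_left_mono[OF s(2) E.sup_norm_dual_nonneg[OF that]]
    by (rule order_trans)
  obtain l where l: "l \<in> carrier E" and lim: "(\<lambda>N. vnorm E (y N \<ominus>\<^bsub>E\<^esub> l)) \<longlonglongrightarrow> 0"
  proof (rule E.banach_limit[OF E yE])
    fix \<epsilon> :: real assume \<epsilon>: "0 < \<epsilon>"
    let ?a = "\<lambda>n. norm (J x n) * b"
    have "summable ?a"
      using J x by (auto simp: ell1_coordinates_def sums_iff intro: summable_mult2)
    then have "Cauchy (\<lambda>N. sum ?a {..<N})"
      using summable_iff_convergent convergent_Cauchy by blast
    then obtain N where N: "\<And>m n. N \<le> m \<Longrightarrow> N \<le> n \<Longrightarrow> norm (sum ?a {..<m} - sum ?a {..<n}) < \<epsilon>"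
      using \<epsilon> unfolding Cauchy_iff by blast
    have "vnorm E (y m \<ominus>\<^bsub>E\<^esub> y n) < \<epsilon>" if mn: "N \<le> m" "N \<le> n" for m n
    proof -
      have "vnorm E (y m \<ominus>\<^bsub>E\<^esub> y n) \<le> \<bar>sum ?a {..<m} - sum ?a {..<n}\<bar>"
      proof (rule vnorm_le_functionals[OF VE])
        fix f assume f: "f \<in> carrier (dual E)" "sup_norm E f \<le> 1"
        have "norm (J x i * f (s i)) \<le> norm (J x i) * b" for i
        proof -
          have "norm (f (s i)) \<le> 1 * b"
            using fs[OF f(1), of i] mult_right_mono[OF f(2) b] by linarith
          then show ?thesis by (simp add: norm_mult mult_left_mono)
        qed
        then show "norm (f (y m \<ominus>\<^bsub>E\<^esub> y n)) \<le> \<bar>sum ?a {..<m} - sum ?a {..<n}\<bar>"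
          unfolding E.dual_minus[OF f(1) yE yE] fy[OF f(1)] by (rule norm_sum_diff_le)
      qed (use yE in simp)
      then show ?thesis using N[OF mn] by simp
    qed
    then show "\<exists>N. \<forall>m\<ge>N. \<forall>n\<ge>N. vnorm E (y m \<ominus>\<^bsub>E\<^esub> y n) < \<epsilon>" by blast
  qed blast
  have "f l = (\<Sum>n. J x n * f (s n))" if f: "f \<in> carrier (dual E)" for f
  proof -
    have "(\<lambda>N. f (y N) - f l) \<longlonglongrightarrow> 0"
    proof (rule Lim_null_comparison)
      show "(\<lambda>N. sup_norm E f * vnorm E (y N \<ominus>\<^bsub>E\<^esub> l)) \<longlonglongrightarrow> 0"
        using tendsto_mult_left[OF lim, of "sup_norm E f"] by simp
      show "\<forall>\<^sub>F N in sequentially. norm (f (y N) - f l) \<le> sup_norm E f * vnorm E (y N \<ominus>\<^bsub>E\<^esub> l)"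
        using E.dual_bound[OF f, of "y _ \<ominus>\<^bsub>E\<^esub> l"] yE l by (simp add: E.dual_minus[OF f])
    qed
    then have "(\<lambda>N. \<Sum>n<N. J x n * f (s n)) \<longlonglongrightarrow> f l"
      by (simp add: LIM_zero_iff fy[OF f])
    then show ?thesis by (simp add: sums_def[symmetric] sums_iff)
  qed
  with l show ?thesis by blast
qed

text \<open>
  The conjugate of the operator \<open>S\<close> turns a w.u.C. series of functionals into a series that converges
  in norm: a block of the series that is at most \<open>\<epsilon>\<close> on \<open>A\<close>, hence at all points \<open>s n\<close>, has norm at most
  \<open>\<epsilon>\<close> after composition with \<open>S\<close>.
\<close>

lemma V_star_set_operator_sums_uniformly:
  fixes E :: "('k::real_or_complex, 'e) nspace"
  assumes E: "normed_space E" and J: "ell1_coordinates F J" and A: "V_star_set E A"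
    and s: "range s \<subseteq> A" and g: "wuC_series (dual E) g"
    and S: "\<And>x. x \<in> carrier F \<Longrightarrow> S x \<in> carrier E"
    and fS: "\<And>f x. f \<in> carrier (dual E) \<Longrightarrow> x \<in> carrier F \<Longrightarrow> f (S x) = (\<Sum>n. J x n * f (s n))"
    and \<epsilon>: "0 < \<epsilon>"
  shows "\<exists>N. \<forall>m\<ge>N. \<forall>x\<in>carrier F. norm ((\<Sum>n. g n (S x)) - (\<Sum>n<m. g n (S x))) \<le> \<epsilon> * vnorm F x"
proof -
  interpret E: normed_space E by (rule E)
  interpret D: normed_space "dual E" by (rule E.normed_space_dual)
  have gD: "g i \<in> carrier (dual E)" for i by (rule E.wuC_dual_carrier[OF g])
  have sE: "s n \<in> carrier E" for n using s A by (auto simp: V_star_set_def)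
  obtain N where N: "\<And>m n x. N \<le> m \<Longrightarrow> x \<in> A \<Longrightarrow> norm (\<Sum>i=m..<n. g i x) \<le> \<epsilon>"
    using V_star_set_uniformly_Cauchy[OF E A g \<epsilon>] by blast
  have "norm ((\<Sum>n. g n (S x)) - (\<Sum>n<m. g n (S x))) \<le> \<epsilon> * vnorm F x"
    if m: "N \<le> m" and x: "x \<in> carrier F" for m x
  proof -
    have block: "norm ((\<Sum>i<n. g i (S x)) - (\<Sum>i<m. g i (S x))) \<le> \<epsilon> * vnorm F x" if "m \<le> n" for n
    proof -
      let ?h = "finsum (dual E) g {m..<n}"
      have h: "?h \<in> carrier (dual E)" by (rule D.M.finsum_closed) (use gD in auto)
      have h_at: "?h y = (\<Sum>i=m..<n. g i y)" if "y \<in> carrier E" for y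
        unfolding dual_def
        by (intro function_space_finsum E.normed_space_dual[unfolded dual_def])
          (use gD that in \<open>auto simp: dual_def\<close>)
      have "norm (?h (s j)) \<le> \<epsilon>" for j using N[OF m, of "s j" n] s sE by (auto simp: h_at)
      then have "norm (?h (S x)) \<le> \<epsilon> * vnorm F x"
        unfolding fS[OF h x] by (rule ell1_sum_bound(2)[OF J x])
      moreover have "(\<Sum>i<n. g i (S x)) - (\<Sum>i<m. g i (S x)) = (\<Sum>i=m..<n. g i (S x))"
        using that by (simp add: lessThan_atLeast0 sum_diff_nat_ivl)
      ultimately show ?thesis by (simp add: h_at S[OF x])
    qed
    have "summable (\<lambda>n. g n (S x))"
      by (rule summable_norm_cancel[OF E.wuC_dual_summable[OF g S[OF x]]])
    then have "(\<lambda>n. \<Sum>i<n. g i (S x)) \<longlonglongrightarrow> (\<Sum>n. g n (S x))" by (rule summable_LIMSEQ)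
    then have "(\<lambda>n. norm ((\<Sum>i<n. g i (S x)) - (\<Sum>i<m. g i (S x)))) \<longlonglongrightarrow>
        norm ((\<Sum>n. g n (S x)) - (\<Sum>n<m. g n (S x)))"
      by (intro tendsto_intros)
    then show ?thesis by (rule LIMSEQ_le_const2) (use block in blast)
  qed
  then show ?thesis by blast
qed

text \<open>
  For a sequence \<open>s\<close> in a \<open>(V\<^sup>*)\<close> set the polynomial \<open>P x = \<phi> x ^ (k - 1) S x\<close> takes the value \<open>s m\<close> at the
  \<open>m\<close>-th unit vector, because the sum \<open>\<phi>\<close> of the coordinates is \<open>1\<close> there.  The sum of the series of the
  \<open>f\<^sub>n \<circ> P\<close> is again a polynomial of this shape, with the functional \<open>L\<close> given by the pointwise sum of
  the \<open>f\<^sub>n \<circ> S\<close>.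
\<close>

lemma property_V_star_if_P_wco:
  fixes E :: "('k::real_or_complex, 'e) nspace" and F :: "('k, 'v) nspace"
  assumes E: "banach_space E" and F: "normed_space F" and J: "ell1_coordinates F J" and k: "1 \<le> k"
    and sub: "P_uc_star k F E \<subseteq> P_wco k F E"
  shows "property_V_star E"
  unfolding property_V_star_def
proof (intro allI impI)
  fix A assume A: "V_star_set E A"
  have VE: "normed_space E" using E by (simp add: banach_space_def)
  interpret E: normed_space E by (rule VE)
  interpret F: normed_space F by (rule F)
  interpret PS: normed_space "polynomial_space k F" by (rule F.normed_space_polynomial_space[OF k])
  let ?D = "carrier (dual E)" and ?PS = "polynomial_space k F"
  have AE: "A \<subseteq> carrier E" using A by (simp add: V_star_set_def)
  obtain b where b: "\<And>x. x \<in> A \<Longrightarrow> vnorm E x \<le> b" by (rule V_star_set_bounded[OF VE A]) blast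
  show "relatively_weakly_compact E A"
  proof (rule eberlein[OF E AE b], assumption)
    fix s :: "nat \<Rightarrow> 'e" assume s: "range s \<subseteq> A"
    have sE: "s n \<in> carrier E" and sb: "vnorm E (s n) \<le> b" for n using s AE b by auto
    have b0: "0 \<le> b" using sb[of 0] E.vnorm_nonneg[OF sE[of 0]] by linarith
    have J_add: "J (x \<oplus>\<^bsub>F\<^esub> y) n = J x n + J y n" if "x \<in> carrier F" "y \<in> carrier F" for x y n
      using J that by (simp add: ell1_coordinates_def)
    have J_smult: "J (c \<odot>\<^bsub>F\<^esub> x) n = c * J x n" if "x \<in> carrier F" for c x n
      using J that by (simp add: ell1_coordinates_def)
    have J_sums: "(\<lambda>n. norm (J x n)) sums vnorm F x" if "x \<in> carrier F" for x
      using J that by (simp add: ell1_coordinates_def)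
    obtain e where e: "\<And>m. e m \<in> carrier F" "\<And>m. J (e m) = (\<lambda>n. if n = m then 1 else 0)"
      using J unfolding ell1_coordinates_def by metis
    have "\<forall>x\<in>carrier F. \<exists>y. y \<in> carrier E \<and> (\<forall>f\<in>?D. f y = (\<Sum>n. J x n * f (s n)))"
      using ell1_operator_exists[OF E J sE sb] unfolding Bex_def by (rule ballI)
    from bchoice[OF this] obtain S where
      "\<forall>x\<in>carrier F. S x \<in> carrier E \<and> (\<forall>f\<in>?D. f (S x) = (\<Sum>n. J x n * f (s n)))" ..
    then have S: "\<And>x. x \<in> carrier F \<Longrightarrow> S x \<in> carrier E"
      and fS: "\<And>f x. f \<in> ?D \<Longrightarrow> x \<in> carrier F \<Longrightarrow> f (S x) = (\<Sum>n. J x n * f (s n))"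
      by simp_all
    have fs: "norm (f (s n)) \<le> sup_norm E f * b" if "f \<in> ?D" for f n
      using E.dual_bound[OF that sE] mult_left_mono[OF sb E.sup_norm_dual_nonneg[OF that]]
      by (rule order_trans)
    have summ: "summable (\<lambda>n. J x n * f (s n))" if "f \<in> ?D" "x \<in> carrier F" for f x
      by (rule ell1_sum_bound(1)[OF J that(2) fs[OF that(1)]])
    have fS_le: "norm (f (S x)) \<le> (sup_norm E f * b) * vnorm F x" if "f \<in> ?D" "x \<in> carrier F" for f x
      unfolding fS[OF that] by (rule ell1_sum_bound(2)[OF J that(2) fs[OF that(1)]])
    have fS_add: "f (S (x \<oplus>\<^bsub>F\<^esub> y)) = f (S x) + f (S y)" if "f \<in> ?D" "x \<in> carrier F" "y \<in> carrier F" for f x y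
      using that by (simp add: fS J_add distrib_right suminf_add summ)
    have fS_smult: "f (S (c \<odot>\<^bsub>F\<^esub> x)) = c * f (S x)" if "f \<in> ?D" "x \<in> carrier F" for f c x
      using that by (simp add: fS J_smult mult.assoc suminf_mult summ)
    have S_lin: "linear_map F E S"
      unfolding linear_map_def
    proof (intro conjI ballI allI)
      show "S \<in> carrier F \<rightarrow> carrier E" using S by blast
      show "S (x \<oplus>\<^bsub>F\<^esub> y) = S x \<oplus>\<^bsub>E\<^esub> S y" if "x \<in> carrier F" "y \<in> carrier F" for x y
        by (rule functionals_separate_points[OF VE]) (use that S fS_add in \<open>auto simp: E.dual_add\<close>)
      show "S (c \<odot>\<^bsub>F\<^esub> x) = c \<odot>\<^bsub>E\<^esub> S x" if "x \<in> carrier F" for c x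
        by (rule functionals_separate_points[OF VE]) (use that S fS_smult in \<open>auto simp: E.dual_smult\<close>)
    qed
    have S_le: "vnorm E (S x) \<le> b * vnorm F x" if x: "x \<in> carrier F" for x
    proof (rule vnorm_le_functionals[OF VE S[OF x]])
      fix f assume f: "f \<in> ?D" "sup_norm E f \<le> 1"
      have "(sup_norm E f * b) * vnorm F x \<le> (1 * b) * vnorm F x"
        using f b0 x by (intro mult_right_mono) auto
      then show "norm (f (S x)) \<le> b * vnorm F x" using fS_le[OF f(1) x] by simp
    qed
    have S_e: "S (e m) = s m" for m
    proof (rule functionals_separate_points[OF VE S[OF e(1)] sE])
      fix f assume f: "f \<in> ?D"
      have "(\<lambda>n. J (e m) n * f (s n)) = (\<lambda>n. if n = m then f (s n) else 0)" by (auto simp: e(2))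
      then show "f (S (e m)) = f (s m)"
        using sums_unique[OF sums_single[of m "\<lambda>n. f (s n)"]] by (simp add: fS[OF f e(1)])
    qed
    define \<phi> where "\<phi> = (\<lambda>x\<in>carrier F. \<Sum>n. J x n)"
    have J_summable: "summable (J x)" if "x \<in> carrier F" for x
      by (rule summable_norm_cancel[OF sums_summable[OF J_sums[OF that]]])
    have \<phi>_le: "norm (\<phi> x) \<le> 1 * vnorm F x" if "x \<in> carrier F" for x
      using ell1_sum_bound(2)[OF J that, of "\<lambda>_. 1" 1] that by (simp add: \<phi>_def)
    have \<phi>: "\<phi> \<in> carrier (dual F)"
    proof (rule F.dualI(1)[OF _ _ zero_le_one \<phi>_le])
      have "J (x \<oplus>\<^bsub>F\<^esub> y) = (\<lambda>n. J x n + J y n)" if "x \<in> carrier F" "y \<in> carrier F" for x y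
        using J_add[OF that] by (rule ext)
      moreover have "J (c \<odot>\<^bsub>F\<^esub> x) = (\<lambda>n. c * J x n)" if "x \<in> carrier F" for c x
        using J_smult[OF that] by (rule ext)
      ultimately show "linear_map F scalars \<phi>"
        by (auto simp: linear_map_scalars_iff \<phi>_def suminf_add suminf_mult J_summable)
      show "\<phi> \<in> extensional (carrier F)" unfolding \<phi>_def by (rule restrict_extensional)
    qed
    have \<phi>_e: "\<phi> (e m) = 1" for m
      using sums_unique[OF sums_single[of m "\<lambda>_. 1 :: 'k"]] by (simp add: \<phi>_def e)
    have \<phi>_ball: "norm (\<phi> x ^ (k - 1)) \<le> 1" if "x \<in> carrier F" "vnorm F x \<le> 1" for x
      using \<phi>_le[OF that(1)] that(2) by (simp add: norm_power power_le_one)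
    define P where "P = (\<lambda>x\<in>carrier F. \<phi> x ^ (k - 1) \<odot>\<^bsub>E\<^esub> S x)"
    have P: "P \<in> hom_polynomials k F E"
      unfolding P_def by (rule power_times_linear_is_polynomial[OF F VE k \<phi> S_lin S_le])
    have conj: "conjugate F P f = (\<lambda>x\<in>carrier F. \<phi> x ^ (k - 1) * f (S x))" if "f \<in> ?D" for f
      by (auto simp: conjugate_def compose_def P_def E.dual_smult[OF that] S intro!: restrict_ext)
    have conj_poly: "conjugate F P f \<in> hom_polynomials k F scalars" if f: "f \<in> ?D" for f
      using power_times_linear_is_polynomial[OF F normed_space_scalars k \<phi>, of "\<lambda>x. f (S x)" "sup_norm E f * b"]
        fS_add[OF f] fS_smult[OF f] fS_le[OF f] by (simp add: conj[OF f] linear_map_scalars_iff)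
    have "uc_operator (dual E) (?PS) (conjugate F P)"
      unfolding uc_operator_def bounded_linear_map_def
    proof (intro conjI allI impI)
      show "linear_map (dual E) (?PS) (conjugate F P)"
        unfolding linear_map_def
      proof (intro conjI ballI allI)
        interpret D: normed_space "dual E" by (rule E.normed_space_dual)
        show "conjugate F P \<in> ?D \<rightarrow> carrier (?PS)" using conj_poly by auto
        show "conjugate F P (f \<oplus>\<^bsub>dual E\<^esub> g) = conjugate F P f \<oplus>\<^bsub>?PS\<^esub> conjugate F P g"
          if f: "f \<in> ?D" and g: "g \<in> ?D" for f g
          unfolding conj[OF f] conj[OF g] conj[OF D.M.a_closed[OF f g]]
          by (auto simp: polynomial_space_def S algebra_simps intro!: restrict_ext)
        show "conjugate F P (c \<odot>\<^bsub>dual E\<^esub> f) = c \<odot>\<^bsub>?PS\<^esub> conjugate F P f" if f: "f \<in> ?D" for c f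
          unfolding conj[OF f] conj[OF D.smult_closed'[OF f]]
          by (auto simp: polynomial_space_def S algebra_simps intro!: restrict_ext)
      qed
      have "sup_norm F (conjugate F P f) \<le> b * sup_norm E f" if f: "f \<in> ?D" for f
      proof (rule F.sup_norm_least)
        fix x assume x: "x \<in> carrier F" "vnorm F x \<le> 1"
        have "norm (f (S x)) \<le> (sup_norm E f * b) * vnorm F x" by (rule fS_le[OF f x(1)])
        also have "\<dots> \<le> (sup_norm E f * b) * 1" using x f b0 by (intro mult_left_mono) auto
        finally have "norm (f (S x)) \<le> sup_norm E f * b" by simp
        then have "norm (\<phi> x ^ (k - 1)) * norm (f (S x)) \<le> 1 * (sup_norm E f * b)"
          by (intro mult_mono \<phi>_ball[OF x]) auto
        then show "norm (conjugate F P f x) \<le> b * sup_norm E f"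
          using x by (simp add: conj[OF f] norm_mult mult.commute)
      qed
      then show "\<exists>C. \<forall>f\<in>?D. vnorm (?PS) (conjugate F P f) \<le> C * vnorm (dual E) f"
        by (auto intro!: exI[of _ b])
      fix f assume f: "wuC_series (dual E) f"
      show "uc_series (?PS) (conjugate F P \<circ> f)"
        unfolding uc_series_def
      proof (intro conjI allI impI)
        show "range (conjugate F P \<circ> f) \<subseteq> carrier (?PS)"
          using conj_poly E.wuC_dual_carrier[OF f] by auto
        fix r :: "nat \<Rightarrow> nat" assume "strict_mono r"
        define g where "g = f \<circ> r"
        have g: "wuC_series (dual E) g"
          unfolding g_def by (rule wuC_series_subseq[OF f \<open>strict_mono r\<close>])
        have gD: "g n \<in> ?D" for n by (rule E.wuC_dual_carrier[OF g])
        have g_summable: "summable (\<lambda>n. g n (S x))" if "x \<in> carrier F" for x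
          by (rule summable_norm_cancel[OF E.wuC_dual_summable[OF g S[OF that]]])
        define L where "L x = (\<Sum>n. g n (S x))" for x
        have unif: "\<exists>N. \<forall>m\<ge>N. \<forall>x\<in>carrier F. norm (L x - (\<Sum>n<m. g n (S x))) \<le> \<epsilon> * vnorm F x"
          if "0 < \<epsilon>" for \<epsilon>
          unfolding L_def by (rule V_star_set_operator_sums_uniformly[OF VE J A s g S fS that])
        obtain N where N: "\<And>x. x \<in> carrier F \<Longrightarrow> norm (L x - (\<Sum>n<N. g n (S x))) \<le> 1 * vnorm F x"
          using unif[OF zero_less_one] by blast
        define c where "c = 1 + (\<Sum>n<N. sup_norm E (g n) * b)"
        have L_le: "norm (L x) \<le> c * vnorm F x" if x: "x \<in> carrier F" for x
        proof -
          have "norm (\<Sum>n<N. g n (S x)) \<le> (\<Sum>n<N. (sup_norm E (g n) * b) * vnorm F x)"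
            by (rule sum_norm_le) (rule fS_le[OF gD x])
          then show ?thesis
            using N[OF x] norm_triangle_ineq[of "L x - (\<Sum>n<N. g n (S x))" "\<Sum>n<N. g n (S x)"]
            by (simp add: c_def distrib_right sum_distrib_right)
        qed
        have L_lin: "linear_map F scalars L"
          unfolding linear_map_scalars_iff L_def
          by (auto simp: fS_add[OF gD] fS_smult[OF gD] suminf_add suminf_mult g_summable)
        define Q where "Q = (\<lambda>x\<in>carrier F. \<phi> x ^ (k - 1) * L x)"
        have Q: "Q \<in> hom_polynomials k F scalars"
          using power_times_linear_is_polynomial[OF F normed_space_scalars k \<phi> L_lin, of c] L_le
          by (simp add: Q_def)
        let ?q = "(conjugate F P \<circ> f) \<circ> r"
        let ?T = "\<lambda>m. finsum (?PS) ?q {..<m}"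
        have q: "?q n = conjugate F P (g n)" for n by (simp add: g_def)
        have q_poly: "?q n \<in> hom_polynomials k F scalars" for n unfolding q by (rule conj_poly[OF gD])
        have fin: "?T m \<in> hom_polynomials k F scalars" for m
          using PS.M.finsum_closed[of ?q "{..<m}"] q_poly by auto
        have fin_at: "?T m x = \<phi> x ^ (k - 1) * (\<Sum>n<m. g n (S x))"
          if x: "x \<in> carrier F" for m x
        proof -
          have "?T m x = (\<Sum>n<m. ?q n x)"
            unfolding polynomial_space_def
            by (intro function_space_finsum F.normed_space_polynomial_space[OF k, unfolded polynomial_space_def])
              (use x q_poly in auto)
          then show ?thesis unfolding q using x by (simp add: conj[OF gD] sum_distrib_left)
        qed
        have close: "\<exists>N. \<forall>m\<ge>N. vdist (?PS) (?T m) Q \<le> \<epsilon>"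
          if "0 < \<epsilon>" for \<epsilon>
        proof -
          obtain N where N: "\<And>m x. N \<le> m \<Longrightarrow> x \<in> carrier F \<Longrightarrow> norm (L x - (\<Sum>n<m. g n (S x))) \<le> \<epsilon> * vnorm F x"
            using unif[OF \<open>0 < \<epsilon>\<close>] by blast
          have "vdist (?PS) (?T m) Q \<le> \<epsilon>" if m: "N \<le> m" for m
          proof -
            let ?f = "?T m"
            have "?f \<ominus>\<^bsub>?PS\<^esub> Q = (\<lambda>x\<in>carrier F. ?f x - Q x)"
              using function_space_minus[of "carrier F" "hom_polynomials k F scalars" "sup_norm F" ?f Q]
                fin Q PS.normed_space_axioms by (simp add: polynomial_space_def)
            then have "vdist (?PS) ?f Q = sup_norm F (\<lambda>x\<in>carrier F. ?f x - Q x)"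
              using fin Q by simp
            also have "\<dots> \<le> \<epsilon>"
            proof (rule F.sup_norm_least)
              fix x assume x: "x \<in> carrier F" "vnorm F x \<le> 1"
              have "?f x - Q x = \<phi> x ^ (k - 1) * ((\<Sum>n<m. g n (S x)) - L x)"
                using x by (simp add: fin_at Q_def right_diff_distrib)
              then have "norm (?f x - Q x) = norm (\<phi> x ^ (k - 1)) * norm (L x - (\<Sum>n<m. g n (S x)))"
                by (simp only: norm_mult norm_minus_commute[of "\<Sum>n<m. g n (S x)" "L x"])
              moreover have "norm (L x - (\<Sum>n<m. g n (S x))) \<le> \<epsilon> * 1"
                using N[OF m x(1)] mult_left_mono[OF x(2), of \<epsilon>] \<open>0 < \<epsilon>\<close> by linarith
              then have "norm (\<phi> x ^ (k - 1)) * norm (L x - (\<Sum>n<m. g n (S x))) \<le> 1 * (\<epsilon> * 1)"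
                by (intro mult_mono \<phi>_ball[OF x]) auto
              ultimately show "norm ((\<lambda>x\<in>carrier F. ?f x - Q x) x) \<le> \<epsilon>" using x by simp
            qed
            finally show ?thesis .
          qed
          then show ?thesis by blast
        qed
        have "(\<lambda>m. vdist (?PS) (?T m) Q) \<longlonglongrightarrow> 0"
        proof (rule LIMSEQ_I)
          fix \<epsilon> :: real assume "0 < \<epsilon>"
          then obtain N where N: "\<And>m. N \<le> m \<Longrightarrow>
              vdist (?PS) (?T m) Q \<le> \<epsilon> / 2"
            using close[of "\<epsilon> / 2"] by auto
          have "0 \<le> vdist (?PS) (?T m) Q" for m
            by (rule Metric_space.nonneg[OF PS.Metric_space_vdist])
          then show "\<exists>N. \<forall>m\<ge>N. norm (vdist (?PS) (?T m) Q - 0) < \<epsilon>"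
            using N \<open>0 < \<epsilon>\<close> by (intro exI[of _ N]) (force intro: le_less_trans)
        qed
        then show "convergent_series (?PS) ?q"
          unfolding convergent_series_def PS.limitin_norm_topology_iff
          using Q fin by (intro exI[of _ Q]) simp
      qed
    qed
    then have "P \<in> P_wco k F E" using P sub by (auto simp: P_uc_star_def)
    moreover have "Metric_space.mbounded (carrier F) (vdist F) (range e)"
    proof -
      interpret Metric_space "carrier F" "vdist F" by (rule F.Metric_space_vdist)
      have "vnorm F (e m) = 1" for m
      proof -
        have "(\<lambda>n. norm (J (e m) n)) = (\<lambda>n. if n = m then 1 else 0)" by (auto simp: e(2))
        then show ?thesis
          using sums_unique2[OF J_sums[OF e(1)[of m]]] sums_single[of m "\<lambda>_. 1 :: real"] by simp
      qed
      then have "range e \<subseteq> mcball \<zero>\<^bsub>F\<^esub> 1"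
        using e(1) F.vnorm_minus_commute[of "\<zero>\<^bsub>F\<^esub>"] by (auto simp: F.minus_eq_smult)
      then show ?thesis by (auto simp: mbounded_def)
    qed
    ultimately have "relatively_weakly_compact E (P ` range e)" by (simp add: P_wco_def)
    moreover have "P (e m) = s m" for m
      using e(1)[of m] sE by (simp add: P_def \<phi>_e S_e)
    then have "P ` range e = range s" by (simp add: image_image)
    ultimately show "relatively_weakly_compact E (range s)" by simp
  qed
qed


section \<open>The Banach space \<open>\<ell>\<^sub>1\<close> and its copies\<close>

lemma ell1_simps [simp]:
  "carrier ell1 = {x. summable (\<lambda>n. norm (x n))}" "vnorm ell1 = (\<lambda>x. \<Sum>n. norm (x n))"
  "x \<oplus>\<^bsub>ell1\<^esub> y = (\<lambda>n. x n + y n)" "c \<odot>\<^bsub>ell1\<^esub> x = (\<lambda>n. c * x n)"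
  by (simp_all add: ell1_def restrict_UNIV)

lemma normed_space_ell1:
  "normed_space (ell1 :: ('k::{real_normed_field, banach}, nat \<Rightarrow> 'k) nspace)"
  unfolding ell1_def
proof (rule normed_space_function_space, unfold restrict_UNIV mem_Collect_eq)
  fix f g :: "nat \<Rightarrow> 'k" and c
  assume f: "summable (\<lambda>n. norm (f n))"
  show "summable (\<lambda>n. norm (c * f n))" using summable_mult[OF f, of "norm c"] by (simp only: norm_mult)
  show "f = (\<lambda>n. 0)" if "(\<Sum>n. norm (f n)) = 0"
    using that suminf_eq_zero_iff[OF f] by auto
  show "(\<Sum>n. norm (c * f n)) = norm c * (\<Sum>n. norm (f n))"
    using suminf_mult[OF f] by (simp add: norm_mult)
  assume g: "summable (\<lambda>n. norm (g n))"
  show fg: "summable (\<lambda>n. norm (f n + g n))"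
    by (rule summable_comparison_test'[OF summable_add[OF f g], of 0]) (simp add: norm_triangle_ineq)
  show "(\<Sum>n. norm (f n + g n)) \<le> (\<Sum>n. norm (f n)) + (\<Sum>n. norm (g n))"
    unfolding suminf_add[OF f g]
    by (rule suminf_le[OF norm_triangle_ineq fg summable_add[OF f g]])
qed auto

lemma ell1_coordinates_ell1: "ell1_coordinates ell1 (\<lambda>x. x)"
proof -
  have "summable (\<lambda>n. norm (if n = m then 1 else 0 :: 'a))" for m :: nat
    by (rule summable_finite[of "{m}"]) auto
  then show ?thesis by (auto simp: ell1_coordinates_def summable_sums)
qed

lemma banach_space_ell1:
  "banach_space (ell1 :: ('k::{real_normed_field, banach}, nat \<Rightarrow> 'k) nspace)"
proof -
  let ?V = "ell1 :: ('k, nat \<Rightarrow> 'k) nspace"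
  interpret normed_space ?V by (rule normed_space_ell1)
  interpret Metric_space "carrier ?V" "vdist ?V" by (rule Metric_space_vdist)
  have minus: "x \<ominus>\<^bsub>?V\<^esub> y = (\<lambda>n. x n - y n)" if "x \<in> carrier ?V" "y \<in> carrier ?V" for x y
    using minus_eq_smult[OF that] by simp
  have mcomplete
    unfolding mcomplete_def
  proof (intro allI impI)
    fix s assume s: "MCauchy s"
    then have sV: "s m \<in> carrier ?V" for m unfolding MCauchy_def by blast
    have diff: "summable (\<lambda>i. norm (s m i - s n i))" for m n
      using M.minus_closed[OF sV sV, of m n] minus[OF sV sV, of m n] by simp
    have cauchy: "\<exists>N. \<forall>m\<ge>N. \<forall>n\<ge>N. (\<Sum>i. norm (s m i - s n i)) < \<epsilon>" if "0 < \<epsilon>" for \<epsilon>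
    proof -
      obtain N where N: "\<And>m n. N \<le> m \<Longrightarrow> N \<le> n \<Longrightarrow> vdist ?V (s m) (s n) < \<epsilon>"
        using s \<open>0 < \<epsilon>\<close> unfolding MCauchy_def by blast
      then show ?thesis
        by (intro exI[of _ N]) (auto simp only: vdist_eq[OF sV sV] minus[OF sV sV] ell1_simps)
    qed
    have "Cauchy (\<lambda>m. s m i)" for i
      unfolding Cauchy_iff
    proof (intro allI impI)
      fix \<epsilon> :: real assume "0 < \<epsilon>"
      then obtain N where N: "\<And>m n. N \<le> m \<Longrightarrow> N \<le> n \<Longrightarrow> (\<Sum>i. norm (s m i - s n i)) < \<epsilon>"
        using cauchy by blast
      have "norm (s m i - s n i) \<le> (\<Sum>i. norm (s m i - s n i))" for m n
        using sum_le_suminf[OF diff, of "{i}" m n] by simp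
      then show "\<exists>M. \<forall>m\<ge>M. \<forall>n\<ge>M. norm (s m i - s n i) < \<epsilon>"
        using N by (meson le_less_trans)
    qed
    then have "\<forall>i. \<exists>l. (\<lambda>m. s m i) \<longlonglongrightarrow> l" using Cauchy_convergent_iff convergent_def by blast
    then obtain x where x: "\<And>i. (\<lambda>m. s m i) \<longlonglongrightarrow> x i" by metis
    have close: "\<exists>N. \<forall>m\<ge>N. summable (\<lambda>i. norm (s m i - x i)) \<and> (\<Sum>i. norm (s m i - x i)) \<le> \<epsilon>"
      if "0 < \<epsilon>" for \<epsilon>
    proof -
      obtain N where N: "\<And>m n. N \<le> m \<Longrightarrow> N \<le> n \<Longrightarrow> (\<Sum>i. norm (s m i - s n i)) < \<epsilon>"
        using cauchy[OF \<open>0 < \<epsilon>\<close>] by blast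
      have "summable (\<lambda>i. norm (s m i - x i)) \<and> (\<Sum>i. norm (s m i - x i)) \<le> \<epsilon>" if m: "N \<le> m" for m
      proof -
        have part: "(\<Sum>i<K. norm (s m i - x i)) \<le> \<epsilon>" for K
        proof (rule LIMSEQ_le_const2)
          show "(\<lambda>n. \<Sum>i<K. norm (s m i - s n i)) \<longlonglongrightarrow> (\<Sum>i<K. norm (s m i - x i))"
            by (intro tendsto_intros x)
          show "\<exists>N. \<forall>n\<ge>N. (\<Sum>i<K. norm (s m i - s n i)) \<le> \<epsilon>"
          proof (intro exI[of _ N] allI impI)
            fix n assume "N \<le> n"
            have "(\<Sum>i<K. norm (s m i - s n i)) \<le> (\<Sum>i. norm (s m i - s n i))"
              by (rule sum_le_suminf[OF diff]) auto
            then show "(\<Sum>i<K. norm (s m i - s n i)) \<le> \<epsilon>" using N[OF m \<open>N \<le> n\<close>] by linarith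
          qed
        qed
        have sm: "summable (\<lambda>i. norm (s m i - x i))"
          by (rule summableI_nonneg_bounded[OF _ part]) simp
        then show ?thesis using suminf_le_const[OF sm part] by blast
      qed
      then show ?thesis by blast
    qed
    have xV: "x \<in> carrier ?V"
    proof -
      obtain m where m: "summable (\<lambda>i. norm (s m i - x i))" using close[OF zero_less_one] by blast
      have "summable (\<lambda>i. norm (s m i))" using sV[of m] by simp
      then have "summable (\<lambda>i. norm (s m i) + norm (s m i - x i))" using m by (rule summable_add)
      moreover have "norm (x i) \<le> norm (s m i) + norm (s m i - x i)" for i
        using norm_triangle_ineq4[of "s m i" "s m i - x i"] by simp
      ultimately have "summable (\<lambda>i. norm (x i))"
        using summable_comparison_test'[of "\<lambda>i. norm (s m i) + norm (s m i - x i)" 0 "\<lambda>i. norm (x i)"]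
        by simp
      then show ?thesis by simp
    qed
    have "(\<lambda>m. vdist ?V (s m) x) \<longlonglongrightarrow> 0"
    proof (rule LIMSEQ_I)
      fix \<epsilon> :: real assume "0 < \<epsilon>"
      then obtain N where N: "\<And>m. N \<le> m \<Longrightarrow> (\<Sum>i. norm (s m i - x i)) \<le> \<epsilon> / 2"
        using close[of "\<epsilon> / 2"] by auto
      have "vdist ?V (s m) x = (\<Sum>i. norm (s m i - x i))" for m
        by (simp only: vdist_eq[OF sV xV] minus[OF sV xV] ell1_simps)
      then have "norm (vdist ?V (s m) x - 0) < \<epsilon>" if "N \<le> m" for m
        using N[OF that] nonneg[of "s m" x] \<open>0 < \<epsilon>\<close> by simp
      then show "\<exists>N. \<forall>m\<ge>N. norm (vdist ?V (s m) x - 0) < \<epsilon>" by blast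
    qed
    then show "\<exists>x. limitin mtopology s x sequentially"
      unfolding limitin_norm_topology_iff using sV xV by (intro exI[of _ x]) simp
  qed
  then show ?thesis by (simp add: banach_space_def normed_space_ell1)
qed

text \<open>
  The structure of \<open>V\<close> transported along an injection \<open>j\<close>, so that \<open>\<ell>\<^sub>1\<close> appears among the spaces on
  any type that is large enough.
\<close>

definition isometric_copy :: "('v \<Rightarrow> 'w) \<Rightarrow> ('k, 'v) nspace \<Rightarrow> ('k, 'w) nspace" where
  "isometric_copy j V =
     \<lparr>carrier = j ` carrier V, mult = undefined, one = undefined, zero = j \<zero>\<^bsub>V\<^esub>,
      add = (\<lambda>x y. j (inv_into UNIV j x \<oplus>\<^bsub>V\<^esub> inv_into UNIV j y)),
      smult = (\<lambda>c x. j (c \<odot>\<^bsub>V\<^esub> inv_into UNIV j x)), vnorm = (\<lambda>x. vnorm V (inv_into UNIV j x))\<rparr>"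

lemma isometric_copy_simps:
  assumes "inj j"
  shows "carrier (isometric_copy j V) = j ` carrier V" "\<zero>\<^bsub>isometric_copy j V\<^esub> = j \<zero>\<^bsub>V\<^esub>"
    "j x \<oplus>\<^bsub>isometric_copy j V\<^esub> j y = j (x \<oplus>\<^bsub>V\<^esub> y)" "c \<odot>\<^bsub>isometric_copy j V\<^esub> j x = j (c \<odot>\<^bsub>V\<^esub> x)"
    "vnorm (isometric_copy j V) (j x) = vnorm V x"
  using assms by (simp_all add: isometric_copy_def)

lemma normed_space_isometric_copy:
  assumes j: "inj j" and V: "normed_space V"
  shows "normed_space (isometric_copy j V)"
proof -
  interpret normed_space V by (rule V)
  show ?thesis
    by (rule normed_spaceI)
      (auto simp: isometric_copy_simps[OF j] M.a_ac smult_add_left smult_add_right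
        smult_smult vnorm_eq_0 vnorm_triangle vnorm_smult)
qed

lemma banach_space_isometric_copy:
  assumes j: "inj j" and B: "banach_space V"
  shows "banach_space (isometric_copy j V)"
proof -
  have V: "normed_space V" using B by (simp add: banach_space_def)
  let ?W = "isometric_copy j V"
  interpret V: normed_space V by (rule V)
  interpret W: normed_space ?W by (rule normed_space_isometric_copy[OF j V])
  interpret VM: Metric_space "carrier V" "vdist V" by (rule V.Metric_space_vdist)
  interpret WM: Metric_space "carrier ?W" "vdist ?W" by (rule W.Metric_space_vdist)
  note simps = isometric_copy_simps[OF j]
  have vdist: "vdist ?W (j x) (j y) = vdist V x y" if "x \<in> carrier V" "y \<in> carrier V" for x y
    using that by (simp add: simps V.minus_eq_smult W.minus_eq_smult)
  have "WM.mcomplete"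
    unfolding WM.mcomplete_def
  proof (intro allI impI)
    fix \<sigma> assume \<sigma>: "WM.MCauchy \<sigma>"
    then have "range \<sigma> \<subseteq> carrier ?W" unfolding WM.MCauchy_def by blast
    then have "\<forall>n. \<exists>x\<in>carrier V. \<sigma> n = j x" unfolding simps by blast
    then obtain s where s: "\<And>n. s n \<in> carrier V" "\<And>n. \<sigma> n = j (s n)" by metis
    have "VM.MCauchy s" using \<sigma> s by (auto simp: WM.MCauchy_def VM.MCauchy_def vdist)
    then obtain l where "limitin VM.mtopology s l sequentially"
      using B by (auto simp: banach_space_def VM.mcomplete_def)
    then have "limitin WM.mtopology \<sigma> (j l) sequentially"
      unfolding V.limitin_norm_topology_iff W.limitin_norm_topology_iff
      using s by (auto simp: simps vdist simp del: V.vdist_eq W.vdist_eq)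
    then show "\<exists>x. limitin WM.mtopology \<sigma> x sequentially" by blast
  qed
  then show ?thesis by (simp add: banach_space_def W.normed_space_axioms)
qed

lemma ell1_coordinates_isometric_copy:
  assumes j: "inj j"
  shows "ell1_coordinates (isometric_copy j ell1) (inv_into UNIV j)"
  using ell1_coordinates_ell1 j unfolding ell1_coordinates_def
  by (auto simp: isometric_copy_simps[OF j])

text \<open>
  A real number is coded by a set of natural numbers, a scalar by two reals (its real part and that of
  its product with \<open>\<iota>\<close>), so a sequence of scalars by countably many sets of natural numbers.  These are
  interleaved into one set.
\<close>

lemma scalar_sequences_lepoll_reals:
  "(UNIV :: (nat \<Rightarrow> 'k::real_or_complex) set) \<lesssim> (UNIV :: real set)"
proof -
  obtain re :: "'k \<Rightarrow> real" and \<iota> :: 'k where dec: "\<And>x. x = of_real (re x) - \<iota> * of_real (re (\<iota> * x))"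
    by (rule real_part[where 'k = 'k]) blast
  have "(UNIV :: real set) \<lesssim> (UNIV :: nat set set)"
    by (rule eqpoll_imp_lepoll[OF eqpoll_sym[OF nat_sets_eqpoll_reals]])
  then obtain h :: "real \<Rightarrow> nat set" where h: "inj h"
    by (auto simp: lepoll_def)
  define code :: "(nat \<Rightarrow> 'k) \<Rightarrow> nat set" where
    "code x = {m. case prod_decode m of (n, i) \<Rightarrow>
       i div 2 \<in> h (if even i then re (x n) else re (\<iota> * x n))}" for x
  have "inj code"
  proof (rule injI, rule ext)
    fix x y n assume eq: "code x = code y"
    have "prod_encode (n, 2 * i) \<in> code x \<longleftrightarrow> i \<in> h (re (x n))"
      "prod_encode (n, 2 * i + 1) \<in> code x \<longleftrightarrow> i \<in> h (re (\<iota> * x n))" for x i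
      by (simp_all add: code_def)
    then have "h (re (x n)) = h (re (y n))" "h (re (\<iota> * x n)) = h (re (\<iota> * y n))"
      using eq by blast+
    then have "re (x n) = re (y n)" "re (\<iota> * x n) = re (\<iota> * y n)"
      using h by (simp_all add: inj_eq)
    then show "x n = y n" using dec[of "x n"] dec[of "y n"] by metis
  qed
  then have "(UNIV :: (nat \<Rightarrow> 'k) set) \<lesssim> (UNIV :: nat set set)" by (auto simp: lepoll_def)
  then show ?thesis using nat_sets_eqpoll_reals lepoll_trans2 by blast
qed

theorem proposition23:
  fixes E :: "('k::real_or_complex, 'e) nspace"
  assumes "banach_space E"
    and universe: "(UNIV :: real set) \<lesssim> (UNIV :: 'f set)"
  shows "(property_V_star E \<longleftrightarrow>
           (\<forall>k\<ge>1. \<forall>F :: ('k, 'f) nspace. banach_space F \<longrightarrow> P_uc_star k F E \<subseteq> P_wco k F E)) \<and>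
         (property_V_star E \<longleftrightarrow>
           (\<exists>k\<ge>1. P_uc_star k (ell1 :: ('k, nat \<Rightarrow> 'k) nspace) E \<subseteq> P_wco k ell1 E))"
proof -
  have VE: "normed_space E" using assms(1) by (simp add: banach_space_def)
  have forward: "property_V_star E \<Longrightarrow> 1 \<le> k \<Longrightarrow> banach_space F \<Longrightarrow> P_uc_star k F E \<subseteq> P_wco k F E"
    for k and F :: "('k, 'f) nspace"
    by (rule P_uc_star_subset_P_wco[OF VE]) (simp_all add: banach_space_def)
  have forward_ell1: "property_V_star E \<Longrightarrow>
      P_uc_star 1 (ell1 :: ('k, nat \<Rightarrow> 'k) nspace) E \<subseteq> P_wco 1 ell1 E"
    by (rule P_uc_star_subset_P_wco[OF VE normed_space_ell1 order_refl])
  have backward_ell1: "property_V_star E"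
    if "1 \<le> k" "P_uc_star k (ell1 :: ('k, nat \<Rightarrow> 'k) nspace) E \<subseteq> P_wco k ell1 E" for k
    by (rule property_V_star_if_P_wco[OF assms(1) normed_space_ell1 ell1_coordinates_ell1 that])
  have backward: "property_V_star E"
    if all: "\<forall>k\<ge>1. \<forall>F :: ('k, 'f) nspace. banach_space F \<longrightarrow> P_uc_star k F E \<subseteq> P_wco k F E"
  proof -
    have "(UNIV :: (nat \<Rightarrow> 'k) set) \<lesssim> (UNIV :: 'f set)"
      by (rule lepoll_trans[OF scalar_sequences_lepoll_reals universe])
    then obtain j :: "(nat \<Rightarrow> 'k) \<Rightarrow> 'f" where j: "inj j" by (auto simp: lepoll_def)
    let ?F = "isometric_copy j (ell1 :: ('k, nat \<Rightarrow> 'k) nspace)"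
    have F: "banach_space ?F" by (rule banach_space_isometric_copy[OF j banach_space_ell1])
    then have "P_uc_star 1 ?F E \<subseteq> P_wco 1 ?F E" using all by blast
    then show ?thesis
      using property_V_star_if_P_wco[OF assms(1) _ ell1_coordinates_isometric_copy[OF j] order_refl] F
      by (simp add: banach_space_def)
  qed
  show ?thesis using forward forward_ell1 backward_ell1 backward by blast
qed

end
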